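(* Let $d\ge1$ and let $(t_n)_{n\in\mathbb{Z}^d}\subset\mathbb{R}^d$ be a sequence such that the exponentials $f_n(x)=\frac{1}{(2\pi)^{d/2}}e^{i\langle x,t_n\rangle}$, $n\in\mathbb{Z}^d$, form a uniformly invertible Riesz basis for $L_2([-\pi,\pi]^d)$. Let $A>0$. For all $f\in PW_{[-\pi,\pi]^d}$, if $\Psi_\ell$ ($\ell\in\mathbb{N}$) denotes the unique polynomial of coordinate degree at most $2\ell$ with $\Psi_\ell(t_n)=f(t_n)$ for all $n\in C_{\ell,d}$, then $$\lim_{\ell\to\infty}\|f-\Psi_\ell\|_{L_2([-A(\ell+1/2)^{1/2},A(\ell+1/2)^{1/2}]^d)}=0$$ and $$\lim_{\ell\to\infty}\|f-\Psi_\ell\|_{L_\infty([-A(\ell+1/2)^{1/2},A(\ell+1/2)^{1/2}]^d)}=0.$$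
   Context: $\mathbb{N}=\{1,2,\dots\}$. $C_{\ell,d}=\{-\ell,\dots,\ell\}^d$. A polynomial on $\mathbb{R}^d$ (complex coefficients) has coordinate degree at most $2\ell$ if its degree in each single coordinate variable is at most $2\ell$. Under the stated hypothesis the interpolating polynomials $\Psi_\ell$ exist and are unique. $PW_{[-\pi,\pi]^d}$ is the space of $f\in L_2(\mathbb{R}^d)$ (complex-valued) whose (inverse) Fourier transform is supported in $[-\pi,\pi]^d$, with the $L_2(\mathbb{R}^d)$ norm; its elements are identified with their continuous representatives. Let $e_n(x)=\frac{1}{(2\pi)^{d/2}}e^{i\langle x,n\rangle}$, an orthonormal basis of $L_2([-\pi,\pi]^d)$, and let $P_\ell$ be the orthogonal projection onto $\mathrm{span}\{e_n: n\in C_{\ell,d}\}$. A Riesz basis is the image of an orthonormal basis under a bounded linear bijection with bounded inverse. $(f_n)_{n\in\mathbb{Z}^d}$ is a uniformly invertible Riesz basis if the linear map $L$ with $Le_n=f_n$ is a bounded bijection of $L_2([-\pi,\pi]^d)$ with bounded inverse, for every $\ell\in\mathbb{N}$ the compression $P_\ell L P_\ell$ is invertible as an operator on the finite-dimensional space $\mathrm{ran}\,P_\ell$, and $\sup_{\ell\in\mathbb{N}}\|(P_\ell L P_\ell)^{-1}\|<\infty$. *)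

theory Defs
  imports "HOL-Analysis.Analysis" "HOL-Probability.Essential_Supremum"
begin

text \<open>
  \<open>L\<^sub>2\<close> spaces are handled through representatives: elements are complex-valued functions on
  all of \<open>\<real>\<^sup>d\<close>, only their values on \<open>S\<close> matter, and equality is equality almost everywhere on \<open>S\<close>.
\<close>

definition L2 :: "(real^'d) set \<Rightarrow> (real^'d \<Rightarrow> complex) set" where
  "L2 S = {f. f \<in> borel_measurable (lebesgue_on S) \<and>
              integrable (lebesgue_on S) (\<lambda>x. (norm (f x))\<^sup>2)}"

definition L2_norm_on :: "(real^'d) set \<Rightarrow> (real^'d \<Rightarrow> complex) \<Rightarrow> real" where
  "L2_norm_on S f = sqrt (\<integral>x. (norm (f x))\<^sup>2 \<partial>lebesgue_on S)"

definition L2_inner_on :: "(real^'d) set \<Rightarrow> (real^'d \<Rightarrow> complex) \<Rightarrow> (real^'d \<Rightarrow> complex) \<Rightarrow> complex" where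
  "L2_inner_on S f g = (\<integral>x. f x * cnj (g x) \<partial>lebesgue_on S)"

definition Linf_norm_on :: "(real^'d) set \<Rightarrow> (real^'d \<Rightarrow> complex) \<Rightarrow> ereal" where
  "Linf_norm_on S f = esssup (lebesgue_on S) (\<lambda>x. ereal (norm (f x)))"

definition ae_eq_on :: "(real^'d) set \<Rightarrow> (real^'d \<Rightarrow> complex) \<Rightarrow> (real^'d \<Rightarrow> complex) \<Rightarrow> bool" where
  "ae_eq_on S f g \<longleftrightarrow> (AE x in lebesgue_on S. f x = g x)"

text \<open>
  Bounded (complex-)linear operators on \<open>L\<^sub>2(S)\<close>. Compatibility with almost-everywhere equality
  is not listed separately since it follows from linearity and boundedness.
\<close>

definition L2_bounded_linear ::
    "(real^'d) set \<Rightarrow> ((real^'d \<Rightarrow> complex) \<Rightarrow> (real^'d \<Rightarrow> complex)) \<Rightarrow> bool" where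
  "L2_bounded_linear S T \<longleftrightarrow>
     (\<forall>f\<in>L2 S. T f \<in> L2 S) \<and>
     (\<forall>f\<in>L2 S. \<forall>g\<in>L2 S. ae_eq_on S (T (\<lambda>x. f x + g x)) (\<lambda>x. T f x + T g x)) \<and>
     (\<forall>c. \<forall>f\<in>L2 S. ae_eq_on S (T (\<lambda>x. c * f x)) (\<lambda>x. c * T f x)) \<and>
     (\<exists>C. \<forall>f\<in>L2 S. L2_norm_on S (T f) \<le> C * L2_norm_on S f)"

definition L2_bounded_bijection ::
    "(real^'d) set \<Rightarrow> ((real^'d \<Rightarrow> complex) \<Rightarrow> (real^'d \<Rightarrow> complex)) \<Rightarrow> bool" where
  "L2_bounded_bijection S T \<longleftrightarrow>
     L2_bounded_linear S T \<and>
     (\<exists>T'. L2_bounded_linear S T' \<and>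
           (\<forall>f\<in>L2 S. ae_eq_on S (T' (T f)) f \<and> ae_eq_on S (T (T' f)) f))"

definition cube :: "real \<Rightarrow> (real^'d) set" where
  "cube r = cbox (\<chi> i. - r) (\<chi> i. r)"

definition index_cube :: "nat \<Rightarrow> (int^'d) set" where
  "index_cube l = {n. \<forall>i. - int l \<le> n $ i \<and> n $ i \<le> int l}"

definition exponential :: "real^'d \<Rightarrow> real^'d \<Rightarrow> complex" where
  "exponential s x =
     complex_of_real (1 / (2 * pi) powr (real CARD('d) / 2)) * exp (\<i> * complex_of_real (x \<bullet> s))"

definition lattice_exp :: "int^'d \<Rightarrow> real^'d \<Rightarrow> complex" where
  "lattice_exp n = exponential (\<chi> i. real_of_int (n $ i))"

text \<open>
  The span of the \<open>lattice_exp n\<close>, \<open>n \<in> index_cube l\<close>. Two trigonometric polynomials that agree almost everywhere on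
  \<open>cube pi\<close> are equal as functions on \<open>\<real>\<^sup>d\<close>, so this set of functions represents the
  finite-dimensional subspace of \<open>L\<^sub>2(cube pi)\<close> faithfully.
\<close>

definition trig_polys :: "nat \<Rightarrow> (real^'d \<Rightarrow> complex) set" where
  "trig_polys l = {g. \<exists>c. g = (\<lambda>x. \<Sum>n\<in>index_cube l. c n * lattice_exp n x)}"

definition trig_proj :: "nat \<Rightarrow> (real^'d \<Rightarrow> complex) \<Rightarrow> (real^'d \<Rightarrow> complex)" where
  "trig_proj l f = (THE g. g \<in> trig_polys l \<and>
     (\<forall>h\<in>trig_polys l. L2_inner_on (cube pi) (\<lambda>x. f x - g x) h = 0))"

definition compression ::
    "nat \<Rightarrow> ((real^'d \<Rightarrow> complex) \<Rightarrow> (real^'d \<Rightarrow> complex)) \<Rightarrow> (real^'d \<Rightarrow> complex) \<Rightarrow> (real^'d \<Rightarrow> complex)" where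
  "compression l T f = trig_proj l (T (trig_proj l f))"

definition trig_op_norm ::
    "nat \<Rightarrow> ((real^'d \<Rightarrow> complex) \<Rightarrow> (real^'d \<Rightarrow> complex)) \<Rightarrow> ereal" where
  "trig_op_norm l T =
     (SUP g\<in>{g \<in> trig_polys l. L2_norm_on (cube pi) g \<le> 1}. ereal (L2_norm_on (cube pi) (T g)))"

definition uniformly_invertible_Riesz_basis :: "(int^'d \<Rightarrow> real^'d \<Rightarrow> complex) \<Rightarrow> bool" where
  "uniformly_invertible_Riesz_basis F \<longleftrightarrow>
     (\<exists>L. L2_bounded_bijection (cube pi) L \<and>
          (\<forall>n. ae_eq_on (cube pi) (L (lattice_exp n)) (F n)) \<and>
          (\<forall>l\<ge>1. bij_betw (compression l L) (trig_polys l) (trig_polys l)) \<and>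
          (SUP l\<in>{1..}. trig_op_norm l (inv_into (trig_polys l) (compression l L))) < \<infinity>)"

text \<open>
  The unitary inverse Fourier transform: the integral formula on \<open>L\<^sub>1\<close>, and its extension by
  continuity from \<open>L\<^sub>1 \<inter> L\<^sub>2\<close> to \<open>L\<^sub>2\<close>, as a relation.
\<close>

definition inv_fourier_L1 :: "(real^'d \<Rightarrow> complex) \<Rightarrow> real^'d \<Rightarrow> complex" where
  "inv_fourier_L1 f \<xi> = (\<integral>x. f x * exponential \<xi> x \<partial>lebesgue)"

definition has_inv_fourier :: "(real^'d \<Rightarrow> complex) \<Rightarrow> (real^'d \<Rightarrow> complex) \<Rightarrow> bool" where
  "has_inv_fourier f g \<longleftrightarrow> f \<in> L2 UNIV \<and> g \<in> L2 UNIV \<and>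
     (\<exists>\<phi>::nat \<Rightarrow> real^'d \<Rightarrow> complex.
        (\<forall>k. integrable lebesgue (\<phi> k) \<and> \<phi> k \<in> L2 UNIV \<and> inv_fourier_L1 (\<phi> k) \<in> L2 UNIV) \<and>
        (\<lambda>k. L2_norm_on UNIV (\<lambda>x. \<phi> k x - f x)) \<longlonglongrightarrow> 0 \<and>
        (\<lambda>k. L2_norm_on UNIV (\<lambda>\<xi>. inv_fourier_L1 (\<phi> k) \<xi> - g \<xi>)) \<longlonglongrightarrow> 0)"

text \<open>
  Continuity selects the continuous representative. For closed \<open>S\<close>, vanishing almost everywhere
  outside \<open>S\<close> says that the (essential) support is contained in \<open>S\<close>.
\<close>

definition Paley_Wiener :: "(real^'d) set \<Rightarrow> (real^'d \<Rightarrow> complex) set" where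
  "Paley_Wiener S = {f. continuous_on UNIV f \<and>
     (\<exists>g. has_inv_fourier f g \<and> (AE \<xi> in lebesgue. \<xi> \<notin> S \<longrightarrow> g \<xi> = 0))}"

definition coord_polys :: "nat \<Rightarrow> (real^'d \<Rightarrow> complex) set" where
  "coord_polys m = {p. \<exists>c. p = (\<lambda>x. \<Sum>k\<in>{k::nat^'d. \<forall>i. k $ i \<le> m}.
                                   c k * complex_of_real (\<Prod>i\<in>UNIV. (x $ i) ^ (k $ i)))}"

definition interpolates ::
    "(int^'d \<Rightarrow> real^'d) \<Rightarrow> (real^'d \<Rightarrow> complex) \<Rightarrow> nat \<Rightarrow> (real^'d \<Rightarrow> complex) \<Rightarrow> bool" where
  "interpolates t f l p \<longleftrightarrow> p \<in> coord_polys (2 * l) \<and> (\<forall>n\<in>index_cube l. p (t n) = f (t n))"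

definition interp_poly ::
    "(int^'d \<Rightarrow> real^'d) \<Rightarrow> (real^'d \<Rightarrow> complex) \<Rightarrow> nat \<Rightarrow> (real^'d \<Rightarrow> complex)" where
  "interp_poly t f l = (THE p. interpolates t f l p)"

end

theory Submission
  imports Defs "HOL-Probability.Probability"
begin

text \<open>
Write \<open>L\<close> for the operator with \<open>L e\<^sub>n = f\<^sub>n\<close>, where \<open>e\<^sub>n\<close> and \<open>f\<^sub>n\<close> are the exponentials with
frequencies \<open>n\<close> and \<open>t n\<close>, and \<open>P\<^sub>l\<close> for the orthogonal projection onto the trigonometric
polynomials \<open>T\<^sub>l\<close>. For \<open>u\<close> in \<open>L\<^sub>2\<close> of the cube let \<open>hat u\<close> be its Fourier transform,
so that \<open>hat u (t n) = \<langle>u, f\<^sub>n\<rangle>\<close>. A function \<open>f\<close> of the Paley--Wiener space is \<open>hat g\<close> for some \<open>g\<close>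
(\<open>Paley_Wiener_hat\<close>).

From polynomials to trigonometric polynomials. The product formula for the sine gives
\<open>sin (\<pi>t) = \<pi>t (1 - t\<^sup>2/1\<^sup>2) \<dots> (1 - t\<^sup>2/l\<^sup>2) R\<^sub>l(t)\<close> with the tail \<open>R\<^sub>l(t) = \<Prod>\<^bsub>k>l\<^esub> (1 - t\<^sup>2/k\<^sup>2)\<close>.
Hence \<open>R\<^sub>l\<close> times the Lagrange basis polynomial of a node \<open>k\<close> among \<open>-l, \<dots>, l\<close> is a multiple of
\<open>sin (\<pi>(t - k)) / (\<pi>(t - k))\<close>, the transform of \<open>e\<^sub>k\<close>. In \<open>d\<close> variables, with
\<open>R\<^sub>l(x) = \<Prod>\<^sub>i R\<^sub>l(x\<^sub>i)\<close>, the functions \<open>R\<^sub>l p\<close> for \<open>p\<close> of coordinate degree at most \<open>2l\<close> are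
exactly the functions \<open>hat h\<close> for \<open>h\<close> in \<open>T\<^sub>l\<close> (\<open>tail_prod_coord_poly\<close>, \<open>trig_poly_coord_poly\<close>).

Interpolation as a linear system. The condition \<open>p (t n) = f (t n)\<close> on the index cube becomes
\<open>\<langle>h, L e\<^sub>n\<rangle> = R\<^sub>l(t n) \<langle>g, L e\<^sub>n\<rangle>\<close>, a linear system for \<open>h\<close> in \<open>T\<^sub>l\<close> whose operator is the adjoint of the
compression \<open>P\<^sub>l L P\<^sub>l\<close>. As the compression is bijective, the system is uniquely solvable for every
right-hand side. Solvability also forces \<open>R\<^sub>l(t n) \<noteq> 0\<close>: the value of \<open>R\<^sub>l p\<close> at \<open>t n\<close> can be prescribed
to be \<open>1\<close>. So the interpolating polynomial exists and is unique (\<open>interpolation_unique_existence\<close>).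

Convergence of the transforms. Let \<open>h\<^sub>l\<close> be the trigonometric polynomial that belongs to the
interpolating polynomial \<open>\<Psi>\<^sub>l\<close>. Testing \<open>h\<^sub>l - P\<^sub>l g\<close> against \<open>L y\<close> with
\<open>y = (P\<^sub>l L P\<^sub>l)\<^sup>-\<^sup>1 (h\<^sub>l - P\<^sub>l g)\<close>, whose norm is controlled uniformly in \<open>l\<close>, bounds
\<open>\<parallel>h\<^sub>l - P\<^sub>l g\<parallel>\<close> by \<open>\<parallel>g - P\<^sub>l g\<parallel>\<close> and the \<open>\<ell>\<^sub>2\<close> norm of \<open>(R\<^sub>l(t n) - 1) \<langle>g, f\<^sub>n\<rangle>\<close>. The former tends to \<open>0\<close>
because the \<open>e\<^sub>n\<close> are complete (\<open>fourier_sum_converges\<close>), the latter because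
\<open>|R\<^sub>l| \<le> 1\<close>, \<open>R\<^sub>l \<rightarrow> 1\<close> pointwise and the samples \<open>\<langle>g, f\<^sub>n\<rangle>\<close> are square summable.
Hence \<open>h\<^sub>l \<rightarrow> g\<close> (\<open>perturbed_projection_converges\<close>), and \<open>f - R\<^sub>l \<Psi>\<^sub>l = hat (g - h\<^sub>l)\<close> tends to \<open>0\<close> uniformly
and in \<open>L\<^sub>2\<close> (\<open>norm_hat_le\<close>, \<open>norm_hat_cube_le\<close>).

Removing the tail. On the cube of half-width \<open>A (l + 1/2)\<^bsup>1/2\<^esup>\<close> the tail \<open>R\<^sub>l\<close> stays between a positive
constant and \<open>1\<close>, because \<open>R\<^sub>l(s) \<ge> exp (- 2 s\<^sup>2 / l)\<close> there. In
\<open>f - \<Psi>\<^sub>l = f (1 - 1/R\<^sub>l) + (f - R\<^sub>l \<Psi>\<^sub>l) / R\<^sub>l\<close> the second term is therefore harmless. The first term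
tends to \<open>0\<close> in \<open>L\<^sub>2\<close> by dominated convergence, and uniformly because \<open>R\<^sub>l \<rightarrow> 1\<close> uniformly on fixed
cubes while \<open>f\<close> vanishes at infinity (\<open>hat_vanishes\<close>). These two steps are \<open>remove_tail_L2\<close> and
\<open>remove_tail_Linf\<close>.
\<close>

section \<open>The Hilbert spaces \<open>L\<^sub>2(S)\<close>\<close>

lemma L2_measurable: "f \<in> L2 S \<Longrightarrow> f \<in> borel_measurable (lebesgue_on S)"
  and L2_integrable: "f \<in> L2 S \<Longrightarrow> integrable (lebesgue_on S) (\<lambda>x. (norm (f x))\<^sup>2)"
  by (auto simp: L2_def)

text \<open>
Complex conjugation is continuous; declaring this to the measurability prover lets it treat the
integrands of inner products.
\<close>

lemma borel_measurable_cnj [measurable (raw)]: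
  "f \<in> borel_measurable M \<Longrightarrow> (\<lambda>x. cnj (f x)) \<in> borel_measurable M"
  by (rule measurable_compose[OF _ borel_measurable_continuous_onI]) (auto intro: continuous_intros)

lemma L2_norm_nonneg [simp]: "0 \<le> L2_norm_on S f"
  by (simp add: L2_norm_on_def)

lemma L2_norm_square: "(L2_norm_on S f)\<^sup>2 = (\<integral>x. (norm (f x))\<^sup>2 \<partial>lebesgue_on S)"
  by (simp add: L2_norm_on_def)

lemma L2_scale:
  assumes "f \<in> L2 S" shows "(\<lambda>x. c * f x) \<in> L2 S"
  using assms by (auto simp: L2_def norm_mult power_mult_distrib)

lemma L2_norm_scale: "L2_norm_on S (\<lambda>x. c * f x) = cmod c * L2_norm_on S f"
  by (simp add: L2_norm_on_def norm_mult power_mult_distrib real_sqrt_mult)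

lemma norm_add_square_le:
  fixes a b :: "'a::real_normed_vector"
  shows "(norm (a + b))\<^sup>2 \<le> 2 * (norm a)\<^sup>2 + 2 * (norm b)\<^sup>2"
proof -
  have "(norm (a + b))\<^sup>2 \<le> (norm a + norm b)\<^sup>2" by (intro power_mono norm_triangle_ineq) simp
  also have "\<dots> \<le> 2 * (norm a)\<^sup>2 + 2 * (norm b)\<^sup>2"
    using zero_le_power2[of "norm a - norm b"] by (simp add: power2_eq_square algebra_simps)
  finally show ?thesis .
qed

lemma L2_dominated:
  assumes "g \<in> borel_measurable (lebesgue_on S)" "f \<in> L2 S" "\<And>x. x \<in> S \<Longrightarrow> norm (g x) \<le> C * norm (f x)"
  shows "g \<in> L2 S"
proof -
  have "integrable (lebesgue_on S) (\<lambda>x. (norm (g x))\<^sup>2)"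
  proof (rule Bochner_Integration.integrable_bound)
    show "integrable (lebesgue_on S) (\<lambda>x. C\<^sup>2 * (norm (f x))\<^sup>2)"
      using assms(2) by (auto simp: L2_def)
    show "AE x in lebesgue_on S. norm ((norm (g x))\<^sup>2) \<le> norm (C\<^sup>2 * (norm (f x))\<^sup>2)"
    proof (rule AE_I2)
      fix x assume "x \<in> space (lebesgue_on S)"
      then have "(norm (g x))\<^sup>2 \<le> (C * norm (f x))\<^sup>2" using assms(3) by (intro power_mono) auto
      then show "norm ((norm (g x))\<^sup>2) \<le> norm (C\<^sup>2 * (norm (f x))\<^sup>2)" by (simp add: power_mult_distrib)
    qed
  qed (use assms(1) in measurable)
  with assms(1) show ?thesis by (simp add: L2_def)
qed

lemma L2_add:
  assumes "f \<in> L2 S" "g \<in> L2 S" shows "(\<lambda>x. f x + g x) \<in> L2 S"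
proof -
  have [measurable]: "f \<in> borel_measurable (lebesgue_on S)" "g \<in> borel_measurable (lebesgue_on S)"
    using assms by (auto simp: L2_def)
  have "integrable (lebesgue_on S) (\<lambda>x. (norm (f x + g x))\<^sup>2)"
    by (rule Bochner_Integration.integrable_bound[where f = "\<lambda>x. 2 * (norm (f x))\<^sup>2 + 2 * (norm (g x))\<^sup>2"])
       (use assms in \<open>auto simp: L2_def norm_add_square_le\<close>)
  then show ?thesis by (simp add: L2_def)
qed

lemma L2_diff:
  assumes "f \<in> L2 S" "g \<in> L2 S" shows "(\<lambda>x. f x - g x) \<in> L2 S"
  using L2_add[OF assms(1) L2_scale[OF assms(2), of "-1"]] by simp

lemma L2_zero: "(\<lambda>x. 0) \<in> L2 S"
  by (simp add: L2_def)

lemma L2_sum: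
  assumes "\<And>i. i \<in> I \<Longrightarrow> f i \<in> L2 S" shows "(\<lambda>x. \<Sum>i\<in>I. f i x) \<in> L2 S"
  using assms
proof (induction I rule: infinite_finite_induct)
  case (insert i I)
  then show ?case using L2_add[of "f i" S "\<lambda>x. \<Sum>i\<in>I. f i x"] by simp
qed (auto simp: L2_zero)

text \<open>
From \<open>|f g| \<le> |f|\<^sup>2 + |g|\<^sup>2\<close>.
\<close>

lemma L2_inner_integrable:
  assumes "f \<in> L2 S" "g \<in> L2 S"
  shows "integrable (lebesgue_on S) (\<lambda>x. f x * cnj (g x))"
proof -
  have [measurable]: "f \<in> borel_measurable (lebesgue_on S)" "g \<in> borel_measurable (lebesgue_on S)"
    using assms by (auto simp: L2_def)
  have le: "a * b \<le> a\<^sup>2 + b\<^sup>2" if "0 \<le> a" "0 \<le> b" for a b :: real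
    using zero_le_power2[of "a - b"] mult_nonneg_nonneg[OF that]
    by (simp add: power2_eq_square algebra_simps)
  show ?thesis
    by (rule Bochner_Integration.integrable_bound[where f = "\<lambda>x. (norm (f x))\<^sup>2 + (norm (g x))\<^sup>2"])
       (use assms in \<open>auto simp: L2_def norm_mult intro!: le\<close>)
qed

lemma L2_inner_add_left:
  assumes "f \<in> L2 S" "g \<in> L2 S" "h \<in> L2 S"
  shows "L2_inner_on S (\<lambda>x. f x + g x) h = L2_inner_on S f h + L2_inner_on S g h"
  using L2_inner_integrable[OF assms(1,3)] L2_inner_integrable[OF assms(2,3)]
  by (simp add: L2_inner_on_def distrib_right)

lemma L2_inner_scale_left: "L2_inner_on S (\<lambda>x. c * f x) h = c * L2_inner_on S f h"
  by (simp add: L2_inner_on_def mult.assoc)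

lemma L2_inner_cnj: "cnj (L2_inner_on S f h) = L2_inner_on S h f"
  by (simp add: L2_inner_on_def Bochner_Integration.integral_cnj[symmetric] mult.commute)

lemma L2_inner_diff_left:
  assumes "f \<in> L2 S" "g \<in> L2 S" "h \<in> L2 S"
  shows "L2_inner_on S (\<lambda>x. f x - g x) h = L2_inner_on S f h - L2_inner_on S g h"
  using L2_inner_integrable[OF assms(1,3)] L2_inner_integrable[OF assms(2,3)]
  by (simp add: L2_inner_on_def left_diff_distrib)

lemma L2_inner_sum_left:
  assumes "\<And>i. i \<in> I \<Longrightarrow> f i \<in> L2 S" "h \<in> L2 S"
  shows "L2_inner_on S (\<lambda>x. \<Sum>i\<in>I. c i * f i x) h = (\<Sum>i\<in>I. c i * L2_inner_on S (f i) h)"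
  using assms
proof (induction I rule: infinite_finite_induct)
  case (insert i I)
  then show ?case
    using L2_inner_add_left[OF L2_scale[of "f i" S "c i"] L2_sum[of I "\<lambda>i x. c i * f i x" S] assms(2)]
    by (simp add: L2_scale L2_inner_scale_left)
qed (auto simp: L2_inner_on_def)

lemma L2_inner_add_right:
  assumes "f \<in> L2 S" "g \<in> L2 S" "h \<in> L2 S"
  shows "L2_inner_on S h (\<lambda>x. f x + g x) = L2_inner_on S h f + L2_inner_on S h g"
  using L2_inner_add_left[OF assms] by (metis L2_inner_cnj complex_cnj_add)

lemma L2_inner_scale_right: "L2_inner_on S h (\<lambda>x. c * f x) = cnj c * L2_inner_on S h f"
  by (metis L2_inner_cnj L2_inner_scale_left complex_cnj_mult)

lemma L2_inner_sum_right:
  assumes "\<And>i. i \<in> I \<Longrightarrow> f i \<in> L2 S" "h \<in> L2 S"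
  shows "L2_inner_on S h (\<lambda>x. \<Sum>i\<in>I. c i * f i x) = (\<Sum>i\<in>I. cnj (c i) * L2_inner_on S h (f i))"
proof -
  have "L2_inner_on S h (\<lambda>x. \<Sum>i\<in>I. c i * f i x) = cnj (L2_inner_on S (\<lambda>x. \<Sum>i\<in>I. c i * f i x) h)"
    by (simp add: L2_inner_cnj)
  also have "\<dots> = (\<Sum>i\<in>I. cnj (c i) * L2_inner_on S h (f i))"
    using assms by (subst L2_inner_sum_left) (auto simp: L2_inner_cnj)
  finally show ?thesis .
qed

lemma L2_inner_self: "L2_inner_on S f f = complex_of_real ((L2_norm_on S f)\<^sup>2)"
proof -
  have "L2_inner_on S f f = (\<integral>x. complex_of_real ((norm (f x))\<^sup>2) \<partial>lebesgue_on S)"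
    by (simp add: L2_inner_on_def complex_norm_square[symmetric])
  then show ?thesis by (simp only: integral_complex_of_real L2_norm_square)
qed

lemma L2_norm_add_square:
  assumes "f \<in> L2 S" "g \<in> L2 S"
  shows "(L2_norm_on S (\<lambda>x. f x + g x))\<^sup>2
    = (L2_norm_on S f)\<^sup>2 + (L2_norm_on S g)\<^sup>2 + 2 * Re (L2_inner_on S f g)"
proof -
  have "L2_inner_on S g f = cnj (L2_inner_on S f g)" by (simp add: L2_inner_cnj)
  then have "complex_of_real ((L2_norm_on S (\<lambda>x. f x + g x))\<^sup>2)
     = complex_of_real ((L2_norm_on S f)\<^sup>2 + (L2_norm_on S g)\<^sup>2) + (L2_inner_on S f g + cnj (L2_inner_on S f g))"
    using assms by (simp add: L2_inner_self[symmetric] L2_inner_add_left L2_inner_add_right L2_add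
      del: of_real_power)
  also have "L2_inner_on S f g + cnj (L2_inner_on S f g) = complex_of_real (2 * Re (L2_inner_on S f g))"
    by (rule complex_add_cnj)
  finally show ?thesis by (simp only: of_real_add[symmetric] of_real_eq_iff)
qed

text \<open>
With \<open>z = \<langle>f, g\<rangle>\<close>, expand \<open>\<parallel>s f - r z g\<parallel>\<^sup>2 \<ge> 0\<close> for real \<open>s\<close> and \<open>r\<close>. The choice
\<open>s = \<parallel>g\<parallel>\<^sup>2\<close>, \<open>r = 1\<close> gives the inequality when \<open>\<parallel>g\<parallel> \<noteq> 0\<close>; when \<open>\<parallel>g\<parallel> = 0\<close>, letting \<open>r\<close> grow with
\<open>s = 1\<close> forces \<open>z = 0\<close>.
\<close>

lemma L2_Cauchy_Schwarz:
  assumes f: "f \<in> L2 S" and g: "g \<in> L2 S"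
  shows "cmod (L2_inner_on S f g) \<le> L2_norm_on S f * L2_norm_on S g"
proof -
  define z where "z = L2_inner_on S f g"
  define a where "a = L2_norm_on S f"
  define b where "b = L2_norm_on S g"
  have ab: "a \<ge> 0" "b \<ge> 0" by (auto simp: a_def b_def)
  \<comment> \<open>the expanded form of \<open>\<parallel>s f - r z g\<parallel>\<^sup>2 \<ge> 0\<close>\<close>
  have main: "0 \<le> s\<^sup>2 * a\<^sup>2 + r\<^sup>2 * (cmod z)\<^sup>2 * b\<^sup>2 - 2 * s * r * (cmod z)\<^sup>2" for s r :: real
  proof -
    have "0 \<le> (L2_norm_on S (\<lambda>x. of_real s * f x + (- of_real r * z) * g x))\<^sup>2" by simp
    also have "\<dots> = s\<^sup>2 * a\<^sup>2 + r\<^sup>2 * (cmod z)\<^sup>2 * b\<^sup>2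
        + 2 * Re (of_real s * (- of_real r * cnj z) * z)"
      by (subst L2_norm_add_square[OF L2_scale[OF f] L2_scale[OF g]])
         (simp only: L2_norm_scale L2_inner_scale_left L2_inner_scale_right a_def b_def z_def
           norm_mult power_mult_distrib norm_minus_cancel norm_of_real power2_abs
           complex_cnj_mult complex_cnj_minus complex_cnj_complex_of_real mult.assoc)
    also have "of_real s * (- of_real r * cnj z) * z = of_real (- s * r * (cmod z)\<^sup>2)"
      by (simp only: of_real_mult of_real_minus complex_norm_square) (simp add: mult_ac)
    finally show ?thesis by simp
  qed
  have "(cmod z)\<^sup>2 \<le> (a * b)\<^sup>2"
  proof (cases "b = 0")
    case True
    show ?thesis
    proof (rule ccontr)
      assume "\<not> ?thesis"
      then have z: "(cmod z)\<^sup>2 > 0" using True by simp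
      have "2 * ((a\<^sup>2 + 1) / (cmod z)\<^sup>2) * (cmod z)\<^sup>2 \<le> a\<^sup>2"
        \<comment> \<open>this \<open>r\<close> makes the quadratic form equal to \<open>a\<^sup>2 - 2 (a\<^sup>2 + 1)\<close>\<close>
        using main[of 1 "(a\<^sup>2 + 1) / (cmod z)\<^sup>2"] True by simp
      then have "2 * (a\<^sup>2 + 1) \<le> a\<^sup>2" using z by simp
      moreover obtain q where "q = a\<^sup>2" "0 \<le> q" by simp
      ultimately show False by simp
    qed
  next
    case False
    then have b: "b\<^sup>2 > 0" by simp
    have "0 \<le> b\<^sup>2 * (a\<^sup>2 * b\<^sup>2 - (cmod z)\<^sup>2)"
      using main[of "b\<^sup>2" 1] by (simp add: power2_eq_square algebra_simps)
    then show ?thesis using b by (simp add: zero_le_mult_iff power_mult_distrib)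
  qed
  from power2_le_imp_le[OF this] ab show ?thesis unfolding z_def a_def b_def by simp
qed

lemma L2_norm_triangle:
  assumes f: "f \<in> L2 S" and g: "g \<in> L2 S"
  shows "L2_norm_on S (\<lambda>x. f x + g x) \<le> L2_norm_on S f + L2_norm_on S g"
proof (rule power2_le_imp_le)
  have "Re (L2_inner_on S f g) \<le> L2_norm_on S f * L2_norm_on S g"
    by (rule order_trans[OF complex_Re_le_cmod L2_Cauchy_Schwarz[OF f g]])
  then show "(L2_norm_on S (\<lambda>x. f x + g x))\<^sup>2 \<le> (L2_norm_on S f + L2_norm_on S g)\<^sup>2"
    using L2_norm_add_square[OF f g] by (simp add: power2_sum)
qed simp

lemma L2_norm_triangle_diff:
  assumes f: "f \<in> L2 S" and g: "g \<in> L2 S"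
  shows "L2_norm_on S (\<lambda>x. f x - g x) \<le> L2_norm_on S f + L2_norm_on S g"
  using L2_norm_triangle[OF f L2_scale[OF g, of "-1"]] unfolding L2_norm_scale by simp

lemma L2_norm_cong_AE:
  assumes "f \<in> borel_measurable (lebesgue_on S)" "g \<in> borel_measurable (lebesgue_on S)" "ae_eq_on S f g"
  shows "L2_norm_on S f = L2_norm_on S g"
  using assms unfolding L2_norm_on_def ae_eq_on_def
  by (intro arg_cong[where f = sqrt] integral_cong_AE) auto

lemma L2_inner_cong_AE:
  assumes "f \<in> L2 S" "g \<in> L2 S" "ae_eq_on S f g" "h \<in> L2 S"
  shows "L2_inner_on S h f = L2_inner_on S h g"
  unfolding L2_inner_on_def
proof (rule integral_cong_AE)
  have [measurable]: "f \<in> borel_measurable (lebesgue_on S)" "g \<in> borel_measurable (lebesgue_on S)"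
    "h \<in> borel_measurable (lebesgue_on S)" using assms by (auto simp: L2_def)
  show "(\<lambda>x. h x * cnj (f x)) \<in> borel_measurable (lebesgue_on S)" by measurable
  show "(\<lambda>x. h x * cnj (g x)) \<in> borel_measurable (lebesgue_on S)" by measurable
  show "AE x in lebesgue_on S. h x * cnj (f x) = h x * cnj (g x)"
    using assms(3) unfolding ae_eq_on_def by eventually_elim simp
qed

lemma L2_mono_set:
  assumes "T \<subseteq> S" "T \<in> sets lebesgue" "S \<in> sets lebesgue" "f \<in> L2 S"
  shows "f \<in> L2 T" "L2_norm_on T f \<le> L2_norm_on S f"
proof -
  have i: "integrable lebesgue (\<lambda>x. indicator S x *\<^sub>R (norm (f x))\<^sup>2)"
    using assms by (simp add: L2_def integrable_restrict_space)
  have "integrable lebesgue (\<lambda>x. indicator T x *\<^sub>R (indicator S x *\<^sub>R (norm (f x))\<^sup>2))"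
    by (rule integrable_mult_indicator[OF assms(2) i])
  also have "(\<lambda>x. indicator T x *\<^sub>R (indicator S x *\<^sub>R (norm (f x))\<^sup>2)) =
      (\<lambda>x. indicator T x *\<^sub>R (norm (f x))\<^sup>2)"
    using assms(1) by (auto simp: indicator_def fun_eq_iff)
  finally have i': "integrable lebesgue (\<lambda>x. indicator T x *\<^sub>R (norm (f x))\<^sup>2)" .
  have "f \<in> borel_measurable (lebesgue_on T)"
    by (rule measurable_restrict_mono[OF L2_measurable[OF assms(4)] assms(1)])
  then show "f \<in> L2 T" using i' assms(2) by (simp add: L2_def integrable_restrict_space)
  have "(\<integral>x. indicator T x *\<^sub>R (norm (f x))\<^sup>2 \<partial>lebesgue) \<le> (\<integral>x. indicator S x *\<^sub>R (norm (f x))\<^sup>2 \<partial>lebesgue)"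
    using assms(1) by (intro integral_mono i i') (auto simp: indicator_def)
  then show "L2_norm_on T f \<le> L2_norm_on S f"
    using assms(2,3) by (simp add: L2_norm_on_def integral_restrict_space)
qed

section \<open>The tail of the product formula for the sine\<close>

definition sincpi :: "real \<Rightarrow> real" where
  "sincpi x = sinc (pi * x)"

text \<open>
This is the tail \<open>\<Prod>\<^bsub>k>l\<^esub> (1 - t\<^sup>2/k\<^sup>2)\<close> of the product formula for the sine. Through the entire reciprocal
Gamma function it is defined and continuous for all \<open>t\<close>, including the integers where
\<open>sin (\<pi>t)\<close> divided by the first factors of the product would read \<open>0/0\<close>.
\<close>

definition sinc_tail :: "nat \<Rightarrow> real \<Rightarrow> real" where
  "sinc_tail l t = (fact l)\<^sup>2 * rGamma (real l + 1 - t) * rGamma (real l + 1 + t)"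

lemma isCont_sincpi: "isCont sincpi x"
  unfolding sincpi_def
  by (rule isCont_o2[where g = sinc]) (auto intro!: continuous_intros isCont_sinc)

lemma abs_sincpi_le_1: "\<bar>sincpi x\<bar> \<le> 1"
  using abs_sin_x_le_abs_x[of "pi * x"] by (auto simp: sincpi_def divide_le_eq_1 abs_divide)

lemma abs_sincpi_le:
  assumes "x \<noteq> 0" shows "\<bar>sincpi x\<bar> \<le> 1 / \<bar>x\<bar>"
proof -
  have "\<bar>sin (pi * x)\<bar> \<le> pi" using abs_sin_le_one[of "pi * x"] pi_ge_two by linarith
  then show ?thesis using assms
    by (auto simp: sincpi_def abs_divide abs_mult field_simps)
qed

lemma continuous_on_sinc_tail: "continuous_on UNIV (sinc_tail l)"
  unfolding sinc_tail_def[abs_def]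
  by (intro continuous_intros continuous_on_compose2[OF continuous_on_rGamma]) auto

lemma sinc_tail_Suc: "sinc_tail l t = (1 - t\<^sup>2 / (real (Suc l))\<^sup>2) * sinc_tail (Suc l) t"
proof -
  define a where "a = real (Suc l)"
  have a: "a \<noteq> 0" "a > 0" by (auto simp: a_def)
  have 1: "rGamma (a - t) = (a - t) * rGamma (a + 1 - t)" for t
    using rGamma_plus1[of "a - t"] by (simp add: algebra_simps)
  have 2: "rGamma (a + t) = (a + t) * rGamma (a + 1 + t)"
    using 1[of "-t"] by simp
  have "sinc_tail l t = (fact l)\<^sup>2 * rGamma (a - t) * rGamma (a + t)"
    by (simp add: sinc_tail_def a_def add.commute)
  also have "\<dots> = (fact l)\<^sup>2 * (a\<^sup>2 - t\<^sup>2) * rGamma (a + 1 - t) * rGamma (a + 1 + t)"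
    unfolding 1 2 by (simp add: algebra_simps power2_eq_square)
  also have "a\<^sup>2 - t\<^sup>2 = (1 - t\<^sup>2/a\<^sup>2) * a\<^sup>2" using a by (simp add: field_simps)
  also have "(fact l)\<^sup>2 * ((1 - t\<^sup>2/a\<^sup>2) * a\<^sup>2) * rGamma (a + 1 - t) * rGamma (a + 1 + t)
      = (1 - t\<^sup>2 / a\<^sup>2) * sinc_tail (Suc l) t"
    by (simp add: sinc_tail_def a_def power_mult_distrib add.commute mult_ac)
  finally show ?thesis by (simp add: a_def)
qed

text \<open>
The reflection formula of the Gamma function.
\<close>

lemma sinc_tail_0: "pi * t * sinc_tail 0 t = sin (pi * t)"
proof -
  have "complex_of_real (rGamma t * rGamma (1 - t)) = complex_of_real (sin (pi * t) / pi)"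
    using rGamma_reflection_complex[of "of_real t"]
    by (metis (no_types, lifting) of_real_1 of_real_diff of_real_divide of_real_mult rGamma_complex_of_real sin_of_real)
  then have "rGamma t * rGamma (1 - t) = sin (pi * t) / pi" by (simp only: of_real_eq_iff)
  moreover have "t * rGamma (1 + t) = rGamma t" using rGamma_plus1[of t] by (simp add: add.commute)
  ultimately have "t * rGamma (1 + t) * rGamma (1 - t) = sin (pi * t) / pi" by simp
  then show ?thesis by (simp add: sinc_tail_def field_simps)
qed

lemma sinc_tail_prod:
  assumes "l \<le> m"
  shows "sinc_tail l t = (\<Prod>k=Suc l..m. 1 - t\<^sup>2 / (real k)\<^sup>2) * sinc_tail m t"
  using assms
proof (induction m rule: dec_induct)
  case base then show ?case by simp
next
  case (step m)
  then show ?case by (simp add: sinc_tail_Suc[of m t] mult.assoc prod.nat_ivl_Suc')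
qed

lemma sin_eq_sinc_tail:
  "sin (pi * t) = pi * t * (\<Prod>k=1..l. 1 - t\<^sup>2 / (real k)\<^sup>2) * sinc_tail l t"
  using sinc_tail_prod[of 0 l t] sinc_tail_0[of t] by (simp add: mult.assoc)

lemma sinc_tail_pos:
  assumes "\<bar>t\<bar> < real l + 1" shows "sinc_tail l t > 0"
  using assms Gamma_real_pos[of "real l + 1 - t"] Gamma_real_pos[of "real l + 1 + t"]
  by (simp add: sinc_tail_def rGamma_inverse_Gamma)

text \<open>
Divide Euler's product formula for \<open>sin (\<pi>t)\<close> by its first \<open>l\<close> factors. For integral \<open>t\<close> some factors
may vanish, so statements about integral arguments are obtained from this one by continuity.
\<close>

lemma sinc_tail_limit_nonint:
  assumes "t \<notin> \<int>"
  shows "(\<lambda>m. \<Prod>k=Suc l..m. 1 - t\<^sup>2 / (real k)\<^sup>2) \<longlonglongrightarrow> sinc_tail l t"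
proof -
  have t0: "t \<noteq> 0" using assms by auto
  have sin0: "sin (pi * t) \<noteq> 0"
    using assms sin_times_pi_eq_0[of t] by (simp add: mult.commute)
  define P where "P m = (\<Prod>k=1..m. 1 - t\<^sup>2 / (real k)\<^sup>2)" for m
  have P: "P \<longlonglongrightarrow> sin (pi * t) / (pi * t)"
    using sin_product_formula_real'[OF t0] by (simp add: P_def[abs_def])
  have Pl: "P l \<noteq> 0" using sin0 sin_eq_sinc_tail[of t l] by (auto simp: P_def)
  have "(\<lambda>m. P m / P l) \<longlonglongrightarrow> sin (pi * t) / (pi * t) / P l"
    using P by (intro tendsto_intros Pl)
  moreover have "sin (pi * t) / (pi * t) / P l = sinc_tail l t"
    using Pl t0 sin_eq_sinc_tail[of t l] by (simp add: P_def field_simps)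
  moreover have "\<forall>\<^sub>F m in sequentially. P m / P l = (\<Prod>k=Suc l..m. 1 - t\<^sup>2 / (real k)\<^sup>2)"
    using eventually_ge_at_top[of l]
  proof eventually_elim
    case (elim m)
    have "P m = P l * (\<Prod>k=Suc l..m. 1 - t\<^sup>2 / (real k)\<^sup>2)"
      using prod.ub_add_nat[of 1 l "\<lambda>k. 1 - t\<^sup>2 / (real k)\<^sup>2" "m - l"] elim by (simp add: P_def)
    then show ?case using Pl by simp
  qed
  ultimately show ?thesis using tendsto_cong by force
qed

text \<open>
Serves to carry statements from nonintegral to integral arguments by continuity.
\<close>

lemma nonint_approximation: "\<exists>u :: nat \<Rightarrow> real. u \<longlonglongrightarrow> t \<and> (\<forall>n. u n \<notin> \<int>)"
proof (cases "t \<in> \<int>")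
  case False then show ?thesis by (intro exI[of _ "\<lambda>_. t"]) auto
next
  case True
  have "(\<lambda>n. t + inverse (real (Suc n) + 1)) \<longlonglongrightarrow> t + 0"
    by real_asymp
  moreover have "t + inverse (real (Suc n) + 1) \<notin> \<int>" for n
  proof
    assume "t + inverse (real (Suc n) + 1) \<in> \<int>"
    then have "t + inverse (real (Suc n) + 1) - t \<in> \<int>" using True by (rule Ints_diff)
    then obtain k :: int where k: "inverse (real (Suc n) + 1) = of_int k"
      by (auto elim: Ints_cases)
    have "0 < inverse (real (Suc n) + 1)" "inverse (real (Suc n) + 1) < 1"
      by (auto simp: divide_simps)
    then show False unfolding k by simp
  qed
  ultimately show ?thesis by (intro exI[of _ "\<lambda>n. t + inverse (real (Suc n) + 1)"]) auto
qed

lemma sum_inverse_squares_tail: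
  assumes "l \<ge> 1" "l \<le> m"
  shows "(\<Sum>k=Suc l..m. 1 / (real k)\<^sup>2) \<le> 1 / real l - 1 / real m"
  using assms(2)
proof (induction m rule: dec_induct)
  case base then show ?case by simp
next
  case (step m)
  have "1 / (real (Suc m))\<^sup>2 \<le> 1 / real m - 1 / real (Suc m)"
    using assms(1) step(1) by (simp add: divide_simps power2_eq_square)
  with step show ?case by simp
qed

lemma exp_le_one_minus:
  fixes x :: real assumes "0 \<le> x" "x \<le> 1/2" shows "exp (- 2 * x) \<le> 1 - x"
proof -
  have "2 * x * x \<le> 1 * x" using assms by (intro mult_right_mono) auto
  then have "- 2 * x \<le> - x - 2 * x\<^sup>2" by (simp add: power2_eq_square)
  also have "\<dots> \<le> ln (1 - x)" using assms by (rule ln_one_minus_pos_lower_bound)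
  finally have "exp (- 2 * x) \<le> exp (ln (1 - x))" by simp
  with assms show ?thesis by simp
qed

text \<open>
In the range considered every factor \<open>1 - t\<^sup>2/k\<^sup>2\<close> with \<open>k > l\<close> lies in \<open>[1/2, 1]\<close>, so it is at least
\<open>exp (- 2 t\<^sup>2/k\<^sup>2)\<close>, and the sum of \<open>1/k\<^sup>2\<close> over \<open>k > l\<close> is at most \<open>1/l\<close>.
\<close>

lemma sinc_tail_bounds:
  assumes l: "l \<ge> 1" and t: "t\<^sup>2 < (real l + 1)\<^sup>2 / 2"
  shows "exp (- 2 * t\<^sup>2 / real l) \<le> sinc_tail l t" "sinc_tail l t \<le> 1"
proof -
  have *: "exp (- 2 * t\<^sup>2 / real l) \<le> sinc_tail l t \<and> sinc_tail l t \<le> 1"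
    if t: "t\<^sup>2 < (real l + 1)\<^sup>2 / 2" and "t \<notin> \<int>" for t
  proof (intro conjI)
    have small: "t\<^sup>2 / (real k)\<^sup>2 \<le> 1/2" if "k \<ge> Suc l" for k
    proof -
      have "t\<^sup>2 \<le> (real k)\<^sup>2 / 2"
        using t power_mono[of "real l + 1" "real k" 2] that by linarith
      then show ?thesis using that by (simp add: field_simps)
    qed
    show "sinc_tail l t \<le> 1"
    proof (rule LIMSEQ_le_const2[OF sinc_tail_limit_nonint[OF \<open>t \<notin> \<int>\<close>]], intro exI allI impI)
      fix m assume "m \<ge> (0::nat)"
      show "(\<Prod>k=Suc l..m. 1 - t\<^sup>2 / (real k)\<^sup>2) \<le> 1"
      proof (intro prod_le_1 conjI)
        fix k assume "k \<in> {Suc l..m}"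
        then have "t\<^sup>2 / (real k)\<^sup>2 \<le> 1/2" using small[of k] by auto
        then show "0 \<le> 1 - t\<^sup>2 / (real k)\<^sup>2" by linarith
      qed simp
    qed
    show "exp (- 2 * t\<^sup>2 / real l) \<le> sinc_tail l t"
    proof (rule LIMSEQ_le_const[OF sinc_tail_limit_nonint[OF \<open>t \<notin> \<int>\<close>]], intro exI allI impI)
      fix m assume m: "m \<ge> l"
      have "- 2 * t\<^sup>2 / real l \<le> - 2 * t\<^sup>2 * (\<Sum>k=Suc l..m. 1 / (real k)\<^sup>2)"
      proof -
        have "(\<Sum>k=Suc l..m. 1 / (real k)\<^sup>2) \<le> 1 / real l"
          using sum_inverse_squares_tail[OF l m] by (rule order_trans) simp
        then have "2 * t\<^sup>2 * (\<Sum>k=Suc l..m. 1 / (real k)\<^sup>2) \<le> 2 * t\<^sup>2 * (1 / real l)"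
          by (intro mult_left_mono) auto
        then show ?thesis by simp
      qed
      then have "exp (- 2 * t\<^sup>2 / real l) \<le> exp (\<Sum>k=Suc l..m. - 2 * (t\<^sup>2 / (real k)\<^sup>2))"
        by (simp add: sum_distrib_left sum_negf)
      also have "\<dots> = (\<Prod>k=Suc l..m. exp (- 2 * (t\<^sup>2 / (real k)\<^sup>2)))" by (simp add: exp_sum)
      also have "\<dots> \<le> (\<Prod>k=Suc l..m. 1 - t\<^sup>2 / (real k)\<^sup>2)"
        using small by (intro prod_mono conjI exp_le_one_minus) auto
      finally show "exp (- 2 * t\<^sup>2 / real l) \<le> (\<Prod>k=Suc l..m. 1 - t\<^sup>2 / (real k)\<^sup>2)" .
    qed
  qed
  obtain u :: "nat \<Rightarrow> real" where u: "u \<longlonglongrightarrow> t" "\<And>n. u n \<notin> \<int>" using nonint_approximation by blast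
  have ct: "(\<lambda>n. sinc_tail l (u n)) \<longlonglongrightarrow> sinc_tail l t"
    using continuous_on_tendsto_compose[OF continuous_on_sinc_tail u(1)] by simp
  have ev: "\<forall>\<^sub>F n in sequentially. (u n)\<^sup>2 < (real l + 1)\<^sup>2 / 2"
    using t by (intro order_tendstoD[OF tendsto_power[OF u(1)]])
  have ev': "\<forall>\<^sub>F n in sequentially. exp (- 2 * (u n)\<^sup>2 / real l) \<le> sinc_tail l (u n)"
    "\<forall>\<^sub>F n in sequentially. sinc_tail l (u n) \<le> 1"
    using ev *[OF _ u(2)] by (auto elim!: eventually_mono simp del: minus_divide_left)
  have "(\<lambda>n. exp (- 2 * (u n)\<^sup>2 / real l)) \<longlonglongrightarrow> exp (- 2 * t\<^sup>2 / real l)"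
    using l by (intro tendsto_intros u) auto
  then show "exp (- 2 * t\<^sup>2 / real l) \<le> sinc_tail l t"
    by (rule tendsto_le[OF sequentially_bot ct _ ev'(1)])
  show "sinc_tail l t \<le> 1"
    using ev'(2) by (intro tendsto_upperbound[OF ct]) auto
qed

text \<open>
For \<open>|t| < l + 1\<close> all factors of the tail lie in \<open>[0, 1]\<close>. For larger \<open>|t|\<close> the tail is
\<open>sin (\<pi>t) / (\<pi>t)\<close> divided by \<open>\<Prod>\<^bsub>k\<le>l\<^esub> (1 - t\<^sup>2/k\<^sup>2)\<close>, and the modulus of this product is at least \<open>1\<close>:
from \<open>|t| - k \<ge> l + 1 - k\<close> and \<open>|t| + k \<ge> k\<close> it is at least \<open>\<Prod>\<^bsub>k\<le>l\<^esub> (l + 1 - k) / k = 1\<close>.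
The bound holds for all real \<open>t\<close>, which matters because the sampling points are arbitrary.
\<close>

lemma abs_sinc_tail_le_1:
  assumes l: "l \<ge> 1"
  shows "\<bar>sinc_tail l t\<bar> \<le> 1"
proof (cases "\<bar>t\<bar> < real l + 1")
  case True
  have *: "sinc_tail l t \<le> 1" if t: "\<bar>t\<bar> < real l + 1" and "t \<notin> \<int>" for t
  proof (rule LIMSEQ_le_const2[OF sinc_tail_limit_nonint[OF \<open>t \<notin> \<int>\<close>]], intro exI allI impI)
    fix m assume "m \<ge> (0::nat)"
    show "(\<Prod>k=Suc l..m. 1 - t\<^sup>2 / (real k)\<^sup>2) \<le> 1"
    proof (intro prod_le_1 conjI)
      fix k assume "k \<in> {Suc l..m}"
      then have "\<bar>t\<bar> \<le> \<bar>real k\<bar>" "real k > 0" using t by auto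
      then show "0 \<le> 1 - t\<^sup>2 / (real k)\<^sup>2" using abs_le_square_iff[of t "real k"] by simp
    qed simp
  qed
  obtain u :: "nat \<Rightarrow> real" where u: "u \<longlonglongrightarrow> t" "\<And>n. u n \<notin> \<int>" using nonint_approximation by blast
  have ct: "(\<lambda>n. sinc_tail l (u n)) \<longlonglongrightarrow> sinc_tail l t"
    using continuous_on_tendsto_compose[OF continuous_on_sinc_tail u(1)] by simp
  have "\<forall>\<^sub>F n in sequentially. \<bar>u n\<bar> < real l + 1"
    using True by (intro order_tendstoD[OF tendsto_rabs[OF u(1)]])
  then have "\<forall>\<^sub>F n in sequentially. sinc_tail l (u n) \<le> 1"
    by (auto elim!: eventually_mono simp: * u(2))
  then have "sinc_tail l t \<le> 1" by (intro tendsto_upperbound[OF ct]) auto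
  with sinc_tail_pos[OF True] show ?thesis by simp
next
  case False
  define Q where "Q = (\<Prod>k=1..l. 1 - t\<^sup>2 / (real k)\<^sup>2)"
  have t0: "\<bar>t\<bar> > 0" using False by linarith
  have one: "(\<Prod>k=1..l. real (l + 1 - k) / real k) = 1"
  proof -
    have "(\<Prod>k=1..l. real (l + 1 - k)) = (\<Prod>k=1..l. real k)"
      by (rule prod.reindex_bij_witness[of _ "\<lambda>k. l + 1 - k" "\<lambda>k. l + 1 - k"]) auto
    moreover have "(\<Prod>k=1..l. real k) \<noteq> 0" by simp
    ultimately show ?thesis unfolding prod_dividef by simp
  qed
  have "(\<Prod>k=1..l. real (l + 1 - k) / real k) \<le> (\<Prod>k=1..l. \<bar>1 - t\<^sup>2 / (real k)\<^sup>2\<bar>)"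
  proof (intro prod_mono conjI)
    fix k assume k: "k \<in> {1..l}"
    then show "0 \<le> real (l + 1 - k) / real k" by simp
    have "real (l + 1 - k) * real k \<le> (\<bar>t\<bar> - real k) * (\<bar>t\<bar> + real k)"
      using k False by (intro mult_mono) auto
    also have "\<dots> = t\<^sup>2 - (real k)\<^sup>2" by (simp add: power2_eq_square algebra_simps)
    finally have "real (l + 1 - k) * real k / (real k)\<^sup>2 \<le> (t\<^sup>2 - (real k)\<^sup>2) / (real k)\<^sup>2"
      by (rule divide_right_mono) simp
    moreover have "real (l + 1 - k) * real k / (real k)\<^sup>2 = real (l + 1 - k) / real k"
      using k by (simp add: power2_eq_square)
    moreover have "(t\<^sup>2 - (real k)\<^sup>2) / (real k)\<^sup>2 = t\<^sup>2 / (real k)\<^sup>2 - 1"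
      using k by (simp add: diff_divide_distrib)
    ultimately show "real (l + 1 - k) / real k \<le> \<bar>1 - t\<^sup>2 / (real k)\<^sup>2\<bar>" by linarith
  qed
  then have Q: "\<bar>Q\<bar> \<ge> 1" unfolding one Q_def abs_prod .
  have "\<bar>pi * t\<bar> * \<bar>sinc_tail l t\<bar> \<le> \<bar>pi * t\<bar> * \<bar>sinc_tail l t\<bar> * \<bar>Q\<bar>"
    using mult_left_mono[OF Q, of "\<bar>pi * t\<bar> * \<bar>sinc_tail l t\<bar>"] by simp
  also have "\<dots> = \<bar>sin (pi * t)\<bar>"
    using sin_eq_sinc_tail[of t l] by (simp add: Q_def abs_mult[symmetric] mult_ac)
  also have "\<dots> \<le> \<bar>pi * t\<bar>" by (rule abs_sin_x_le_abs_x)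
  finally show ?thesis using t0 by (simp add: abs_mult)
qed

text \<open>
The Lagrange basis polynomial of the node \<open>k\<close> among the nodes \<open>-l, \<dots>, l\<close>.
\<close>

definition int_lagrange :: "nat \<Rightarrow> int \<Rightarrow> real \<Rightarrow> real" where
  "int_lagrange l k t = (\<Prod>j\<in>{- int l..int l} - {k}. (t - of_int j) / (of_int k - of_int j))"

lemma prod_symmetric_interval:
  "(\<Prod>j\<in>{- int l..int l}. t - real_of_int j) = t * (\<Prod>k=1..l. t\<^sup>2 - (real k)\<^sup>2)"
proof (induction l)
  case (Suc l)
  have eq: "{- int (Suc l)..int (Suc l)} = insert (- int (Suc l)) (insert (int (Suc l)) {- int l..int l})" by auto
  show ?case unfolding eq using Suc
    by (simp add: prod.nat_ivl_Suc' power2_eq_square algebra_simps)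
qed simp

text \<open>
Both sides are multiples of \<open>sin (\<pi>t) / (t - k)\<close>: the left one because \<open>k\<close> is an integer, the right one
because \<open>\<Prod>\<^sub>j (t - j)\<close> over \<open>|j| \<le> l\<close> is a multiple of \<open>t \<Prod>\<^sub>j (1 - t\<^sup>2/j\<^sup>2)\<close>, which the tail completes
to the sine. The constant is found by evaluating at \<open>t = k\<close>, where both sides are continuous.
\<close>

lemma sincpi_shift:
  assumes k: "k \<in> {- int l..int l}"
  shows "sincpi (t - of_int k) * sinc_tail l (of_int k) = int_lagrange l k t * sinc_tail l t"
proof -
  define W where "W t = (\<Prod>j\<in>{- int l..int l} - {k}. t - real_of_int j)" for t
  define c where "c = (\<Prod>j=1..l. - ((real j)\<^sup>2))"
  have c: "c \<noteq> 0" by (simp add: c_def)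
  define C where "C = cos (of_int k * pi) / c"
  have W: "W t * (t - of_int k) = t * (\<Prod>j=1..l. t\<^sup>2 - (real j)\<^sup>2)" for t
    using prod.remove[OF _ k, of "\<lambda>j. t - real_of_int j"] prod_symmetric_interval[of t l]
    by (simp add: W_def mult.commute)
  have W': "W t * (t - of_int k) = c * (t * (\<Prod>j=1..l. 1 - t\<^sup>2 / (real j)\<^sup>2))" for t
  proof -
    have "(\<Prod>j=1..l. t\<^sup>2 - (real j)\<^sup>2) = (\<Prod>j=1..l. - ((real j)\<^sup>2) * (1 - t\<^sup>2 / (real j)\<^sup>2))"
      by (intro prod.cong refl) (simp add: field_simps)
    then show ?thesis unfolding W by (simp only: prod.distrib c_def mult_ac)
  qed
  have ne: "sincpi (t - of_int k) = C * W t * sinc_tail l t" if "t \<noteq> of_int k" for t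
  proof -
    have "sin (pi * (t - of_int k)) = sin (pi * t) * cos (of_int k * pi)"
      by (simp add: right_diff_distrib sin_diff mult.commute)
    also have "sin (pi * t) = pi * (c * (t * (\<Prod>j=1..l. 1 - t\<^sup>2 / (real j)\<^sup>2)) * sinc_tail l t) / c"
      using c by (subst sin_eq_sinc_tail[of t l]) simp
    also have "\<dots> = pi * (W t * (t - of_int k) * sinc_tail l t) / c"
      unfolding W' by simp
    finally show ?thesis using that c by (simp add: sincpi_def C_def field_simps)
  qed
  have cont: "continuous_on UNIV (\<lambda>t. sincpi (t - of_int k))"
  proof (rule continuous_at_imp_continuous_on, rule ballI)
    fix t show "isCont (\<lambda>t. sincpi (t - of_int k)) t"
      by (rule isCont_o2[OF _ isCont_sincpi]) simp
  qed
  have cont': "continuous_on UNIV (\<lambda>t. C * W t * sinc_tail l t)"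
    unfolding W_def[abs_def] by (intro continuous_intros continuous_on_sinc_tail)
  have all: "sincpi (t - of_int k) = C * W t * sinc_tail l t" for t
  proof (cases "t = of_int k")
    case True
    obtain u :: "nat \<Rightarrow> real" where u: "u \<longlonglongrightarrow> t" "\<And>n. u n \<notin> \<int>" using nonint_approximation by blast
    have *: "(\<lambda>n. sincpi (u n - of_int k)) \<longlonglongrightarrow> sincpi (t - of_int k)"
      by (rule continuous_on_tendsto_compose[OF cont u(1)]) auto
    have "(\<lambda>n. C * W (u n) * sinc_tail l (u n)) \<longlonglongrightarrow> C * W t * sinc_tail l t"
      by (rule continuous_on_tendsto_compose[OF cont' u(1)]) auto
    also have "(\<lambda>n. C * W (u n) * sinc_tail l (u n)) = (\<lambda>n. sincpi (u n - of_int k))"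
    proof (rule ext)
      fix n
      have "u n \<noteq> of_int k" using u(2)[of n] by auto
      then show "C * W (u n) * sinc_tail l (u n) = sincpi (u n - of_int k)" using ne by simp
    qed
    finally show ?thesis using * LIMSEQ_unique by blast
  qed (rule ne)
  have W0: "W (of_int k) \<noteq> 0" by (simp add: W_def)
  have "C * W (of_int k) * sinc_tail l (of_int k) = 1"
    using all[of "of_int k"] by (simp add: sincpi_def)
  then have "sincpi (t - of_int k) * sinc_tail l (of_int k) = W t / W (of_int k) * sinc_tail l t"
    using W0 unfolding all by (simp add: field_simps)
  also have "W t / W (of_int k) = int_lagrange l k t"
    by (simp add: W_def int_lagrange_def prod_dividef)
  finally show ?thesis .
qed

section \<open>Product functions on cubes and the exponentials\<close>

lemma mem_cube: "x \<in> cube r \<longleftrightarrow> (\<forall>i. - r \<le> x $ i \<and> x $ i \<le> r)"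
  by (simp add: cube_def mem_box_cart)

lemma cube_sets [measurable, simp]: "cube r \<in> sets borel" "cube r \<in> sets lebesgue"
  by (auto simp: cube_def)

text \<open>
Lebesgue measure on \<open>\<real>\<^sup>d\<close> is the image of the product measure indexed by the standard basis; the
proof only translates between the index type \<open>'d\<close> and that basis.
\<close>

lemma lborel_vec_prod:
  fixes f :: "'d::finite \<Rightarrow> real \<Rightarrow> complex"
  assumes int: "\<And>i. integrable lborel (f i)"
  shows "has_bochner_integral (lborel :: (real^'d) measure) (\<lambda>x. \<Prod>i\<in>UNIV. f i (x $ i)) (\<Prod>i\<in>UNIV. \<integral>x. f i x \<partial>lborel)"
proof -
  define ax where "ax = (\<lambda>i::'d. axis i (1::real))"
  have inj: "inj ax" by (auto simp: ax_def inj_def axis_eq_axis)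
  have Basis: "(Basis :: (real^'d) set) = ax ` UNIV" by (auto simp: Basis_vec_def ax_def)
  define F where "F b = f (inv ax b)" for b
  have F: "F (ax i) = f i" for i by (simp add: F_def inj)
  interpret product_sigma_finite "\<lambda>_::real^'d. lborel :: real measure" ..
  let ?T = "\<lambda>g :: real^'d \<Rightarrow> real. \<Sum>b\<in>Basis. g b *\<^sub>R b"
  have nth: "?T g $ i = g (ax i)" for g i
  proof -
    have "?T g $ i = (?T g) \<bullet> ax i" by (simp add: ax_def inner_axis)
    also have "\<dots> = g (ax i)" by (rule inner_sum_left_Basis) (simp add: Basis)
    finally show ?thesis .
  qed
  have "integrable (\<Pi>\<^sub>M b\<in>Basis. lborel) (\<lambda>g. \<Prod>b\<in>(Basis :: (real^'d) set). F b (g b))"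
    by (rule product_integrable_prod) (auto simp: F_def int)
  moreover have "(\<integral>g. (\<Prod>b\<in>(Basis :: (real^'d) set). F b (g b)) \<partial>(\<Pi>\<^sub>M b\<in>Basis. lborel)) = (\<Prod>b\<in>(Basis :: (real^'d) set). \<integral>x. F b x \<partial>lborel)"
    by (rule product_integral_prod) (auto simp: F_def int)
  moreover have "(\<Prod>b\<in>(Basis :: (real^'d) set). F b (g b)) = (\<Prod>i\<in>UNIV. f i (?T g $ i))" for g
    unfolding nth unfolding Basis using inj by (simp add: prod.reindex F)
  moreover have "(\<Prod>b\<in>(Basis :: (real^'d) set). \<integral>x. F b x \<partial>lborel) = (\<Prod>i\<in>UNIV. \<integral>x. f i x \<partial>lborel)"
    unfolding Basis using inj by (simp add: prod.reindex F)
  ultimately have "has_bochner_integral (\<Pi>\<^sub>M b\<in>Basis. lborel) (\<lambda>g. \<Prod>i\<in>UNIV. f i (?T g $ i)) (\<Prod>i\<in>UNIV. \<integral>x. f i x \<partial>lborel)"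
    by (simp add: has_bochner_integral_iff)
  moreover have [measurable]: "f i \<in> borel_measurable borel" for i using int[of i] by auto
  have "(\<lambda>x::real^'d. \<Prod>i\<in>UNIV. f i (x $ i)) \<in> borel_measurable borel" by measurable
  moreover have "?T \<in> measurable (\<Pi>\<^sub>M b\<in>Basis. lborel) borel" by measurable
  ultimately show ?thesis
    by (subst lborel_eq) (simp add: has_bochner_integral_distr)
qed

lemma has_bochner_integral_lebesgue:
  fixes f :: "'a::euclidean_space \<Rightarrow> complex"
  assumes "has_bochner_integral lborel f I"
  shows "has_bochner_integral lebesgue f I"
proof -
  have f: "integrable lborel f" "I = integral\<^sup>L lborel f"
    using assms by (auto simp: has_bochner_integral_iff)
  show ?thesis
    using f integrable_completion[OF borel_measurable_integrable[OF f(1)]]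
      integral_completion[OF borel_measurable_integrable[OF f(1)]]
    by (simp add: has_bochner_integral_iff)
qed

lemma cube_prod_integral:
  fixes f :: "'d::finite \<Rightarrow> real \<Rightarrow> complex"
  assumes int: "\<And>i. set_integrable lborel {-r..r} (f i)"
  shows "has_bochner_integral (lebesgue_on (cube r :: (real^'d) set)) (\<lambda>x. \<Prod>i\<in>UNIV. f i (x $ i))
     (\<Prod>i\<in>UNIV. LBINT x:{-r..r}. f i x)"
proof -
  have eq: "(\<Prod>i\<in>UNIV. indicator {-r..r} (x $ i) *\<^sub>R f i (x $ i)) = indicator (cube r) x *\<^sub>R (\<Prod>i\<in>UNIV. f i (x $ i))" for x :: "real^'d"
  proof (cases "x \<in> cube r")
    case True
    then show ?thesis by (simp add: mem_cube)
  next
    case False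
    then obtain i where "x $ i \<notin> {-r..r}" by (auto simp: mem_cube)
    then have "(\<Prod>i\<in>UNIV. indicator {-r..r} (x $ i) *\<^sub>R f i (x $ i)) = 0"
      by (intro prod_zero bexI[of _ i]) auto
    with False show ?thesis by simp
  qed
  have "has_bochner_integral lebesgue (\<lambda>x::real^'d. \<Prod>i\<in>UNIV. indicator {-r..r} (x $ i) *\<^sub>R f i (x $ i))
      (\<Prod>i\<in>UNIV. LBINT x:{-r..r}. f i x)"
    using has_bochner_integral_lebesgue[OF lborel_vec_prod[of "\<lambda>i x. indicator {-r..r} x *\<^sub>R f i x"]] int
    by (simp add: set_integrable_def set_lebesgue_integral_def)
  then show ?thesis unfolding eq
    by (simp add: has_bochner_integral_iff integrable_restrict_space integral_restrict_space)
qed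

definition exp1 :: "real \<Rightarrow> real \<Rightarrow> complex" where
  "exp1 s x = complex_of_real (1 / sqrt (2 * pi)) * exp (\<i> * complex_of_real (s * x))"

text \<open>
The exponentials are products of functions of one variable. This reduces all their integrals over
cubes to integrals over intervals.
\<close>

lemma exponential_eq_prod:
  fixes s x :: "real^'d::finite"
  shows "exponential s x = (\<Prod>i\<in>UNIV. exp1 (s $ i) (x $ i))"
proof -
  have "(2 * pi) powr (real CARD('d) / 2) = ((2 * pi) powr (1/2)) powr (real CARD('d))"
    by (simp add: powr_powr)
  also have "\<dots> = sqrt (2 * pi) ^ CARD('d)"
    using pi_gt_zero by (simp add: powr_half_sqrt powr_realpow)
  finally have 1: "(2 * pi) powr (real CARD('d) / 2) = sqrt (2 * pi) ^ CARD('d)" .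
  have "(\<Prod>i\<in>(UNIV::'d set). exp1 (s $ i) (x $ i)) = complex_of_real (1 / sqrt (2 * pi)) ^ CARD('d) *
     exp (\<Sum>i\<in>UNIV. \<i> * complex_of_real (s $ i * x $ i))"
    by (simp only: exp1_def prod.distrib exp_sum[OF finite] prod_constant)
  also have "(\<Sum>i\<in>UNIV. \<i> * complex_of_real (s $ i * x $ i)) = \<i> * complex_of_real (x \<bullet> s)"
    by (simp add: inner_vec_def sum_distrib_left mult.commute[of "x $ _"])
  finally show ?thesis unfolding exponential_def 1 by (simp add: power_divide)
qed

lemma norm_exp1: "cmod (exp1 s x) = 1 / sqrt (2 * pi)"
  by (simp add: exp1_def norm_mult norm_divide del: of_real_mult)

lemma continuous_exp1 [continuous_intros]: "continuous_on A (exp1 s)"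
  unfolding exp1_def[abs_def] by (intro continuous_intros)

lemma norm_exponential: "cmod (exponential s x) = 1 / (2 * pi) powr (real CARD('d) / 2)" for s :: "real^'d::finite"
  by (simp add: exponential_def norm_mult norm_divide)

lemma exponential_commute: "exponential s x = exponential x s"
  by (simp add: exponential_def inner_commute)

lemma exp_integral_value:
  assumes "s \<noteq> 0" "a \<le> b"
  shows "(LBINT x:{a..b}. exp (\<i> * complex_of_real (s * x)))
    = (exp (\<i> * complex_of_real (s * b)) - exp (\<i> * complex_of_real (s * a))) / (\<i> * complex_of_real s)"
proof -
  have "(LBINT x:{a..b}. exp (\<i> * complex_of_real (s * x))) =
     exp (\<i> * complex_of_real (s * b)) / (\<i> * complex_of_real s) - exp (\<i> * complex_of_real (s * a)) / (\<i> * complex_of_real s)"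
    unfolding set_lebesgue_integral_def
  proof (rule integral_FTC_Icc)
    show "a \<le> b" by fact
    fix x :: real
    show "((\<lambda>x. exp (\<i> * complex_of_real (s * x)) / (\<i> * complex_of_real s)) has_vector_derivative exp (\<i> * complex_of_real (s * x))) (at x within {a..b})"
    proof -
      have "((\<lambda>z. exp (\<i> * (complex_of_real s * z)) / (\<i> * complex_of_real s)) has_field_derivative exp (\<i> * (complex_of_real s * of_real x))) (at (of_real x))"
        using assms(1) by (auto intro!: derivative_eq_intros simp: field_simps)
      then have "((\<lambda>y. exp (\<i> * (complex_of_real s * of_real y)) / (\<i> * complex_of_real s)) has_vector_derivative exp (\<i> * (complex_of_real s * of_real x))) (at x)"
        by (rule has_vector_derivative_real_field)
      then show ?thesis unfolding of_real_mult by (rule has_vector_derivative_at_within)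
    qed
    show "continuous_on {a..b} (\<lambda>x. exp (\<i> * complex_of_real (s * x)))" by (intro continuous_intros)
  qed
  then show ?thesis by (simp add: diff_divide_distrib)
qed

lemma exp1_inner:
  "(LBINT x:{-pi..pi}. exp1 s x * cnj (exp1 t x)) = complex_of_real (sincpi (s - t))"
proof -
  have eq: "exp1 s x * cnj (exp1 t x) = complex_of_real (1 / (2 * pi)) * exp (\<i> * complex_of_real ((s - t) * x))" for x
  proof -
    define c where "c = complex_of_real (1 / sqrt (2 * pi))"
    have "c * c = complex_of_real (1 / sqrt (2 * pi) * (1 / sqrt (2 * pi)))"
      unfolding c_def by (rule of_real_mult[symmetric])
    also have "1 / sqrt (2 * pi) * (1 / sqrt (2 * pi)) = 1 / (2 * pi)" by simp
    finally have cc: "c * c = complex_of_real (1 / (2 * pi))" .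
    have cj: "cnj (exp1 t x) = c * exp (- (\<i> * complex_of_real (t * x)))"
      by (simp add: exp1_def c_def exp_cnj)
    have "exp1 s x * cnj (exp1 t x) = (c * c) * (exp (\<i> * complex_of_real (s * x)) * exp (- (\<i> * complex_of_real (t * x))))"
      unfolding cj unfolding exp1_def c_def[symmetric] by (simp only: mult_ac)
    also have "exp (\<i> * complex_of_real (s * x)) * exp (- (\<i> * complex_of_real (t * x))) = exp (\<i> * complex_of_real ((s - t) * x))"
      unfolding exp_add[symmetric] by (simp add: algebra_simps)
    finally show ?thesis unfolding cc .
  qed
  show ?thesis
  proof (cases "s = t")
    case True
    then show ?thesis unfolding eq by (simp add: sincpi_def set_integral_const scaleR_conv_of_real)
  next
    case False
    have "(LBINT x:{-pi..pi}. exp1 s x * cnj (exp1 t x)) = complex_of_real (1 / (2 * pi)) * (LBINT x:{-pi..pi}. exp (\<i> * complex_of_real ((s - t) * x)))"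
      unfolding eq by simp
    also have "(LBINT x:{-pi..pi}. exp (\<i> * complex_of_real ((s - t) * x))) =
      (exp (\<i> * complex_of_real ((s - t) * pi)) - exp (- (\<i> * complex_of_real ((s - t) * pi)))) / (\<i> * complex_of_real (s - t))"
      using False by (subst exp_integral_value) auto
    also have "exp (\<i> * complex_of_real ((s - t) * pi)) - exp (- (\<i> * complex_of_real ((s - t) * pi))) = 2 * \<i> * complex_of_real (sin ((s - t) * pi))"
    proof -
      define z where "z = complex_of_real ((s - t) * pi)"
      have "sin z = complex_of_real (sin ((s - t) * pi))" unfolding z_def by (rule sin_of_real)
      moreover have "exp (\<i> * z) - exp (- (\<i> * z)) = 2 * \<i> * sin z" unfolding sin_exp_eq by simp
      ultimately show ?thesis unfolding z_def by simp
    qed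
    also have "complex_of_real (1 / (2 * pi)) * (2 * \<i> * complex_of_real (sin ((s - t) * pi)) / (\<i> * complex_of_real (s - t)))
       = complex_of_real (sin ((s - t) * pi) / ((s - t) * pi))"
      using False unfolding of_real_divide of_real_mult by (simp add: divide_simps)
    also have "\<dots> = complex_of_real (sincpi (s - t))"
      using False by (simp add: sincpi_def mult.commute)
    finally show ?thesis .
  qed
qed

section \<open>Trigonometric polynomials and Fourier sums on the cube\<close>

lemma cube_lmeasurable: "cube r \<in> lmeasurable"
  by (simp add: cube_def)

lemma L2_cube_bounded:
  assumes "f \<in> borel_measurable (lebesgue_on (cube r))" "\<And>x. x \<in> cube r \<Longrightarrow> cmod (f x) \<le> B"
  shows "f \<in> L2 (cube r)"
proof -
  interpret finite_measure "lebesgue_on (cube r :: (real^'a) set)"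
    by (rule finite_measure_lebesgue_on[OF cube_lmeasurable])
  have "integrable (lebesgue_on (cube r)) (\<lambda>x. (norm (f x))\<^sup>2)"
  proof (rule integrable_const_bound[where B = "B\<^sup>2"])
    show "AE x in lebesgue_on (cube r). norm ((norm (f x))\<^sup>2) \<le> B\<^sup>2"
      using assms(2) by (intro AE_I2) (auto intro!: power_mono)
  qed (use assms(1) in measurable)
  with assms(1) show ?thesis by (simp add: L2_def)
qed

lemma borel_measurable_lebesgue_on:
  "f \<in> borel_measurable borel \<Longrightarrow> f \<in> borel_measurable (lebesgue_on S)"
  by (intro measurable_restrict_space1 measurable_completion) simp

lemma continuous_exponential [continuous_intros]: "continuous_on A (exponential s)"
  unfolding exponential_def[abs_def] by (intro continuous_intros)

lemma L2_exponential [simp, intro]: "exponential s \<in> L2 (cube r)" for s :: "real^'d::finite"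
  by (rule L2_cube_bounded[where B = "1 / (2 * pi) powr (real CARD('d) / 2)"])
     (auto simp: norm_exponential intro!: borel_measurable_lebesgue_on borel_measurable_continuous_onI continuous_intros)

lemma L2_lattice_exp [simp, intro]: "lattice_exp n \<in> L2 (cube r)"
  by (simp add: lattice_exp_def)

lemma exp1_mult_integrable: "set_integrable lborel {-r..r} (\<lambda>x. exp1 s x * cnj (exp1 t x))"
  by (intro borel_integrable_atLeastAtMost' continuous_intros)

lemma inner_exponential:
  fixes s t :: "real^'d::finite"
  shows "L2_inner_on (cube pi) (exponential s) (exponential t) = complex_of_real (\<Prod>i\<in>UNIV. sincpi (s $ i - t $ i))"
  using cube_prod_integral[where r = pi and f = "\<lambda>i x. exp1 (s $ i) x * cnj (exp1 (t $ i) x)"]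
  by (simp add: exp1_mult_integrable exp1_inner L2_inner_on_def exponential_eq_prod prod.distrib has_bochner_integral_iff)

definition ivec :: "int^'d \<Rightarrow> real^'d" where
  "ivec n = (\<chi> i. real_of_int (n $ i))"

lemma ivec_nth [simp]: "ivec n $ i = real_of_int (n $ i)"
  by (simp add: ivec_def)

lemma lattice_exp_ivec: "lattice_exp n = exponential (ivec n)"
  by (simp add: lattice_exp_def ivec_def)

lemma sincpi_of_int: "sincpi (of_int k) = (if k = 0 then 1 else 0)"
  by (simp add: sincpi_def)

lemma inner_lattice_exp_shift:
  "L2_inner_on (cube pi) (exponential (s + ivec m)) (exponential (s + ivec n)) = (if m = n then 1 else 0)"
proof (cases "m = n")
  case False
  then obtain i where "m $ i \<noteq> n $ i" by (auto simp: vec_eq_iff)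
  then have "(\<Prod>i\<in>UNIV. sincpi (of_int (m $ i - n $ i))) = 0"
    by (intro prod_zero bexI[of _ i]) (auto simp: sincpi_of_int simp del: of_int_diff)
  with False show ?thesis by (simp add: inner_exponential)
qed (simp add: inner_exponential sincpi_def)

lemma inner_lattice_exp:
  "L2_inner_on (cube pi) (lattice_exp m) (lattice_exp n) = (if m = n then 1 else 0)"
  using inner_lattice_exp_shift[of 0 m n] by (simp add: lattice_exp_ivec)

lemma bij_betw_vec_PiE:
  "bij_betw vec_nth {n::'a^'d::finite. \<forall>i. n $ i \<in> B} (PiE UNIV (\<lambda>_. B))"
  by (rule bij_betwI[where g = vec_lambda]) auto

text \<open>
Expanding a product of sums, with the choice functions packed as vectors.
\<close>

lemma prod_sum_vec:
  fixes f :: "'d::finite \<Rightarrow> 'a \<Rightarrow> 'b::comm_semiring_1"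
  assumes "finite B"
  shows "(\<Prod>i\<in>UNIV. \<Sum>k\<in>B. f i k) = (\<Sum>n\<in>{n::'a^'d. \<forall>i. n $ i \<in> B}. \<Prod>i\<in>UNIV. f i (n $ i))"
proof -
  have "(\<Prod>i\<in>UNIV. \<Sum>k\<in>B. f i k) = (\<Sum>g\<in>PiE (UNIV::'d set) (\<lambda>_. B). \<Prod>i\<in>UNIV. f i (g i))"
    using assms by (intro prod_sum_PiE) auto
  also have "\<dots> = (\<Sum>n\<in>{n::'a^'d. \<forall>i. n $ i \<in> B}. \<Prod>i\<in>UNIV. f i (n $ i))"
    by (rule sum.reindex_bij_betw[OF bij_betw_vec_PiE, symmetric])
  finally show ?thesis .
qed

lemma finite_vec_set: "finite B \<Longrightarrow> finite {n::'a^'d::finite. \<forall>i. n $ i \<in> B}"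
  using bij_betw_finite[OF bij_betw_vec_PiE[where 'd = 'd], of B] by (simp add: finite_PiE)

lemma index_cube_alt: "index_cube l = {n. \<forall>i. n $ i \<in> {- int l..int l}}"
  by (auto simp: index_cube_def)

lemma finite_index_cube [simp, intro]: "finite (index_cube l :: (int^'d::finite) set)"
  by (simp add: index_cube_alt finite_vec_set del: atLeastAtMost_iff)

lemma sum_index_cube_prod:
  fixes f :: "'d::finite \<Rightarrow> int \<Rightarrow> 'b::comm_semiring_1"
  shows "(\<Sum>n\<in>index_cube l. \<Prod>i\<in>UNIV. f i (n $ i)) = (\<Prod>i\<in>UNIV. \<Sum>k\<in>{- int l..int l}. f i k)"
  by (simp only: index_cube_alt prod_sum_vec finite_atLeastAtMost_int)

lemma orthonormal_combination:
  assumes "finite I" and L2: "\<And>i. i \<in> I \<Longrightarrow> \<phi> i \<in> L2 S"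
    and orth: "\<And>i j. i \<in> I \<Longrightarrow> j \<in> I \<Longrightarrow> L2_inner_on S (\<phi> i) (\<phi> j) = (if i = j then 1 else 0)"
  shows "(\<lambda>x. \<Sum>i\<in>I. c i * \<phi> i x) \<in> L2 S"
    "j \<in> I \<Longrightarrow> L2_inner_on S (\<lambda>x. \<Sum>i\<in>I. c i * \<phi> i x) (\<phi> j) = c j"
    "(L2_norm_on S (\<lambda>x. \<Sum>i\<in>I. c i * \<phi> i x))\<^sup>2 = (\<Sum>i\<in>I. (cmod (c i))\<^sup>2)"
proof -
  show L: "(\<lambda>x. \<Sum>i\<in>I. c i * \<phi> i x) \<in> L2 S" by (intro L2_sum L2_scale L2)
  show coef: "L2_inner_on S (\<lambda>x. \<Sum>i\<in>I. c i * \<phi> i x) (\<phi> j) = c j" if "j \<in> I" for j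
    using that assms(1) by (simp add: L2_inner_sum_left L2 orth if_distrib cong: if_cong)
  have "complex_of_real ((L2_norm_on S (\<lambda>x. \<Sum>i\<in>I. c i * \<phi> i x))\<^sup>2) = (\<Sum>j\<in>I. cnj (c j) * c j)"
    by (simp only: L2_inner_self[symmetric] L2_inner_sum_right[OF L2 L] coef cong: sum.cong)
  also have "\<dots> = complex_of_real (\<Sum>i\<in>I. (cmod (c i))\<^sup>2)"
    by (simp only: of_real_sum complex_norm_square mult.commute)
  finally show "(L2_norm_on S (\<lambda>x. \<Sum>i\<in>I. c i * \<phi> i x))\<^sup>2 = (\<Sum>i\<in>I. (cmod (c i))\<^sup>2)"
    by (simp only: of_real_eq_iff)
qed

text \<open>
Pythagoras: the remainder is orthogonal to the expansion.
\<close>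

lemma orthonormal_expansion:
  assumes "finite I" and L2: "\<And>i. i \<in> I \<Longrightarrow> \<phi> i \<in> L2 S"
    and orth: "\<And>i j. i \<in> I \<Longrightarrow> j \<in> I \<Longrightarrow> L2_inner_on S (\<phi> i) (\<phi> j) = (if i = j then 1 else 0)"
    and f: "f \<in> L2 S"
  shows "(L2_norm_on S (\<lambda>x. f x - (\<Sum>i\<in>I. L2_inner_on S f (\<phi> i) * \<phi> i x)))\<^sup>2
     = (L2_norm_on S f)\<^sup>2 - (\<Sum>i\<in>I. (cmod (L2_inner_on S f (\<phi> i)))\<^sup>2)"
proof -
  define c where "c i = L2_inner_on S f (\<phi> i)" for i
  define p where "p x = (\<Sum>i\<in>I. c i * \<phi> i x)" for x
  note o = orthonormal_combination[OF assms(1,2,3), where c = c, folded p_def]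
  have "L2_inner_on S p (\<lambda>x. f x - p x) = (\<Sum>i\<in>I. c i * L2_inner_on S (\<phi> i) (\<lambda>x. f x - p x))"
    unfolding p_def[abs_def] by (rule L2_inner_sum_left) (use L2 f o(1) in \<open>auto intro: L2_diff simp: p_def[abs_def]\<close>)
  also have "\<dots> = 0"
  proof (intro sum.neutral ballI)
    fix i assume i: "i \<in> I"
    have "L2_inner_on S (\<lambda>x. f x - p x) (\<phi> i) = 0"
      using f i o by (simp add: L2_inner_diff_left L2 c_def)
    then show "c i * L2_inner_on S (\<phi> i) (\<lambda>x. f x - p x) = 0" by (metis L2_inner_cnj complex_cnj_zero mult_zero_right)
  qed
  finally have "(L2_norm_on S (\<lambda>x. p x + (f x - p x)))\<^sup>2 = (L2_norm_on S p)\<^sup>2 + (L2_norm_on S (\<lambda>x. f x - p x))\<^sup>2"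
    using f o(1) by (subst L2_norm_add_square) (auto intro: L2_diff)
  then show ?thesis using o(3) by (simp add: p_def[abs_def] c_def)
qed

text \<open>
The Fourier transform of \<open>u\<close>, viewed as a function on \<open>\<real>\<^sup>d\<close> that vanishes outside the cube. Its values at
lattice points are the Fourier coefficients of \<open>u\<close>.
\<close>

definition hat :: "(real^'d \<Rightarrow> complex) \<Rightarrow> real^'d \<Rightarrow> complex" where
  "hat u t = L2_inner_on (cube pi) u (exponential t)"

text \<open>
Translates of the integer lattice give orthonormal exponentials as well. This uniformity in the shift
\<open>s\<close> is what turns Bessel's inequality into a bound for the \<open>L\<^sub>2\<close> norm of \<open>hat u\<close>.
\<close>

lemma Bessel_shift:
  fixes u :: "real^'d::finite \<Rightarrow> complex"
  assumes "u \<in> L2 (cube pi)" "finite I"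
  shows "(\<Sum>n\<in>I. (cmod (hat u (s + ivec n)))\<^sup>2) \<le> (L2_norm_on (cube pi) u)\<^sup>2"
  using orthonormal_expansion[OF assms(2) _ _ assms(1), of "\<lambda>n. exponential (s + ivec n)"]
    zero_le_power2[of "L2_norm_on (cube pi) (\<lambda>x. u x - (\<Sum>n\<in>I. hat u (s + ivec n) * exponential (s + ivec n) x))"]
  by (simp add: inner_lattice_exp_shift hat_def)

definition trig_sum :: "nat \<Rightarrow> (int^'d \<Rightarrow> complex) \<Rightarrow> real^'d \<Rightarrow> complex" where
  "trig_sum l c x = (\<Sum>n\<in>index_cube l. c n * lattice_exp n x)"

lemma trig_polys_eq: "trig_polys l = range (trig_sum l)"
  by (auto simp: trig_polys_def trig_sum_def[abs_def])

lemma L2_trig_sum [simp, intro]: "trig_sum l c \<in> L2 (cube r)" for c :: "int^'d::finite \<Rightarrow> complex"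
  unfolding trig_sum_def[abs_def] by (intro L2_sum L2_scale L2_lattice_exp)

lemma L2_trig_polys: "h \<in> trig_polys l \<Longrightarrow> h \<in> L2 (cube r)" for h :: "real^'d::finite \<Rightarrow> complex"
  by (auto simp: trig_polys_eq)

lemma hat_trig_sum_ivec: "n \<in> index_cube l \<Longrightarrow> hat (trig_sum l c) (ivec n) = c n" for c :: "int^'d::finite \<Rightarrow> complex"
  using orthonormal_combination(2)[of "index_cube l" "lattice_exp" "cube pi" n c]
  by (simp add: inner_lattice_exp hat_def trig_sum_def[abs_def] flip: lattice_exp_ivec)

lemma norm_trig_sum: "(L2_norm_on (cube pi) (trig_sum l c))\<^sup>2 = (\<Sum>n\<in>index_cube l. (cmod (c n))\<^sup>2)"
  for c :: "int^'d::finite \<Rightarrow> complex"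
  using orthonormal_combination(3)[of "index_cube l" "lattice_exp" "cube pi" c]
  by (simp add: inner_lattice_exp trig_sum_def[abs_def])

lemma hat_trig_sum: "hat (trig_sum l c) t = (\<Sum>n\<in>index_cube l. c n * of_real (\<Prod>i\<in>UNIV. sincpi (of_int (n $ i) - t $ i)))"
  for c :: "int^'d::finite \<Rightarrow> complex"
  unfolding hat_def trig_sum_def[abs_def]
  by (subst L2_inner_sum_left) (auto simp: lattice_exp_ivec inner_exponential)

lemma trig_polys_expansion:
  fixes h :: "real^'d::finite \<Rightarrow> complex"
  assumes "h \<in> trig_polys l" shows "h = trig_sum l (\<lambda>n. hat h (ivec n))"
proof -
  obtain c where c: "h = trig_sum l c" using assms by (auto simp: trig_polys_eq)
  show ?thesis unfolding c trig_sum_def[of l "\<lambda>n. hat (trig_sum l c) (ivec n)"] fun_eq_iff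
    by (simp add: hat_trig_sum_ivec trig_sum_def[of l c])
qed

definition fourier_sum :: "nat \<Rightarrow> (real^'d \<Rightarrow> complex) \<Rightarrow> real^'d \<Rightarrow> complex" where
  "fourier_sum l f = trig_sum l (\<lambda>n. hat f (ivec n))"

lemma fourier_sum_trig: "fourier_sum l f \<in> trig_polys l"
  by (simp add: fourier_sum_def trig_polys_eq)

lemma norm_diff_fourier_sum:
  fixes f :: "real^'d::finite \<Rightarrow> complex"
  assumes "f \<in> L2 (cube pi)"
  shows "(L2_norm_on (cube pi) (\<lambda>x. f x - fourier_sum l f x))\<^sup>2
    = (L2_norm_on (cube pi) f)\<^sup>2 - (\<Sum>n\<in>index_cube l. (cmod (hat f (ivec n)))\<^sup>2)"
  using orthonormal_expansion[OF _ _ _ assms, of "index_cube l" "lattice_exp"]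
  by (simp add: inner_lattice_exp fourier_sum_def trig_sum_def hat_def flip: lattice_exp_ivec)

lemma inner_diff_fourier_sum:
  fixes f :: "real^'d::finite \<Rightarrow> complex"
  assumes f: "f \<in> L2 (cube pi)" and h: "h \<in> trig_polys l"
  shows "L2_inner_on (cube pi) (\<lambda>x. f x - fourier_sum l f x) h = 0"
proof -
  obtain c where c: "h = (\<lambda>x. \<Sum>n\<in>index_cube l. c n * lattice_exp n x)" using h by (auto simp: trig_polys_def)
  have "hat (\<lambda>x. f x - fourier_sum l f x) (ivec n) = 0" if "n \<in> index_cube l" for n
    using f that by (simp add: hat_def L2_inner_diff_left fourier_sum_def)
      (simp add: hat_trig_sum_ivec flip: hat_def)
  then show ?thesis unfolding c
    using f by (subst L2_inner_sum_right) (auto intro!: L2_diff sum.neutral simp: fourier_sum_def lattice_exp_ivec hat_def)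
qed

lemma lattice_exp_trig_polys: "n \<in> index_cube l \<Longrightarrow> lattice_exp n \<in> trig_polys l" for n :: "int^'d::finite"
proof -
  assume n: "n \<in> index_cube l"
  have "lattice_exp n = trig_sum l (\<lambda>m. if m = n then 1 else 0)"
    using n by (simp add: trig_sum_def fun_eq_iff if_distrib[where f = "\<lambda>c. c * _"] cong: if_cong)
  then show ?thesis by (simp add: trig_polys_eq)
qed

text \<open>
The partial sum of the Fourier series satisfies the orthogonality relations of the projection, and these
determine the Fourier coefficients of a trigonometric polynomial.
\<close>

lemma trig_proj_eq:
  fixes f :: "real^'d::finite \<Rightarrow> complex"
  assumes f: "f \<in> L2 (cube pi)"
  shows "trig_proj l f = fourier_sum l f"
  unfolding trig_proj_def
proof (rule the_equality)
  show "fourier_sum l f \<in> trig_polys l \<and> (\<forall>h\<in>trig_polys l. L2_inner_on (cube pi) (\<lambda>x. f x - fourier_sum l f x) h = 0)"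
    using inner_diff_fourier_sum[OF f] fourier_sum_trig by blast
next
  fix g assume g: "g \<in> trig_polys l \<and> (\<forall>h\<in>trig_polys l. L2_inner_on (cube pi) (\<lambda>x. f x - g x) h = 0)"
  have "hat g (ivec n) = hat f (ivec n)" if n: "n \<in> index_cube l" for n
  proof -
    have "L2_inner_on (cube pi) (\<lambda>x. f x - g x) (lattice_exp n) = 0"
      using g lattice_exp_trig_polys[OF n] by blast
    then show ?thesis using f g L2_trig_polys[of g l pi]
      by (simp add: L2_inner_diff_left hat_def lattice_exp_ivec)
  qed
  then show "g = fourier_sum l f"
    using trig_polys_expansion[of g l] g unfolding fourier_sum_def trig_sum_def
    by (metis (no_types, lifting) sum.cong)
qed

lemma trig_proj_trig_polys:
  fixes h :: "real^'d::finite \<Rightarrow> complex"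
  assumes "h \<in> trig_polys l" shows "trig_proj l h = h"
  using trig_polys_expansion[OF assms] trig_proj_eq[OF L2_trig_polys[OF assms]] by (simp add: fourier_sum_def)

section \<open>Lagrange interpolation on the integer lattice\<close>

definition lagrange_poly :: "nat \<Rightarrow> int \<Rightarrow> real poly" where
  "lagrange_poly l k = (\<Prod>j\<in>{- int l..int l} - {k}. [:- of_int j / (of_int k - of_int j), 1 / (of_int k - of_int j):])"

lemma poly_lagrange_poly: "poly (lagrange_poly l k) t = int_lagrange l k t"
  by (simp add: lagrange_poly_def int_lagrange_def poly_prod diff_divide_distrib)

lemma degree_lagrange_poly:
  assumes "k \<in> {- int l..int l}" shows "degree (lagrange_poly l k) \<le> 2 * l"
proof -
  have "degree (lagrange_poly l k) \<le> (\<Sum>j\<in>{- int l..int l} - {k}. degree [:- of_int j / (of_int k - of_int j), 1 / (of_int k - of_int j) :: real:])"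
    unfolding lagrange_poly_def by (rule degree_prod_sum_le[unfolded comp_def]) simp
  also have "\<dots> \<le> (\<Sum>j\<in>{- int l..int l} - {k}. 1)"
    by (intro sum_mono) simp
  also have "\<dots> = 2 * l" using assms by simp
  finally show ?thesis .
qed

lemma int_lagrange_node:
  assumes "k \<in> {- int l..int l}" "j \<in> {- int l..int l}"
  shows "int_lagrange l k (of_int j) = (if j = k then 1 else 0)"
proof (cases "j = k")
  case True
  then show ?thesis unfolding int_lagrange_def by (auto intro!: prod.neutral)
next
  case False
  then show ?thesis unfolding int_lagrange_def using assms(2) by (auto intro!: prod_zero bexI[of _ j])
qed

text \<open>
Both sides are polynomials of degree at most \<open>2 l\<close> in \<open>t\<close> that agree at the \<open>2 l + 1\<close> integers
\<open>-l, \<dots>, l\<close>.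
\<close>

lemma int_lagrange_interpolation:
  fixes p :: "real poly"
  assumes "degree p \<le> 2 * l"
  shows "poly p t = (\<Sum>k\<in>{- int l..int l}. poly p (of_int k) * int_lagrange l k t)"
proof -
  define q where "q = (\<Sum>k\<in>{- int l..int l}. smult (poly p (of_int k)) (lagrange_poly l k))"
  have q: "poly q t = (\<Sum>k\<in>{- int l..int l}. poly p (of_int k) * int_lagrange l k t)" for t
    by (simp add: q_def poly_sum poly_lagrange_poly)
  have dq: "degree q \<le> 2 * l" unfolding q_def
    by (intro degree_sum_le order_trans[OF degree_smult_le degree_lagrange_poly]) auto
  have card: "card ((of_int :: int \<Rightarrow> real) ` {- int l..int l}) = 2 * l + 1"
    by (subst card_image) (auto simp: inj_on_def)
  have "p = q"
  proof (rule poly_eqI_degree[where A = "of_int ` {- int l..int l}"])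
    fix x :: real assume "x \<in> of_int ` {- int l..int l}"
    then obtain j where j: "x = of_int j" "j \<in> {- int l..int l}" by auto
    have "poly q x = (\<Sum>k\<in>{- int l..int l}. poly p (of_int k) * (if j = k then 1 else 0))"
      unfolding q j(1) using j(2) by (intro sum.cong refl) (simp only: int_lagrange_node)
    also have "\<dots> = poly p x" using j by (simp add: if_distrib[where f = "\<lambda>c. _ * c"] cong: if_cong)
    finally show "poly p x = poly q x" by simp
  qed (use card dq assms in auto)
  then show ?thesis using q by metis
qed

lemma coord_polys_sum:
  assumes "\<And>n. n \<in> I \<Longrightarrow> f n \<in> coord_polys m"
  shows "(\<lambda>x. \<Sum>n\<in>I. c n * f n x) \<in> coord_polys m"
proof -
  have "\<forall>n\<in>I. \<exists>a. f n = (\<lambda>x. \<Sum>k\<in>{k. \<forall>i. k $ i \<le> m}. a k * complex_of_real (\<Prod>i\<in>UNIV. (x $ i) ^ (k $ i)))"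
    using assms unfolding coord_polys_def by simp
  from bchoice[OF this] obtain a where a: "\<forall>n\<in>I. f n = (\<lambda>x. \<Sum>k\<in>{k. \<forall>i. k $ i \<le> m}. a n k * complex_of_real (\<Prod>i\<in>UNIV. (x $ i) ^ (k $ i)))" ..
  have "(\<Sum>n\<in>I. c n * f n x) = (\<Sum>k\<in>{k. \<forall>i. k $ i \<le> m}. (\<Sum>n\<in>I. c n * a n k) * complex_of_real (\<Prod>i\<in>UNIV. (x $ i) ^ (k $ i)))" for x
  proof -
    have "(\<Sum>n\<in>I. c n * f n x) = (\<Sum>n\<in>I. \<Sum>k\<in>{k. \<forall>i. k $ i \<le> m}. c n * (a n k * complex_of_real (\<Prod>i\<in>UNIV. (x $ i) ^ (k $ i))))"
      by (intro sum.cong refl) (simp add: a sum_distrib_left)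
    also have "\<dots> = (\<Sum>k\<in>{k. \<forall>i. k $ i \<le> m}. \<Sum>n\<in>I. c n * (a n k * complex_of_real (\<Prod>i\<in>UNIV. (x $ i) ^ (k $ i))))"
      by (rule sum.swap)
    finally show ?thesis by (simp only: sum_distrib_right mult.assoc)
  qed
  then show ?thesis unfolding coord_polys_def
    by (intro CollectI exI[of _ "\<lambda>k. \<Sum>n\<in>I. c n * a n k"] ext)
qed

lemma coord_polys_prod:
  fixes p :: "'d::finite \<Rightarrow> real poly"
  assumes "\<And>i. degree (p i) \<le> m"
  shows "(\<lambda>x. complex_of_real (\<Prod>i\<in>UNIV. poly (p i) (x $ i))) \<in> coord_polys m"
proof -
  have "poly (p i) t = (\<Sum>k\<in>{..m}. coeff (p i) k * t ^ k)" for i t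
    unfolding poly_altdef using assms[of i]
    by (intro sum.mono_neutral_left) (auto simp: coeff_eq_0)
  then have "(\<Prod>i\<in>UNIV. poly (p i) (x $ i)) = (\<Sum>k\<in>{k::nat^'d. \<forall>i. k $ i \<in> {..m}}. \<Prod>i\<in>UNIV. coeff (p i) (k $ i) * (x $ i) ^ (k $ i))" for x
    by (simp only: prod_sum_vec finite_atMost)
  then have "(\<lambda>x. complex_of_real (\<Prod>i\<in>UNIV. poly (p i) (x $ i))) =
     (\<lambda>x. \<Sum>k\<in>{k::nat^'d. \<forall>i. k $ i \<le> m}. complex_of_real (\<Prod>i\<in>UNIV. coeff (p i) (k $ i)) * complex_of_real (\<Prod>i\<in>UNIV. (x $ i) ^ (k $ i)))"
    by (simp add: prod.distrib)
  then show ?thesis unfolding coord_polys_def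
    by (intro CollectI exI[of _ "\<lambda>k. complex_of_real (\<Prod>i\<in>UNIV. coeff (p i) (k $ i))"])
qed

definition lagrange_prod :: "nat \<Rightarrow> int^'d \<Rightarrow> real^'d \<Rightarrow> real" where
  "lagrange_prod l n x = (\<Prod>i\<in>UNIV. int_lagrange l (n $ i) (x $ i))"

lemma lagrange_sum_coord_poly:
  "(\<lambda>x. \<Sum>n\<in>index_cube l. c n * of_real (lagrange_prod l n x)) \<in> coord_polys (2 * l)"
proof (rule coord_polys_sum)
  fix n assume "n \<in> index_cube l"
  then show "(\<lambda>x. of_real (lagrange_prod l n x)) \<in> coord_polys (2 * l)"
    unfolding lagrange_prod_def poly_lagrange_poly[symmetric]
    by (intro coord_polys_prod degree_lagrange_poly) (auto simp: index_cube_def)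
qed

text \<open>
By linearity it suffices to consider a monomial, which is a product of powers of single coordinates;
interpolate each factor and expand the product.
\<close>

lemma coord_poly_lagrange:
  fixes p :: "real^'d::finite \<Rightarrow> complex"
  assumes "p \<in> coord_polys (2 * l)"
  shows "p x = (\<Sum>n\<in>index_cube l. p (ivec n) * of_real (lagrange_prod l n x))"
proof -
  let ?K = "{k::nat^'d. \<forall>i. k $ i \<le> 2 * l}"
  obtain c where c: "p = (\<lambda>x. \<Sum>k\<in>?K. c k * complex_of_real (\<Prod>i\<in>UNIV. (x $ i) ^ (k $ i)))"
    using assms by (auto simp: coord_polys_def)
  have mono: "(\<Prod>i\<in>UNIV. (x $ i) ^ (k $ i)) = (\<Sum>n\<in>index_cube l. (\<Prod>i\<in>UNIV. (ivec n $ i) ^ (k $ i)) * lagrange_prod l n x)"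
    if "k \<in> ?K" for k
  proof -
    have "(x $ i) ^ (k $ i) = (\<Sum>j\<in>{- int l..int l}. of_int j ^ (k $ i) * int_lagrange l j (x $ i))" for i
      using int_lagrange_interpolation[of "monom 1 (k $ i)" l "x $ i"] that by (simp add: poly_monom degree_monom_eq)
    then have "(\<Prod>i\<in>UNIV. (x $ i) ^ (k $ i)) = (\<Prod>i\<in>UNIV. \<Sum>j\<in>{- int l..int l}. of_int j ^ (k $ i) * int_lagrange l j (x $ i))"
      by simp
    also have "\<dots> = (\<Sum>n\<in>index_cube l. \<Prod>i\<in>UNIV. of_int (n $ i) ^ (k $ i) * int_lagrange l (n $ i) (x $ i))"
      by (rule sum_index_cube_prod[symmetric])
    finally have "(\<Prod>i\<in>UNIV. (x $ i) ^ (k $ i)) = (\<Sum>n\<in>index_cube l. \<Prod>i\<in>UNIV. of_int (n $ i) ^ (k $ i) * int_lagrange l (n $ i) (x $ i))" .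
    then show ?thesis by (simp add: prod.distrib lagrange_prod_def)
  qed
  have "p x = (\<Sum>k\<in>?K. c k * complex_of_real (\<Sum>n\<in>index_cube l. (\<Prod>i\<in>UNIV. (ivec n $ i) ^ (k $ i)) * lagrange_prod l n x))"
    unfolding c by (intro sum.cong refl) (simp only: mono)
  also have "\<dots> = (\<Sum>k\<in>?K. \<Sum>n\<in>index_cube l. c k * complex_of_real (\<Prod>i\<in>UNIV. (ivec n $ i) ^ (k $ i)) * of_real (lagrange_prod l n x))"
    by (simp only: of_real_sum of_real_mult sum_distrib_left mult.assoc)
  also have "\<dots> = (\<Sum>n\<in>index_cube l. \<Sum>k\<in>?K. c k * complex_of_real (\<Prod>i\<in>UNIV. (ivec n $ i) ^ (k $ i)) * of_real (lagrange_prod l n x))"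
    by (rule sum.swap)
  also have "\<dots> = (\<Sum>n\<in>index_cube l. p (ivec n) * of_real (lagrange_prod l n x))"
    unfolding c by (simp only: sum_distrib_right)
  finally show ?thesis .
qed

definition tail_prod :: "nat \<Rightarrow> real^'d \<Rightarrow> real" where
  "tail_prod l x = (\<Prod>i\<in>UNIV. sinc_tail l (x $ i))"

lemma tail_prod_ivec_pos: "n \<in> index_cube l \<Longrightarrow> tail_prod l (ivec n) > 0" for n :: "int^'d::finite"
proof -
  assume n: "n \<in> index_cube l"
  have "\<bar>real_of_int (n $ i)\<bar> < real l + 1" for i
  proof -
    have "- int l \<le> n $ i" "n $ i \<le> int l" using n by (auto simp: index_cube_def)
    then have "\<bar>n $ i\<bar> \<le> int l" by linarith
    then have "real_of_int \<bar>n $ i\<bar> \<le> real_of_int (int l)" by (simp only: of_int_le_iff)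
    then show ?thesis by simp
  qed
  then show ?thesis unfolding tail_prod_def by (intro prod_pos) (auto intro: sinc_tail_pos)
qed

text \<open>
A polynomial is determined by its values on the lattice cube, and the tail turns each Lagrange basis
polynomial into the transform of an exponential (\<open>sincpi_shift\<close>). So multiplication with the tail
carries polynomials of coordinate degree at most \<open>2 l\<close> to transforms of trigonometric polynomials.
\<close>

lemma tail_prod_coord_poly:
  fixes p :: "real^'d::finite \<Rightarrow> complex"
  assumes "p \<in> coord_polys (2 * l)"
  shows "of_real (tail_prod l x) * p x = hat (trig_sum l (\<lambda>n. of_real (tail_prod l (ivec n)) * p (ivec n))) x"
proof -
  have s: "sincpi (- y) = sincpi y" for y by (simp add: sincpi_def)
  have 1: "tail_prod l x * lagrange_prod l n x = tail_prod l (ivec n) * (\<Prod>i\<in>UNIV. sincpi (of_int (n $ i) - x $ i))"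
    if "n \<in> index_cube l" for n
  proof -
    have "sincpi (of_int (n $ i) - x $ i) * sinc_tail l (of_int (n $ i)) = int_lagrange l (n $ i) (x $ i) * sinc_tail l (x $ i)" for i
      using sincpi_shift[of "n $ i" l "x $ i"] s[of "of_int (n $ i) - x $ i"] that by (simp add: index_cube_def)
    then have "(\<Prod>i\<in>UNIV. sincpi (of_int (n $ i) - x $ i) * sinc_tail l (of_int (n $ i))) = (\<Prod>i\<in>UNIV. int_lagrange l (n $ i) (x $ i) * sinc_tail l (x $ i))"
      by simp
    then show ?thesis by (simp add: tail_prod_def lagrange_prod_def prod.distrib mult.commute)
  qed
  have "of_real (tail_prod l x) * p x = (\<Sum>n\<in>index_cube l. p (ivec n) * of_real (tail_prod l x * lagrange_prod l n x))"
    by (subst coord_poly_lagrange[OF assms]) (simp add: sum_distrib_left mult_ac)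
  also have "\<dots> = (\<Sum>n\<in>index_cube l. of_real (tail_prod l (ivec n)) * p (ivec n) * of_real (\<Prod>i\<in>UNIV. sincpi (of_int (n $ i) - x $ i)))"
    by (intro sum.cong refl) (simp only: 1 of_real_mult mult_ac)
  finally show ?thesis by (simp add: hat_trig_sum)
qed

text \<open>
The converse direction: the tail does not vanish on the lattice cube, so the Fourier coefficients of
\<open>h\<close> can be divided by it and interpolated.
\<close>

lemma trig_poly_coord_poly:
  fixes h :: "real^'d::finite \<Rightarrow> complex"
  assumes h: "h \<in> trig_polys l"
  obtains p where "p \<in> coord_polys (2 * l)" "\<And>x. of_real (tail_prod l x) * p x = hat h x"
proof -
  define c where "c n = hat h (ivec n) / of_real (tail_prod l (ivec n))" for n
  define p where "p x = (\<Sum>n\<in>index_cube l. c n * of_real (lagrange_prod l n x))" for x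
  have p: "p \<in> coord_polys (2 * l)" unfolding p_def[abs_def] by (rule lagrange_sum_coord_poly)
  have "p (ivec m) = c m" if m: "m \<in> index_cube l" for m
  proof -
    have "lagrange_prod l n (ivec m) = (if m = n then 1 else 0)" if n: "n \<in> index_cube l" for n
    proof -
      have "lagrange_prod l n (ivec m) = (\<Prod>i\<in>UNIV. if m $ i = n $ i then 1 else 0)"
        unfolding lagrange_prod_def using m n
        by (intro prod.cong refl) (auto simp: index_cube_def int_lagrange_node)
      also have "\<dots> = (if m = n then 1 else 0)"
      proof (cases "m = n")
        case False
        then obtain i where "m $ i \<noteq> n $ i" by (auto simp: vec_eq_iff)
        then have "(\<Prod>i\<in>UNIV. if m $ i = n $ i then 1 else 0 :: real) = 0"
          by (intro prod_zero bexI[of _ i]) auto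
        with False show ?thesis by simp
      qed simp
      finally show ?thesis .
    qed
    then have "p (ivec m) = (\<Sum>n\<in>index_cube l. if m = n then c n else 0)"
      unfolding p_def by (intro sum.cong refl) simp
    then show ?thesis using m by simp
  qed
  then have *: "of_real (tail_prod l (ivec n)) * p (ivec n) = hat h (ivec n)" if "n \<in> index_cube l" for n
    using that tail_prod_ivec_pos[OF that] by (simp add: c_def)
  have "trig_sum l (\<lambda>n. of_real (tail_prod l (ivec n)) * p (ivec n)) = trig_sum l (\<lambda>n. hat h (ivec n))"
    unfolding trig_sum_def[abs_def] by (intro ext sum.cong refl) (simp only: *)
  also have "\<dots> = h" by (rule trig_polys_expansion[OF h, symmetric])
  finally have "of_real (tail_prod l x) * p x = hat h x" for x
    using tail_prod_coord_poly[OF p, of x] by (simp only:)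
  with p show ?thesis by (rule that)
qed

section \<open>Completeness of the exponentials\<close>

text \<open>
On \<open>[-\<pi>, \<pi>]\<close> this is \<open>x - a\<close> shifted by \<open>\<pi>\<close> to the left of \<open>a\<close> and by \<open>-\<pi>\<close> to its right: the
\<open>2 \<pi>\<close>-periodic sawtooth with its jump at \<open>a\<close>. Its Fourier coefficients have moduli independent of \<open>a\<close>,
and indicators of intervals are combinations of sawtooth functions and constants.
\<close>

definition sawtooth :: "real \<Rightarrow> real \<Rightarrow> real" where
  "sawtooth a x = x - a - pi + 2 * pi * indicator {..a} x"

definition coef1 :: "(real \<Rightarrow> real) \<Rightarrow> int \<Rightarrow> complex" where
  "coef1 \<phi> k = (LBINT x:{-pi..pi}. complex_of_real (\<phi> x) * cnj (exp1 (of_int k) x))"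

definition Parseval1 :: "(real \<Rightarrow> real) \<Rightarrow> bool" where
  "Parseval1 \<phi> \<longleftrightarrow> \<phi> \<in> borel_measurable borel \<and> (\<exists>B. \<forall>x\<in>{-pi..pi}. \<bar>\<phi> x\<bar> \<le> B) \<and>
     (\<lambda>N. \<Sum>k\<in>{- int N..int N}. (cmod (coef1 \<phi> k))\<^sup>2) \<longlonglongrightarrow> (LBINT x:{-pi..pi}. (\<phi> x)\<^sup>2)"

lemma set_integrable_bounded_Icc:
  fixes f :: "real \<Rightarrow> 'a::{banach, second_countable_topology}"
  assumes "f \<in> borel_measurable borel" "\<And>x. x \<in> {a..b} \<Longrightarrow> norm (f x) \<le> B"
  shows "set_integrable lborel {a..b} f"
  unfolding set_integrable_def
  by (rule integrableI_bounded_set_indicator[where B = B])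
     (use assms in \<open>auto simp: emeasure_lborel_Icc_eq\<close>)

lemma Parseval1_one: "Parseval1 (\<lambda>_. 1)"
proof -
  have "coef1 (\<lambda>_. 1) k = (if k = 0 then complex_of_real (sqrt (2 * pi)) else 0)" for k
  proof -
    have "1 = complex_of_real (sqrt (2 * pi)) * exp1 0 x" for x by (simp add: exp1_def)
    then have "coef1 (\<lambda>_. 1) k = (LBINT x:{-pi..pi}. complex_of_real (sqrt (2 * pi)) * (exp1 0 x * cnj (exp1 (of_int k) x)))"
      unfolding coef1_def by (simp only: of_real_1 mult.assoc[symmetric])
    also have "\<dots> = complex_of_real (sqrt (2 * pi)) * of_real (sincpi (0 - of_int k))"
      by (simp only: set_integral_mult_right exp1_inner)
    also have "sincpi (0 - of_int k) = (if k = 0 then 1 else 0)"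
      using sincpi_of_int[of "- k"] by simp
    finally show ?thesis by simp
  qed
  then have "(\<Sum>k\<in>{- int N..int N}. (cmod (coef1 (\<lambda>_. 1) k))\<^sup>2) = 2 * pi" for N
    by (simp add: if_distrib[where f = "\<lambda>z. (cmod z)\<^sup>2"] cong: if_cong)
  moreover have "(LBINT x:{-pi..pi}. (1::real)\<^sup>2) = 2 * pi"
    by (simp add: set_integral_const)
  ultimately show ?thesis by (auto simp: Parseval1_def)
qed

lemma integral_exp_neg:
  assumes "k \<noteq> 0" "a \<le> b"
  shows "(LBINT x:{a..b}. exp (- (\<i> * complex_of_real k * complex_of_real x))) =
    \<i> / complex_of_real k * (exp (- (\<i> * complex_of_real k * complex_of_real b)) - exp (- (\<i> * complex_of_real k * complex_of_real a)))"
proof -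
  have "exp (- (\<i> * complex_of_real k * complex_of_real x)) = exp (\<i> * complex_of_real (- k * x))" for x by (simp add: mult.assoc)
  moreover have "z / (\<i> * complex_of_real (- k)) = \<i> / complex_of_real k * z" for z
    using assms(1) by (simp add: field_simps)
  ultimately show ?thesis using exp_integral_value[of "- k" a b] assms by simp
qed

lemma integral_id_exp_neg:
  assumes "k \<noteq> 0"
  shows "(LBINT x:{-pi..pi}. complex_of_real x * exp (- (\<i> * complex_of_real k * complex_of_real x))) =
    (\<i> * of_real pi / complex_of_real k + 1 / (complex_of_real k)\<^sup>2) * exp (- (\<i> * complex_of_real k * complex_of_real pi))
    - (\<i> * of_real (- pi) / complex_of_real k + 1 / (complex_of_real k)\<^sup>2) * exp (- (\<i> * complex_of_real k * complex_of_real (- pi)))"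
    unfolding set_lebesgue_integral_def
proof (rule integral_FTC_Icc)
  show "- pi \<le> pi" by simp
  fix x :: real
  define K where "K = complex_of_real k"
  have K: "K \<noteq> 0" using assms by (simp add: K_def)
  have "((\<lambda>z. (\<i> * z / K + 1 / K\<^sup>2) * exp (- (\<i> * K * z))) has_field_derivative
       ((\<i> / K) * exp (- (\<i> * K * of_real x)) + (\<i> * of_real x / K + 1 / K\<^sup>2) * (exp (- (\<i> * K * of_real x)) * (- (\<i> * K))))) (at (of_real x))"
    using K by (auto intro!: derivative_eq_intros)
  moreover have "(\<i> / K) * E + (\<i> * z / K + 1 / K\<^sup>2) * (E * (- (\<i> * K))) = z * E" for z E
    using K by (simp add: field_simps power2_eq_square)
  ultimately have "((\<lambda>z. (\<i> * z / K + 1 / K\<^sup>2) * exp (- (\<i> * K * z))) has_field_derivative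
       (of_real x * exp (- (\<i> * K * of_real x)))) (at (of_real x))" by simp
  from has_vector_derivative_real_field[OF this]
  show "((\<lambda>x. (\<i> * of_real x / complex_of_real k + 1 / (complex_of_real k)\<^sup>2) * exp (- (\<i> * complex_of_real k * complex_of_real x)))
     has_vector_derivative complex_of_real x * exp (- (\<i> * complex_of_real k * complex_of_real x))) (at x within {-pi..pi})"
    unfolding K_def by (rule has_vector_derivative_at_within)
  show "continuous_on {-pi..pi} (\<lambda>x. complex_of_real x * exp (- (\<i> * complex_of_real k * complex_of_real x)))" by (intro continuous_intros)
qed

text \<open>
Split the sawtooth into \<open>x\<close>, a constant and an indicator, and integrate each part explicitly. For
\<open>k \<noteq> 0\<close> the contributions of the endpoints \<open>-\<pi>\<close> and \<open>\<pi>\<close> cancel, and only the jump at \<open>a\<close> remains.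
\<close>

lemma coef1_sawtooth:
  assumes a: "-pi \<le> a" "a \<le> pi"
  shows "(cmod (coef1 (sawtooth a) k))\<^sup>2 = (if k = 0 then 0 else 2 * pi / (of_int k)\<^sup>2)"
proof -
  let ?K = "complex_of_real (of_int k)"
  let ?E = "\<lambda>x. exp (- (\<i> * ?K * complex_of_real x))"
  define c where "c = complex_of_real (1 / sqrt (2 * pi))"
  have cE: "cnj (exp1 (of_int k) x) = c * ?E x" for x
    by (simp add: exp1_def c_def exp_cnj mult.assoc)
  have int: "set_integrable lborel {s..t} ?E" "set_integrable lborel {s..t} (\<lambda>x. complex_of_real x * ?E x)" for s t
    by (intro borel_integrable_atLeastAtMost' continuous_intros)+
  have Iab: "indicator {-pi..pi} x * indicator {..a} x = (indicator {-pi..a} x :: real)" for x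
    using a by (auto simp: indicator_def)
  have int3: "set_integrable lborel {-pi..pi} (\<lambda>x. complex_of_real (indicator {..a} x) * ?E x)"
    "(LBINT x:{-pi..pi}. complex_of_real (indicator {..a} x) * ?E x) = (LBINT x:{-pi..a}. ?E x)"
  proof -
    have eq: "indicator {-pi..pi} x *\<^sub>R (complex_of_real (indicator {..a} x) * ?E x) = indicator {-pi..a} x *\<^sub>R ?E x" for x
      unfolding Iab[symmetric] by (simp add: scaleR_conv_of_real)
    show "set_integrable lborel {-pi..pi} (\<lambda>x. complex_of_real (indicator {..a} x) * ?E x)"
      using int(1)[of "-pi" a] unfolding set_integrable_def eq .
    show "(LBINT x:{-pi..pi}. complex_of_real (indicator {..a} x) * ?E x) = (LBINT x:{-pi..a}. ?E x)"
      unfolding set_lebesgue_integral_def eq ..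
  qed
  define X where "X = (LBINT x:{-pi..pi}. complex_of_real x * ?E x)"
  define Y where "Y = (LBINT x:{-pi..pi}. ?E x)"
  define Z where "Z = (LBINT x:{-pi..a}. ?E x)"
  have "coef1 (sawtooth a) k = (LBINT x:{-pi..pi}. c * (complex_of_real x * ?E x - complex_of_real (a + pi) * ?E x
      + complex_of_real (2 * pi) * (complex_of_real (indicator {..a} x) * ?E x)))"
    unfolding coef1_def cE sawtooth_def by (intro arg_cong2[where f = "set_lebesgue_integral lborel"] refl ext) (simp add: algebra_simps)
  also have "\<dots> = c * (X - complex_of_real (a + pi) * Y + complex_of_real (2 * pi) * Z)"
    unfolding X_def Y_def Z_def int3(2)[symmetric]
    by (simp only: set_integral_mult_right set_integral_add set_integral_diff int int3 set_integrable_mult_right)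
  finally have eq: "coef1 (sawtooth a) k = c * (X - complex_of_real (a + pi) * Y + complex_of_real (2 * pi) * Z)" .
  have cc: "(cmod c)\<^sup>2 = 1 / (2 * pi)" by (simp add: c_def power_divide norm_divide)
  show ?thesis
  proof (cases "k = 0")
    case True
    have "(\<integral>x. indicator {-pi..pi} x *\<^sub>R complex_of_real x \<partial>lborel) = complex_of_real (pi\<^sup>2 / 2) - complex_of_real ((- pi)\<^sup>2 / 2)"
    proof (rule integral_FTC_Icc)
      fix x :: real
      show "((\<lambda>x. complex_of_real (x\<^sup>2 / 2)) has_vector_derivative complex_of_real x) (at x within {-pi..pi})"
        by (intro has_vector_derivative_of_real) (auto intro!: derivative_eq_intros)
    qed (auto intro: continuous_intros)
    then have "X = 0" unfolding X_def True set_lebesgue_integral_def by simp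
    moreover have "Y = complex_of_real (2 * pi)" unfolding Y_def True by (simp add: set_integral_const scaleR_conv_of_real)
    moreover have "Z = complex_of_real (a + pi)" unfolding Z_def True using a by (simp add: set_integral_const scaleR_conv_of_real)
    ultimately have "coef1 (sawtooth a) k = 0" unfolding eq by simp
    then show ?thesis using True by simp
  next
    case False
    have sg: "?E pi = ?E (- pi)"
    proof -
      have "exp (- (\<i> * ?K * complex_of_real (- pi))) = exp (- (\<i> * ?K * complex_of_real pi) + \<i> * (of_int k * (of_real pi * 2)))"
        by (rule arg_cong[where f = exp]) (simp add: algebra_simps)
      then show ?thesis by (simp only: exp_plus_2pin)
    qed
    have k0: "real_of_int k \<noteq> 0" using False by simp
    define A where "A = \<i> * of_real pi / ?K"
    have "X = (A + 1 / ?K\<^sup>2) * ?E pi - (- A + 1 / ?K\<^sup>2) * ?E (- pi)"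
      unfolding X_def integral_id_exp_neg[OF k0] A_def by simp
    then have X: "X = 2 * A * ?E pi" unfolding sg[symmetric] by (simp only: left_diff_distrib[symmetric]) simp
    have Y: "Y = 0"
      unfolding Y_def by (subst integral_exp_neg[OF k0]) (simp_all only: sg[symmetric], simp_all)
    have "Z = \<i> / ?K * (?E a - ?E pi)"
      unfolding Z_def using a by (subst integral_exp_neg[OF k0]) (simp_all only: sg[symmetric])
    then have "complex_of_real (2 * pi) * Z = 2 * A * (?E a - ?E pi)"
      unfolding A_def by simp
    then have "coef1 (sawtooth a) k = c * (2 * A * ?E a)"
      unfolding eq X Y by (simp only: right_diff_distrib) simp
    then have "coef1 (sawtooth a) k = c * (2 * \<i> * of_real pi / ?K * ?E a)"
      by (simp add: A_def)
    moreover have "cmod (?E a) = 1" by (simp add: norm_exp_eq_Re)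
    ultimately have "(cmod (coef1 (sawtooth a) k))\<^sup>2 = 1 / (2 * pi) * (2 * pi / \<bar>of_int k\<bar>)\<^sup>2"
      by (simp only: norm_mult power_mult_distrib cc norm_divide) (simp add: norm_mult)
    also have "\<dots> = 2 * pi / (of_int k)\<^sup>2" by (simp add: power_divide power2_eq_square)
    finally show ?thesis using False by simp
  qed
qed

lemma sum_symmetric_interval:
  fixes f :: "int \<Rightarrow> real"
  assumes "f 0 = 0" "\<And>k. f (- k) = f k"
  shows "(\<Sum>k\<in>{- int N..int N}. f k) = 2 * (\<Sum>n<N. f (int n + 1))"
proof (induction N)
  case (Suc N)
  have eq: "{- int (Suc N)..int (Suc N)} = insert (- int (Suc N)) (insert (int (Suc N)) {- int N..int N})" by auto
  show ?case unfolding eq using Suc assms(2)[of "int N + 1"] by (simp add: add.commute)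
qed (simp add: assms)

lemma sawtooth_measurable [measurable]: "sawtooth a \<in> borel_measurable borel"
  unfolding sawtooth_def[abs_def] by measurable

text \<open>
Parseval's equation for the sawtooth is Euler's \<open>\<Sum> 1/n\<^sup>2 = \<pi>\<^sup>2/6\<close>: both sides equal \<open>2 \<pi>\<^sup>3 / 3\<close>.
\<close>

lemma Parseval1_sawtooth:
  assumes a: "-pi \<le> a" "a \<le> pi"
  shows "Parseval1 (sawtooth a)"
proof -
  have sq: "(sawtooth a x)\<^sup>2 = (x - a - pi)\<^sup>2 + indicator {..a} x * (4 * pi * (x - a))" for x
    by (auto simp: sawtooth_def indicator_def power2_eq_square algebra_simps)
  have Iab: "indicator {-pi..pi} x * indicator {..a} x = (indicator {-pi..a} x :: real)" for x
    using a by (auto simp: indicator_def)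
  have eq: "indicator {-pi..pi} x *\<^sub>R (indicator {..a} x * (4 * pi * (x - a))) = indicator {-pi..a} x *\<^sub>R (4 * pi * (x - a))" for x
    unfolding Iab[symmetric] by simp
  have i1: "set_integrable lborel {-pi..pi} (\<lambda>x. (x - a - pi)\<^sup>2)"
    "set_integrable lborel {-pi..a} (\<lambda>x. 4 * pi * (x - a))"
    by (intro borel_integrable_atLeastAtMost' continuous_intros)+
  have i2: "set_integrable lborel {-pi..pi} (\<lambda>x. indicator {..a} x * (4 * pi * (x - a)))"
    using i1(2) unfolding set_integrable_def eq .
  have "(LBINT x:{-pi..pi}. (sawtooth a x)\<^sup>2) = (LBINT x:{-pi..pi}. (x - a - pi)\<^sup>2) + (LBINT x:{-pi..pi}. indicator {..a} x * (4 * pi * (x - a)))"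
    unfolding sq by (rule set_integral_add(2)[OF i1(1) i2])
  also have "(LBINT x:{-pi..pi}. indicator {..a} x * (4 * pi * (x - a))) = (LBINT x:{-pi..a}. 4 * pi * (x - a))"
    unfolding set_lebesgue_integral_def eq ..
  also have "\<dots> = 2 * pi * (a - a)\<^sup>2 - 2 * pi * (- pi - a)\<^sup>2"
    unfolding set_lebesgue_integral_def
  proof (rule integral_FTC_Icc)
    fix x :: real
    show "((\<lambda>x. 2 * pi * (x - a)\<^sup>2) has_vector_derivative 4 * pi * (x - a)) (at x within {- pi..a})"
      unfolding has_real_derivative_iff_has_vector_derivative[symmetric] by (auto intro!: derivative_eq_intros)
  qed (use a in \<open>auto intro!: continuous_intros\<close>)
  also have "(LBINT x:{-pi..pi}. (x - a - pi)\<^sup>2) = (pi - a - pi)^3 / 3 - (- pi - a - pi)^3 / 3"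
    unfolding set_lebesgue_integral_def
  proof (rule integral_FTC_Icc)
    fix x :: real
    show "((\<lambda>x. (x - a - pi)^3 / 3) has_vector_derivative (x - a - pi)\<^sup>2) (at x within {- pi..pi})"
      unfolding has_real_derivative_iff_has_vector_derivative[symmetric] by (auto intro!: derivative_eq_intros)
  qed (auto intro!: continuous_intros)
  also have "(pi - a - pi)^3 / 3 - (- pi - a - pi)^3 / 3 + (2 * pi * (a - a)\<^sup>2 - 2 * pi * (- pi - a)\<^sup>2) = 2 * pi^3 / 3"
    by (simp add: power2_eq_square power3_eq_cube field_simps)
  finally have int: "(LBINT x:{-pi..pi}. (sawtooth a x)\<^sup>2) = 2 * pi^3 / 3" .
  have "(\<Sum>k\<in>{- int N..int N}. (cmod (coef1 (sawtooth a) k))\<^sup>2) = 4 * pi * (\<Sum>n<N. 1 / (real n + 1)\<^sup>2)" for N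
    unfolding coef1_sawtooth[OF a] by (subst sum_symmetric_interval) (auto simp: sum_distrib_left)
  moreover have "(\<lambda>N. 4 * pi * (\<Sum>n<N. 1 / (real n + 1)\<^sup>2)) \<longlonglongrightarrow> 4 * pi * (pi\<^sup>2 / 6)"
    using inverse_squares_sums by (intro tendsto_intros) (simp add: sums_def add.commute)
  moreover have "4 * pi * (pi\<^sup>2 / 6) = 2 * pi^3 / 3" by (simp add: power2_eq_square power3_eq_cube)
  ultimately have "(\<lambda>N. \<Sum>k\<in>{- int N..int N}. (cmod (coef1 (sawtooth a) k))\<^sup>2) \<longlonglongrightarrow> 2 * pi^3 / 3"
    by (simp only:)
  moreover have "\<forall>x\<in>{-pi..pi}. \<bar>sawtooth a x\<bar> \<le> 6 * pi"
    using a by (auto simp: sawtooth_def indicator_def)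
  ultimately show ?thesis unfolding Parseval1_def int using sawtooth_measurable by blast
qed

text \<open>
These functions form a closed subspace of \<open>L\<^sub>2\<close>. Completeness of the exponentials means that it is
everything, which is shown for larger and larger classes of functions.
\<close>

definition fourier_conv :: "(real^'d \<Rightarrow> complex) \<Rightarrow> bool" where
  "fourier_conv u \<longleftrightarrow> u \<in> L2 (cube pi) \<and> (\<lambda>l. L2_norm_on (cube pi) (\<lambda>x. u x - fourier_sum l u x)) \<longlonglongrightarrow> 0"

lemma fourier_convI_Parseval:
  fixes u :: "real^'d::finite \<Rightarrow> complex"
  assumes u: "u \<in> L2 (cube pi)"
    and lim: "(\<lambda>l. \<Sum>n\<in>index_cube l. (cmod (hat u (ivec n)))\<^sup>2) \<longlonglongrightarrow> (L2_norm_on (cube pi) u)\<^sup>2"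
  shows "fourier_conv u"
proof -
  have "(\<lambda>l. (L2_norm_on (cube pi) (\<lambda>x. u x - fourier_sum l u x))\<^sup>2) \<longlonglongrightarrow> (L2_norm_on (cube pi) u)\<^sup>2 - (L2_norm_on (cube pi) u)\<^sup>2"
    unfolding norm_diff_fourier_sum[OF u] by (intro tendsto_intros lim)
  from tendsto_real_sqrt[OF this] show ?thesis using u by (simp add: fourier_conv_def)
qed

lemma L2_fourier_sum [simp, intro]: "fourier_sum l f \<in> L2 (cube r)" for f :: "real^'d::finite \<Rightarrow> complex"
  by (simp add: fourier_sum_def)

lemma fourier_sum_add:
  fixes u v :: "real^'d::finite \<Rightarrow> complex"
  assumes "u \<in> L2 (cube pi)" "v \<in> L2 (cube pi)"
  shows "fourier_sum l (\<lambda>x. u x + v x) x = fourier_sum l u x + fourier_sum l v x"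
  using assms by (simp add: fourier_sum_def trig_sum_def hat_def L2_inner_add_left distrib_right sum.distrib)

lemma fourier_sum_scale:
  "fourier_sum l (\<lambda>x. c * u x) x = c * fourier_sum l u x"
  by (simp add: fourier_sum_def trig_sum_def hat_def L2_inner_scale_left sum_distrib_left mult.assoc)

lemma fourier_conv_add:
  fixes u v :: "real^'d::finite \<Rightarrow> complex"
  assumes "fourier_conv u" "fourier_conv v"
  shows "fourier_conv (\<lambda>x. u x + v x)"
  unfolding fourier_conv_def
proof (intro conjI)
  have uv: "u \<in> L2 (cube pi)" "v \<in> L2 (cube pi)" using assms by (auto simp: fourier_conv_def)
  then show "(\<lambda>x. u x + v x) \<in> L2 (cube pi)" by (rule L2_add)
  have "(\<lambda>l. L2_norm_on (cube pi) (\<lambda>x. u x - fourier_sum l u x) + L2_norm_on (cube pi) (\<lambda>x. v x - fourier_sum l v x)) \<longlonglongrightarrow> 0"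
    using assms by (intro tendsto_add_zero) (auto simp: fourier_conv_def)
  then show "(\<lambda>l. L2_norm_on (cube pi) (\<lambda>x. u x + v x - fourier_sum l (\<lambda>x. u x + v x) x)) \<longlonglongrightarrow> 0"
  proof (rule tendsto_sandwich[OF _ _ tendsto_const, rotated -1], goal_cases)
    case 2
    show ?case
      using L2_norm_triangle[OF L2_diff[OF uv(1) L2_fourier_sum] L2_diff[OF uv(2) L2_fourier_sum]]
      by (intro always_eventually allI) (simp add: fourier_sum_add[OF uv] algebra_simps)
  qed simp
qed

lemma fourier_conv_scale:
  fixes u :: "real^'d::finite \<Rightarrow> complex"
  assumes "fourier_conv u"
  shows "fourier_conv (\<lambda>x. c * u x)"
proof -
  have "L2_norm_on (cube pi) (\<lambda>x. c * u x - fourier_sum l (\<lambda>x. c * u x) x) = cmod c * L2_norm_on (cube pi) (\<lambda>x. u x - fourier_sum l u x)" for l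
    unfolding fourier_sum_scale right_diff_distrib[symmetric] L2_norm_scale ..
  then show ?thesis using assms by (auto simp: fourier_conv_def L2_scale tendsto_mult_right_zero)
qed

lemma norm_diff_fourier_sum_le:
  fixes u :: "real^'d::finite \<Rightarrow> complex"
  assumes "u \<in> L2 (cube pi)"
  shows "L2_norm_on (cube pi) (\<lambda>x. u x - fourier_sum l u x) \<le> L2_norm_on (cube pi) u"
  by (rule power2_le_imp_le) (auto simp: norm_diff_fourier_sum[OF assms] sum_nonneg)

text \<open>
Approximation by \<open>v\<close> costs at most \<open>\<parallel>u - v\<parallel>\<close>, because removing a Fourier sum does not increase the norm.
\<close>

lemma fourier_conv_limit:
  fixes u :: "real^'d::finite \<Rightarrow> complex"
  assumes u: "u \<in> L2 (cube pi)" and v: "\<And>i. fourier_conv (v i)"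
    and lim: "(\<lambda>i::nat. L2_norm_on (cube pi) (\<lambda>x. u x - v i x)) \<longlonglongrightarrow> 0"
  shows "fourier_conv u"
  unfolding fourier_conv_def
proof (intro conjI u LIMSEQ_I)
  fix e :: real assume e: "e > 0"
  obtain i where i: "L2_norm_on (cube pi) (\<lambda>x. u x - v i x) < e / 2"
    using LIMSEQ_D[OF lim, of "e / 2"] e by auto
  have vL: "v i \<in> L2 (cube pi)" using v by (simp add: fourier_conv_def)
  obtain N where N: "\<And>l. l \<ge> N \<Longrightarrow> L2_norm_on (cube pi) (\<lambda>x. v i x - fourier_sum l (v i) x) < e / 2"
    using v[of i] LIMSEQ_D[of "\<lambda>l. L2_norm_on (cube pi) (\<lambda>x. v i x - fourier_sum l (v i) x)" 0 "e / 2"] e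
    by (auto simp: fourier_conv_def)
  show "\<exists>N. \<forall>l\<ge>N. norm (L2_norm_on (cube pi) (\<lambda>x. u x - fourier_sum l u x) - 0) < e"
  proof (intro exI[of _ N] allI impI)
    fix l assume l: "l \<ge> N"
    have d: "(\<lambda>x. u x - v i x) \<in> L2 (cube pi)" by (rule L2_diff[OF u vL])
    have "fourier_sum l u x = fourier_sum l (\<lambda>x. u x - v i x) x + fourier_sum l (v i) x" for x
      using fourier_sum_add[OF d vL, of l x] by simp
    then have "L2_norm_on (cube pi) (\<lambda>x. u x - fourier_sum l u x)
       = L2_norm_on (cube pi) (\<lambda>x. ((u x - v i x) - fourier_sum l (\<lambda>x. u x - v i x) x) + (v i x - fourier_sum l (v i) x))"
      by (simp add: algebra_simps)
    also have "\<dots> \<le> L2_norm_on (cube pi) (\<lambda>x. (u x - v i x) - fourier_sum l (\<lambda>x. u x - v i x) x) + L2_norm_on (cube pi) (\<lambda>x. v i x - fourier_sum l (v i) x)"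
      by (intro L2_norm_triangle L2_diff u vL L2_fourier_sum)
    also have "\<dots> \<le> L2_norm_on (cube pi) (\<lambda>x. u x - v i x) + L2_norm_on (cube pi) (\<lambda>x. v i x - fourier_sum l (v i) x)"
      using norm_diff_fourier_sum_le[OF d] by simp
    also have "\<dots> < e" using i N[OF l] by simp
    finally show "norm (L2_norm_on (cube pi) (\<lambda>x. u x - fourier_sum l u x) - 0) < e" by simp
  qed
qed

lemma fourier_conv_cong_AE:
  fixes u v :: "real^'d::finite \<Rightarrow> complex"
  assumes "fourier_conv u" "v \<in> borel_measurable (lebesgue_on (cube pi))" "ae_eq_on (cube pi) u v"
  shows "fourier_conv v"
proof -
  have um: "u \<in> borel_measurable (lebesgue_on (cube pi))" using assms by (auto simp: fourier_conv_def L2_def)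
  have "integrable (lebesgue_on (cube pi)) (\<lambda>x. (cmod (u x))\<^sup>2) = integrable (lebesgue_on (cube pi)) (\<lambda>x. (cmod (v x))\<^sup>2)"
    by (rule integrable_cong_AE) (use um assms(2,3) in \<open>auto simp: ae_eq_on_def\<close>)
  then have v: "v \<in> L2 (cube pi)" using assms(1,2) by (simp add: fourier_conv_def L2_def)
  have "ae_eq_on (cube pi) (\<lambda>x. v x - u x) (\<lambda>x. 0)"
    using assms(3) by (auto simp: ae_eq_on_def elim!: eventually_mono)
  then have "L2_norm_on (cube pi) (\<lambda>x. v x - u x) = L2_norm_on (cube pi) (\<lambda>x::real^'d. 0 :: complex)"
    using um assms(2) by (intro L2_norm_cong_AE) auto
  then have "L2_norm_on (cube pi) (\<lambda>x. v x - u x) = 0" by (simp add: L2_norm_on_def)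
  then show ?thesis using fourier_conv_limit[OF v, of "\<lambda>_. u"] assms(1) by simp
qed

lemma fourier_conv_dominated_limit:
  fixes u :: "real^'d::finite \<Rightarrow> complex"
  assumes u: "u \<in> L2 (cube pi)" and v: "\<And>i. fourier_conv (v i)"
    and lim: "\<And>x. x \<in> cube pi \<Longrightarrow> (\<lambda>i. v i x) \<longlonglongrightarrow> u x"
    and w: "integrable (lebesgue_on (cube pi)) w"
    and dom: "\<And>i x. x \<in> cube pi \<Longrightarrow> (cmod (u x - v i x))\<^sup>2 \<le> w x"
  shows "fourier_conv u"
proof (rule fourier_conv_limit[OF u v])
  have um: "u \<in> borel_measurable (lebesgue_on (cube pi))" using u by (simp add: L2_def)
  have vm: "v i \<in> borel_measurable (lebesgue_on (cube pi))" for i using v by (simp add: fourier_conv_def L2_def)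
  have "(\<lambda>i. \<integral>x. (cmod (u x - v i x))\<^sup>2 \<partial>lebesgue_on (cube pi)) \<longlonglongrightarrow> (\<integral>x. 0 \<partial>lebesgue_on (cube pi :: (real^'d) set))"
  proof (rule integral_dominated_convergence[OF _ _ w])
    show "AE x in lebesgue_on (cube pi). (\<lambda>i. (cmod (u x - v i x))\<^sup>2) \<longlonglongrightarrow> 0"
    proof (rule AE_I2)
      fix x assume "x \<in> space (lebesgue_on (cube pi :: (real^'d) set))"
      then have "(\<lambda>i. (cmod (u x - v i x))\<^sup>2) \<longlonglongrightarrow> (cmod (u x - u x))\<^sup>2"
        by (intro tendsto_intros lim) simp
      then show "(\<lambda>i. (cmod (u x - v i x))\<^sup>2) \<longlonglongrightarrow> 0" by simp
    qed
  qed (use um vm dom in \<open>auto intro!: AE_I2\<close>)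
  from tendsto_real_sqrt[OF this] show "(\<lambda>i. L2_norm_on (cube pi) (\<lambda>x. u x - v i x)) \<longlonglongrightarrow> 0"
    by (simp add: L2_norm_on_def)
qed

text \<open>
For a product of functions of one variable the Fourier coefficients and the square norm are products.
Summing over the index cube therefore multiplies the one-dimensional Parseval equations.
\<close>

lemma fourier_conv_prod:
  fixes \<phi> :: "'d::finite \<Rightarrow> real \<Rightarrow> real"
  assumes P: "\<And>i. Parseval1 (\<phi> i)"
  shows "fourier_conv (\<lambda>x::real^'d. \<Prod>i\<in>UNIV. complex_of_real (\<phi> i (x $ i)))"
proof -
  let ?u = "\<lambda>x::real^'d. \<Prod>i\<in>UNIV. complex_of_real (\<phi> i (x $ i))"
  have "\<forall>i. \<exists>B. \<forall>x\<in>{-pi..pi}. \<bar>\<phi> i x\<bar> \<le> B" using P by (simp add: Parseval1_def)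
  from choice[OF this] obtain B where B: "\<And>i x. x \<in> {-pi..pi} \<Longrightarrow> \<bar>\<phi> i x\<bar> \<le> B i" by blast
  have m [measurable]: "\<phi> i \<in> borel_measurable borel" for i using P by (simp add: Parseval1_def)
  have u: "?u \<in> L2 (cube pi)"
  proof (rule L2_cube_bounded[where B = "\<Prod>i\<in>UNIV. B i"])
    have "?u \<in> borel_measurable borel" by measurable
    then show "?u \<in> borel_measurable (lebesgue_on (cube pi))" by (rule borel_measurable_lebesgue_on)
    fix x :: "real^'d" assume "x \<in> cube pi"
    then show "cmod (?u x) \<le> (\<Prod>i\<in>UNIV. B i)"
      unfolding prod_norm[symmetric] by (intro prod_mono) (auto simp: mem_cube intro!: B)
  qed
  have e [measurable]: "exp1 s \<in> borel_measurable borel" for s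
    by (intro borel_measurable_continuous_onI continuous_intros)
  have "hat ?u (ivec n) = (\<Prod>i\<in>UNIV. coef1 (\<phi> i) (n $ i))" for n
  proof -
    have "has_bochner_integral (lebesgue_on (cube pi :: (real^'d) set)) (\<lambda>x. \<Prod>i\<in>UNIV. complex_of_real (\<phi> i (x $ i)) * cnj (exp1 (of_int (n $ i)) (x $ i)))
        (\<Prod>i\<in>UNIV. LBINT x:{-pi..pi}. complex_of_real (\<phi> i x) * cnj (exp1 (of_int (n $ i)) x))"
    proof (rule cube_prod_integral, rule set_integrable_bounded_Icc)
      fix i show "(\<lambda>x. complex_of_real (\<phi> i x) * cnj (exp1 (of_int (n $ i)) x)) \<in> borel_measurable borel"
        by measurable
      fix x assume "x \<in> {-pi..pi}"
      then show "cmod (complex_of_real (\<phi> i x) * cnj (exp1 (of_int (n $ i)) x)) \<le> B i * (1 / sqrt (2 * pi))"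
        unfolding norm_mult complex_mod_cnj norm_exp1 using B[of x i] by (intro mult_right_mono) auto
    qed
    then show ?thesis
      by (simp add: hat_def L2_inner_on_def exponential_eq_prod has_bochner_integral_iff prod.distrib coef1_def)
  qed
  then have "(\<Sum>n\<in>index_cube l. (cmod (hat ?u (ivec n)))\<^sup>2) = (\<Prod>i\<in>UNIV. \<Sum>k\<in>{- int l..int l}. (cmod (coef1 (\<phi> i) k))\<^sup>2)" for l
    by (simp add: prod_norm[symmetric] prod_power_distrib sum_index_cube_prod[symmetric])
  moreover have "(\<lambda>l. \<Prod>i\<in>UNIV. \<Sum>k\<in>{- int l..int l}. (cmod (coef1 (\<phi> i) k))\<^sup>2) \<longlonglongrightarrow> (\<Prod>i\<in>UNIV. LBINT x:{-pi..pi}. (\<phi> i x)\<^sup>2)"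
    using P by (intro tendsto_prod) (simp add: Parseval1_def)
  moreover have "(L2_norm_on (cube pi) ?u)\<^sup>2 = (\<Prod>i\<in>UNIV. LBINT x:{-pi..pi}. (\<phi> i x)\<^sup>2)"
  proof -
    have "has_bochner_integral (lebesgue_on (cube pi :: (real^'d) set)) (\<lambda>x. \<Prod>i\<in>UNIV. complex_of_real ((\<phi> i (x $ i))\<^sup>2))
        (\<Prod>i\<in>UNIV. LBINT x:{-pi..pi}. complex_of_real ((\<phi> i x)\<^sup>2))"
    proof (rule cube_prod_integral, rule set_integrable_bounded_Icc)
      fix i show "(\<lambda>x. complex_of_real ((\<phi> i x)\<^sup>2)) \<in> borel_measurable borel" by measurable
      fix x assume "x \<in> {-pi..pi}"
      then show "cmod (complex_of_real ((\<phi> i x)\<^sup>2)) \<le> (B i)\<^sup>2"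
        using power_mono[OF B[of x i], of 2] by (simp add: norm_power)
    qed
    then have "L2_inner_on (cube pi) ?u ?u = (\<Prod>i\<in>UNIV. LBINT x:{-pi..pi}. complex_of_real ((\<phi> i x)\<^sup>2))"
      by (simp add: L2_inner_on_def has_bochner_integral_iff prod.distrib[symmetric] power2_eq_square)
    also have "\<dots> = complex_of_real (\<Prod>i\<in>UNIV. LBINT x:{-pi..pi}. (\<phi> i x)\<^sup>2)"
      by (simp only: set_integral_complex_of_real of_real_prod)
    finally show ?thesis by (simp only: L2_inner_self of_real_eq_iff)
  qed
  ultimately show ?thesis by (intro fourier_convI_Parseval[OF u]) simp
qed

lemma fourier_conv_cong:
  fixes u v :: "real^'d::finite \<Rightarrow> complex"
  assumes "fourier_conv u" "\<And>x. x \<in> cube pi \<Longrightarrow> u x = v x"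
  shows "fourier_conv v"
proof (rule fourier_conv_cong_AE[OF assms(1)])
  have "u \<in> borel_measurable (lebesgue_on (cube pi))" using assms(1) by (simp add: fourier_conv_def L2_def)
  then show "v \<in> borel_measurable (lebesgue_on (cube pi))"
    by (subst measurable_cong[where g = u]) (use assms(2) in auto)
  show "ae_eq_on (cube pi) u v" unfolding ae_eq_on_def by (rule AE_I2) (use assms(2) in auto)
qed

text \<open>
The difference of two sawtooth functions is constant except for the jumps, so it is an indicator up to
scaling and a constant.
\<close>

lemma indicator_atMost_sawtooth:
  obtains \<alpha> \<beta> \<gamma> s1 s2 where "Parseval1 s1" "Parseval1 s2"
    "\<And>x. x \<in> {-pi..pi} \<Longrightarrow> indicator {..a} x = \<alpha> * s1 x + \<beta> * s2 x + \<gamma>"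
proof -
  consider "a < -pi" | "a > pi" | "-pi \<le> a" "a \<le> pi" by linarith
  then show thesis
  proof cases
    case 1
    then show thesis using that[of "\<lambda>_. 1" "\<lambda>_. 1" 0 0 0] Parseval1_one by (auto simp: indicator_def)
  next
    case 2
    then show thesis using that[of "\<lambda>_. 1" "\<lambda>_. 1" 0 0 1] Parseval1_one by (auto simp: indicator_def)
  next
    case 3
    have "indicator {..a} x = 1 / (2 * pi) * sawtooth a x + (- 1 / (2 * pi)) * sawtooth pi x + (a + pi) / (2 * pi)" if "x \<in> {-pi..pi}" for x
      using that by (auto simp: sawtooth_def indicator_def field_simps)
    then show thesis using that[OF Parseval1_sawtooth Parseval1_sawtooth, of a pi "1 / (2 * pi)" "- 1 / (2 * pi)" "(a + pi) / (2 * pi)"] 3 by auto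
  qed
qed

text \<open>
Replace the factors of a product one coordinate at a time by indicators of half-lines. A product is
linear in each factor, so \<open>indicator_atMost_sawtooth\<close> reduces each replacement to the case before.
\<close>

lemma fourier_conv_mixed_prod:
  fixes \<phi> :: "'d::finite \<Rightarrow> real \<Rightarrow> real" and a :: "real^'d"
  assumes "finite J" "\<And>i. i \<notin> J \<Longrightarrow> Parseval1 (\<phi> i)" "\<And>i. i \<in> J \<Longrightarrow> \<phi> i = indicator {..a $ i}"
  shows "fourier_conv (\<lambda>x::real^'d. \<Prod>i\<in>UNIV. complex_of_real (\<phi> i (x $ i)))"
  using assms
proof (induction J arbitrary: \<phi> rule: finite_induct)
  case empty
  then show ?case by (intro fourier_conv_prod) simp
next
  case (insert j J)
  obtain \<alpha> \<beta> \<gamma> s1 s2 where s: "Parseval1 s1" "Parseval1 s2"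
    "\<And>x. x \<in> {-pi..pi} \<Longrightarrow> indicator {..a $ j} x = \<alpha> * s1 x + \<beta> * s2 x + \<gamma>"
    using indicator_atMost_sawtooth[of "a $ j"] by metis
  have IH: "fourier_conv (\<lambda>x::real^'d. \<Prod>i\<in>UNIV. complex_of_real ((\<phi>(j := s)) i (x $ i)))" if "Parseval1 s" for s
    using insert.prems insert.hyps that by (intro insert.IH) auto
  have split: "(\<Prod>i\<in>UNIV. complex_of_real ((\<phi>(j := s)) i (x $ i))) = complex_of_real (s (x $ j)) * (\<Prod>i\<in>UNIV - {j}. complex_of_real (\<phi> i (x $ i)))" for s and x :: "real^'d"
    by (subst prod.remove[of _ j]) auto
  have "fourier_conv (\<lambda>x::real^'d. (complex_of_real \<alpha> * (\<Prod>i\<in>UNIV. complex_of_real ((\<phi>(j := s1)) i (x $ i)))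
      + complex_of_real \<beta> * (\<Prod>i\<in>UNIV. complex_of_real ((\<phi>(j := s2)) i (x $ i))))
      + complex_of_real \<gamma> * (\<Prod>i\<in>UNIV. complex_of_real ((\<phi>(j := (\<lambda>_. 1))) i (x $ i))))"
    by (intro fourier_conv_add fourier_conv_scale IH s Parseval1_one)
  then show ?case
  proof (rule fourier_conv_cong)
    fix x :: "real^'d" assume "x \<in> cube pi"
    then have "complex_of_real (\<phi> j (x $ j)) = complex_of_real \<alpha> * complex_of_real (s1 (x $ j)) + complex_of_real \<beta> * complex_of_real (s2 (x $ j)) + complex_of_real \<gamma>"
      using insert.prems(2)[of j] s(3)[of "x $ j"] by (simp add: mem_cube)
    moreover have "(\<Prod>i\<in>UNIV. complex_of_real (\<phi> i (x $ i))) = complex_of_real (\<phi> j (x $ j)) * (\<Prod>i\<in>UNIV - {j}. complex_of_real (\<phi> i (x $ i)))"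
      by (subst prod.remove[of _ j]) auto
    ultimately show "(complex_of_real \<alpha> * (\<Prod>i\<in>UNIV. complex_of_real ((\<phi>(j := s1)) i (x $ i)))
      + complex_of_real \<beta> * (\<Prod>i\<in>UNIV. complex_of_real ((\<phi>(j := s2)) i (x $ i))))
      + complex_of_real \<gamma> * (\<Prod>i\<in>UNIV. complex_of_real ((\<phi>(j := (\<lambda>_. 1))) i (x $ i))) = (\<Prod>i\<in>UNIV. complex_of_real (\<phi> i (x $ i)))"
      unfolding split by (simp add: algebra_simps)
  qed
qed

lemma fourier_conv_orthant:
  fixes a :: "real^'d::finite"
  shows "fourier_conv (indicator {..a})"
proof -
  have "fourier_conv (\<lambda>x::real^'d. \<Prod>i\<in>UNIV. complex_of_real (indicator {..a $ i} (x $ i)))"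
    using fourier_conv_mixed_prod[of "UNIV :: 'd set" "\<lambda>i. indicator {..a $ i}" a] by simp
  moreover have "(\<Prod>i\<in>UNIV. complex_of_real (indicator {..a $ i} (x $ i))) = indicator {..a} x" for x :: "real^'d"
  proof (cases "x \<le> a")
    case True
    then show ?thesis by (simp add: less_eq_vec_def)
  next
    case False
    then obtain i where "\<not> x $ i \<le> a $ i" by (auto simp: less_eq_vec_def)
    then have "(\<Prod>i\<in>UNIV. complex_of_real (indicator {..a $ i} (x $ i))) = 0" by (intro prod_zero bexI[of _ i]) auto
    with False show ?thesis by simp
  qed
  ultimately show ?thesis by simp
qed

lemma integrable_const_cube: "integrable (lebesgue_on (cube r)) (\<lambda>x. c :: real)"
proof -
  interpret finite_measure "lebesgue_on (cube r :: (real^'a) set)"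
    by (rule finite_measure_lebesgue_on[OF cube_lmeasurable])
  show ?thesis by simp
qed

text \<open>
The orthants \<open>{..a}\<close> are stable under intersection and generate the Borel sets, and the class of sets whose
indicator is approximable is closed under complements and countable disjoint unions.
\<close>

lemma fourier_conv_indicator_borel:
  fixes E :: "(real^'d::finite) set"
  assumes "E \<in> sets borel"
  shows "fourier_conv (indicator E)"
proof -
  have one: "fourier_conv (\<lambda>x::real^'d. 1)"
    using fourier_conv_prod[where 'd = 'd and \<phi> = "\<lambda>_ _. 1"] Parseval1_one by simp
  have zero: "fourier_conv (\<lambda>x::real^'d. 0)"
    using fourier_conv_scale[OF one, of 0] by simp
  have "{..a} \<inter> {..b} = {..inf a b}" for a b :: "real^'d" by auto
  then have "Int_stable (range (atMost :: real^'d \<Rightarrow> _))" by (force simp: Int_stable_def)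
  moreover have "range (atMost :: real^'d \<Rightarrow> _) \<subseteq> Pow UNIV" by simp
  moreover have "E \<in> sigma_sets UNIV (range atMost)"
    using assms by (simp add: borel_eq_atMost)
  ultimately show ?thesis
  proof (induction rule: sigma_sets_induct_disjoint)
    case (basic A)
    then show ?case using fourier_conv_orthant by auto
  next
    case empty
    then show ?case using zero by (simp add: indicator_def)
  next
    case (compl A)
    have "fourier_conv (\<lambda>x. 1 + (- 1) * indicator A x)"
      by (intro fourier_conv_add fourier_conv_scale one compl)
    then show ?case by (rule fourier_conv_cong) (auto simp: indicator_def)
  next
    case (union A)
    have A: "A i \<in> sets borel" for i
      using union(2) by (auto simp: borel_eq_atMost[where 'a = "real^'d"])
    have part: "fourier_conv (indicator (\<Union>i<n. A i))" for n
    proof (induction n)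
      case 0
      then show ?case using zero by (simp add: indicator_def)
    next
      case (Suc n)
      have "fourier_conv (\<lambda>x. indicator (\<Union>i<n. A i) x + indicator (A n) x)"
        by (intro fourier_conv_add Suc union)
      then show ?case
      proof (rule fourier_conv_cong)
        fix x
        have "x \<notin> A i" if "x \<in> A n" "i < n" for i
          using disjoint_family_onD[OF union(1), of i n] that by auto
        then show "indicator (\<Union>i<n. A i) x + indicator (A n) x = (indicator (\<Union>i<Suc n. A i) x :: complex)"
          by (cases "x \<in> A n") (auto simp: indicator_def less_Suc_eq split: if_splits)
      qed
    qed
    show ?case
    proof (rule fourier_conv_dominated_limit[OF _ part])
      have "(indicator (\<Union>i. A i) :: real^'d \<Rightarrow> complex) \<in> borel_measurable borel"
        using A by measurable
      then show "(indicator (\<Union>i. A i) :: real^'d \<Rightarrow> complex) \<in> L2 (cube pi)"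
        by (intro L2_cube_bounded[where B = 1] borel_measurable_lebesgue_on) (auto simp: indicator_def)
      show "(\<lambda>n. indicator (\<Union>i<n. A i) x) \<longlonglongrightarrow> (indicator (\<Union>i. A i) x :: complex)" for x
        by (rule LIMSEQ_indicator_UN)
      show "integrable (lebesgue_on (cube pi :: (real^'d) set)) (\<lambda>_. 1 :: real)" by (rule integrable_const_cube)
    qed (auto simp: indicator_def)
  qed
qed

lemma fourier_conv_indicator:
  fixes E :: "(real^'d::finite) set"
  assumes E: "E \<in> sets lebesgue"
  shows "fourier_conv (indicator E)"
proof (rule fourier_conv_cong_AE[OF fourier_conv_indicator_borel])
  show "main_part lborel E \<in> sets borel" using main_part_sets[OF E] by simp
  show "indicator E \<in> borel_measurable (lebesgue_on (cube pi))"
    using E by (intro measurable_restrict_space1) simp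
  have "AE x in lebesgue. (x \<in> main_part lborel E) = (x \<in> E)"
    by (rule AE_completion[OF AE_in_main_part[OF E]])
  then have "AE x in lebesgue_on (cube pi). (x \<in> main_part lborel E) = (x \<in> E)"
    by (subst AE_restrict_space_iff) auto
  then show "ae_eq_on (cube pi) (indicator (main_part lborel E)) (indicator E)"
    unfolding ae_eq_on_def by eventually_elim (simp add: indicator_def)
qed

lemma fourier_conv_sum:
  fixes u :: "'i \<Rightarrow> real^'d::finite \<Rightarrow> complex"
  assumes "finite I" "\<And>i. i \<in> I \<Longrightarrow> fourier_conv (u i)"
  shows "fourier_conv (\<lambda>x. \<Sum>i\<in>I. c i * u i x)"
  using assms
proof (induction I rule: finite_induct)
  case empty
  show ?case using fourier_conv_scale[OF fourier_conv_indicator[of "{}"], of 0] by simp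
next
  case (insert i I)
  then show ?case using fourier_conv_add[OF fourier_conv_scale[of "u i" "c i"], of "\<lambda>x. \<Sum>i\<in>I. c i * u i x"] by simp
qed

text \<open>
Completeness of the exponentials. Simple functions are combinations of indicators, and every \<open>L\<^sub>2\<close>
function is a dominated limit of simple functions.
\<close>

theorem fourier_sum_converges:
  fixes u :: "real^'d::finite \<Rightarrow> complex"
  assumes u: "u \<in> L2 (cube pi)"
  shows "(\<lambda>l. L2_norm_on (cube pi) (\<lambda>x. u x - fourier_sum l u x)) \<longlonglongrightarrow> 0"
proof -
  let ?M = "lebesgue_on (cube pi :: (real^'d) set)"
  from borel_measurable_implies_sequence_metric[OF L2_measurable[OF u], of 0]
  obtain s where s': "(\<forall>i. simple_function ?M (s i)) \<and> (\<forall>x\<in>space ?M. (\<lambda>i. s i x) \<longlonglongrightarrow> u x) \<and>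
    (\<forall>i. \<forall>x\<in>space ?M. dist (s i x) 0 \<le> 2 * dist (u x) 0)" by blast
  have s: "\<And>i. simple_function ?M (s i)" "\<And>x. x \<in> cube pi \<Longrightarrow> (\<lambda>i. s i x) \<longlonglongrightarrow> u x"
    "\<And>i x. x \<in> cube pi \<Longrightarrow> cmod (s i x) \<le> 2 * cmod (u x)"
    using s' by auto
  have simple: "fourier_conv (s i)" for i
  proof -
    have fin: "finite (s i ` cube pi)" using s(1)[of i] by (simp add: simple_function_def)
    have meas: "s i -` {y} \<inter> cube pi \<in> sets lebesgue" for y
    proof -
      have "s i -` {y} \<inter> space ?M \<in> sets ?M" using s(1)[of i] by (rule simple_functionD)
      then show ?thesis by (simp add: sets_restrict_space_iff)
    qed
    have "fourier_conv (\<lambda>x. \<Sum>y\<in>s i ` cube pi. y * indicator (s i -` {y} \<inter> cube pi) x)"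
      by (intro fourier_conv_sum fin fourier_conv_indicator meas)
    then show ?thesis
    proof (rule fourier_conv_cong)
      fix x :: "real^'d" assume x: "x \<in> cube pi"
      then have "(\<Sum>y\<in>s i ` cube pi. y * indicator (s i -` {y} \<inter> cube pi) x) = (\<Sum>y\<in>s i ` cube pi. if s i x = y then y else 0)"
        by (intro sum.cong refl) (auto simp: indicator_def)
      also have "\<dots> = s i x" using fin x by simp
      finally show "(\<Sum>y\<in>s i ` cube pi. y * indicator (s i -` {y} \<inter> cube pi) x) = s i x" .
    qed
  qed
  have "fourier_conv u"
  proof (rule fourier_conv_dominated_limit[OF u simple s(2)])
    show "integrable ?M (\<lambda>x. 9 * (cmod (u x))\<^sup>2)" using L2_integrable[OF u] by simp
    fix i and x :: "real^'d" assume x: "x \<in> cube pi"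
    have "cmod (u x - s i x) \<le> 3 * cmod (u x)"
      using norm_triangle_ineq4[of "u x" "s i x"] s(3)[OF x, of i] by linarith
    then have "(cmod (u x - s i x))\<^sup>2 \<le> (3 * cmod (u x))\<^sup>2" by (intro power_mono) auto
    then show "(cmod (u x - s i x))\<^sup>2 \<le> 9 * (cmod (u x))\<^sup>2" by (simp add: power_mult_distrib)
  qed
  then show ?thesis by (simp add: fourier_conv_def)
qed

section \<open>The Fourier transform of functions on the cube\<close>

lemma norm_exponential_1: "L2_norm_on (cube pi) (exponential t) = 1" for t :: "real^'d::finite"
proof -
  have "complex_of_real ((L2_norm_on (cube pi) (exponential t))\<^sup>2) = 1"
    unfolding L2_inner_self[symmetric] inner_exponential by (simp add: sincpi_def)
  then have "(L2_norm_on (cube pi) (exponential t))\<^sup>2 = 1" using of_real_eq_1_iff by blast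
  then show ?thesis using L2_norm_nonneg[of "cube pi" "exponential t"] by (simp add: power2_eq_1_iff)
qed

text \<open>
Cauchy--Schwarz; the exponentials have norm \<open>1\<close>.
\<close>

lemma norm_hat_le:
  fixes u :: "real^'d::finite \<Rightarrow> complex"
  assumes "u \<in> L2 (cube pi)" shows "cmod (hat u t) \<le> L2_norm_on (cube pi) u"
  using L2_Cauchy_Schwarz[OF assms L2_exponential, of t] by (simp add: hat_def norm_exponential_1)

lemma hat_diff:
  fixes u v :: "real^'d::finite \<Rightarrow> complex"
  assumes "u \<in> L2 (cube pi)" "v \<in> L2 (cube pi)"
  shows "hat (\<lambda>x. u x - v x) t = hat u t - hat v t"
  using assms by (simp add: hat_def L2_inner_diff_left)

lemma continuous_hat_trig_sum: "continuous_on UNIV (hat (trig_sum l c))" for c :: "int^'d::finite \<Rightarrow> complex"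
proof -
  have "continuous_on UNIV (\<lambda>t::real^'d. sincpi (of_int (n $ i) - t $ i))" for n :: "int^'d" and i
  proof (rule continuous_at_imp_continuous_on, rule ballI)
    fix t :: "real^'d"
    show "isCont (\<lambda>t. sincpi (of_int (n $ i) - t $ i)) t"
      by (rule isCont_o2[OF _ isCont_sincpi]) (intro continuous_intros)
  qed
  then show ?thesis unfolding hat_trig_sum[abs_def] by (intro continuous_intros)
qed

lemma hat_fourier_sum_uniform:
  fixes u :: "real^'d::finite \<Rightarrow> complex"
  assumes u: "u \<in> L2 (cube pi)" and e: "e > 0"
  shows "\<forall>\<^sub>F l in sequentially. \<forall>t. cmod (hat (fourier_sum l u) t - hat u t) < e"
proof -
  have "\<forall>\<^sub>F l in sequentially. L2_norm_on (cube pi) (\<lambda>x. u x - fourier_sum l u x) < e"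
    using fourier_sum_converges[OF u] e by (rule order_tendstoD)
  then show ?thesis
  proof eventually_elim
    case (elim l)
    have "cmod (hat (fourier_sum l u) t - hat u t) \<le> L2_norm_on (cube pi) (\<lambda>x. u x - fourier_sum l u x)" for t
      using norm_hat_le[OF L2_diff[OF u L2_fourier_sum], of l u t] u by (simp add: hat_diff norm_minus_commute)
    with elim show ?case using order_le_less_trans by blast
  qed
qed

text \<open>
\<open>hat u\<close> is the uniform limit of the transforms of the Fourier sums, which are finite sums of sinc products.
\<close>

lemma continuous_hat:
  fixes u :: "real^'d::finite \<Rightarrow> complex"
  assumes u: "u \<in> L2 (cube pi)"
  shows "continuous_on UNIV (hat u)"
proof (rule uniform_limit_theorem)
  show "\<forall>\<^sub>F l in sequentially. continuous_on UNIV (hat (fourier_sum l u))"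
    unfolding fourier_sum_def by (intro always_eventually allI continuous_hat_trig_sum)
  show "uniform_limit UNIV (\<lambda>l. hat (fourier_sum l u)) (hat u) sequentially"
    using hat_fourier_sum_uniform[OF u] by (simp add: uniform_limit_iff dist_norm)
qed simp

lemma hat_trig_sum_vanishes:
  fixes c :: "int^'d::finite \<Rightarrow> complex"
  assumes e: "e > 0"
  shows "\<exists>r. \<forall>t. t \<notin> cube r \<longrightarrow> cmod (hat (trig_sum l c) t) < e"
proof -
  define C where "C = (\<Sum>n\<in>index_cube l. cmod (c n))"
  have C: "C \<ge> 0" by (simp add: C_def sum_nonneg)
  \<comment> \<open>chosen so that \<open>C / D < e\<close>; adding \<open>1\<close> keeps it positive\<close>
  define D where "D = (C + 1) / e"
  have D: "D > 0" using C e by (simp add: D_def)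
  have "cmod (hat (trig_sum l c) t) < e" if t: "t \<notin> cube (real l + D)" for t
  proof -
    obtain i where "\<not> (- (real l + D) \<le> t $ i \<and> t $ i \<le> real l + D)" using t by (auto simp: mem_cube)
    then have i: "\<bar>t $ i\<bar> > real l + D" by linarith
    have "cmod (c n * of_real (\<Prod>i\<in>UNIV. sincpi (of_int (n $ i) - t $ i))) \<le> cmod (c n) * (1 / D)" if n: "n \<in> index_cube l" for n
    proof -
      have "- int l \<le> n $ i" "n $ i \<le> int l" using n by (auto simp: index_cube_def)
      then have "\<bar>n $ i\<bar> \<le> int l" by linarith
      then have "real_of_int \<bar>n $ i\<bar> \<le> real_of_int (int l)" by (simp only: of_int_le_iff)
      then have gt: "\<bar>of_int (n $ i) - t $ i\<bar> > D" using i by simp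
      have "\<bar>\<Prod>j\<in>UNIV. sincpi (of_int (n $ j) - t $ j)\<bar> = \<bar>sincpi (of_int (n $ i) - t $ i)\<bar> * (\<Prod>j\<in>UNIV - {i}. \<bar>sincpi (of_int (n $ j) - t $ j)\<bar>)"
        unfolding abs_prod by (rule prod.remove) auto
      also have "\<dots> \<le> \<bar>sincpi (of_int (n $ i) - t $ i)\<bar> * 1"
        by (intro mult_left_mono prod_le_1) (auto simp: abs_sincpi_le_1)
      also have "\<dots> \<le> 1 / \<bar>of_int (n $ i) - t $ i\<bar>" using abs_sincpi_le[of "of_int (n $ i) - t $ i"] gt D by auto
      also have "\<dots> \<le> 1 / D" using gt D by (intro divide_left_mono) auto
      finally show ?thesis unfolding norm_mult norm_of_real by (intro mult_left_mono) auto
    qed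
    then have "cmod (hat (trig_sum l c) t) \<le> (\<Sum>n\<in>index_cube l. cmod (c n) * (1 / D))"
      unfolding hat_trig_sum by (rule sum_norm_le)
    also have "\<dots> = C / D" by (simp add: C_def sum_divide_distrib)
    also have "\<dots> < e" using C e by (simp add: D_def divide_simps)
    finally show ?thesis .
  qed
  then show ?thesis by blast
qed

text \<open>
A form of the Riemann--Lebesgue lemma: by uniform approximation it suffices to consider trigonometric
polynomials, for which the decay of the sinc function applies.
\<close>

lemma hat_vanishes:
  fixes u :: "real^'d::finite \<Rightarrow> complex"
  assumes u: "u \<in> L2 (cube pi)" and e: "e > 0"
  shows "\<exists>r. \<forall>t. t \<notin> cube r \<longrightarrow> cmod (hat u t) < e"
proof -
  obtain l where l: "\<And>t. cmod (hat (fourier_sum l u) t - hat u t) < e / 2"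
    using eventually_happens[OF hat_fourier_sum_uniform[OF u, of "e / 2"]] e by auto
  obtain r where r: "\<And>t. t \<notin> cube r \<Longrightarrow> cmod (hat (fourier_sum l u) t) < e / 2"
    using hat_trig_sum_vanishes[of "e / 2" l "\<lambda>n. hat u (ivec n)"] e by (auto simp: fourier_sum_def)
  have "cmod (hat u t) < e" if "t \<notin> cube r" for t
    using l[of t] r[OF that] norm_triangle_ineq4[of "hat (fourier_sum l u) t" "hat (fourier_sum l u) t - hat u t"] by simp
  then show ?thesis by blast
qed

lemma nn_integral_lborel_shift:
  fixes a :: "'a::euclidean_space"
  assumes [measurable]: "f \<in> borel_measurable borel"
  shows "(\<integral>\<^sup>+x. f (a + x) \<partial>lborel) = (\<integral>\<^sup>+x. f x \<partial>lborel)"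
proof -
  have "(\<integral>\<^sup>+x. f x \<partial>lborel) = (\<integral>\<^sup>+x. f x \<partial>distr lborel borel ((+) a))" by (simp add: lborel_distr_plus)
  also have "\<dots> = (\<integral>\<^sup>+x. f (a + x) \<partial>lborel)" by (subst nn_integral_distr) auto
  finally show ?thesis ..
qed

text \<open>
One half of Plancherel's theorem, by periodisation: cut \<open>\<real>\<^sup>d\<close> into the translates \<open>n + Q\<close> of the unit cube
\<open>Q\<close>, so that the integral of \<open>|hat u|\<^sup>2\<close> is the integral over \<open>s\<close> in \<open>Q\<close> of \<open>\<Sum>\<^sub>n |hat u (s + n)|\<^sup>2\<close>, and
Bessel's inequality bounds this sum for every \<open>s\<close>.
\<close>

lemma norm_hat_cube_le:
  fixes u :: "real^'d::finite \<Rightarrow> complex"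
  assumes u: "u \<in> L2 (cube pi)"
  shows "L2_norm_on (cube r) (hat u) \<le> L2_norm_on (cube pi) u"
proof -
  define N where "N = nat \<lceil>\<bar>r\<bar>\<rceil>"
  define Q :: "(real^'d) set" where "Q = cbox 0 1"
  define G where "G t = ennreal ((cmod (hat u t))\<^sup>2)" for t
  have [measurable]: "hat u \<in> borel_measurable borel"
    by (intro borel_measurable_continuous_onI continuous_hat u)
  have [measurable]: "G \<in> borel_measurable borel" unfolding G_def[abs_def] by measurable
  have [measurable]: "Q \<in> sets borel" by (simp add: Q_def)
  have cover: "indicator (cube r) t \<le> (\<Sum>n\<in>index_cube N. indicator Q (- ivec n + t) :: ennreal)" for t :: "real^'d"
  proof (cases "t \<in> cube r")
    case True
    \<comment> \<open>the translate of \<open>Q\<close> that contains \<open>t\<close>\<close>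
    define n :: "int^'d" where "n = (\<chi> i. \<lfloor>t $ i\<rfloor>)"
    have n: "n \<in> index_cube N" unfolding index_cube_def
    proof (intro CollectI allI)
      fix i
      have "- r \<le> t $ i" "t $ i \<le> r" using True by (auto simp: mem_cube)
      then have "\<bar>t $ i\<bar> \<le> \<bar>r\<bar>" by linarith
      moreover have "\<bar>r\<bar> \<le> of_int (int N)" unfolding N_def of_int_of_nat_eq by (rule real_nat_ceiling_ge)
      ultimately have "- real_of_int (int N) \<le> t $ i" "t $ i \<le> real_of_int (int N)" by auto
      then show "- int N \<le> n $ i \<and> n $ i \<le> int N"
        unfolding n_def by (simp add: le_floor_iff floor_le_iff)
    qed
    have "- ivec n + t \<in> Q" unfolding Q_def mem_box_cart
    proof (intro allI)
      fix i
      have "0 \<le> t $ i - real_of_int \<lfloor>t $ i\<rfloor>" "t $ i - real_of_int \<lfloor>t $ i\<rfloor> \<le> 1" by linarith+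
      then show "(0::real^'d) $ i \<le> (- ivec n + t) $ i \<and> (- ivec n + t) $ i \<le> (1::real^'d) $ i"
        by (simp add: n_def)
    qed
    then have "1 \<le> (\<Sum>n\<in>{n}. indicator Q (- ivec n + t) :: ennreal)" by simp
    also have "\<dots> \<le> (\<Sum>n\<in>index_cube N. indicator Q (- ivec n + t))"
      using n by (intro sum_mono2) auto
    finally show ?thesis using True by simp
  qed simp
  have "(\<integral>\<^sup>+t. indicator (cube r) t * G t \<partial>lborel) \<le> (\<integral>\<^sup>+t. (\<Sum>n\<in>index_cube N. indicator Q (- ivec n + t)) * G t \<partial>lborel)"
    by (intro nn_integral_mono mult_right_mono cover) auto
  also have "\<dots> = (\<Sum>n\<in>index_cube N. \<integral>\<^sup>+t. indicator Q (- ivec n + t) * G t \<partial>lborel)"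
    unfolding sum_distrib_right by (intro nn_integral_sum) measurable
  also have "\<dots> = (\<Sum>n\<in>index_cube N. \<integral>\<^sup>+s. indicator Q s * G (ivec n + s) \<partial>lborel)"
  proof (intro sum.cong refl)
    fix n :: "int^'d"
    have "(\<integral>\<^sup>+t. indicator Q (- ivec n + t) * G t \<partial>lborel) = (\<integral>\<^sup>+s. indicator Q (- ivec n + (ivec n + s)) * G (ivec n + s) \<partial>lborel)"
      by (rule nn_integral_lborel_shift[symmetric]) measurable
    then show "(\<integral>\<^sup>+t. indicator Q (- ivec n + t) * G t \<partial>lborel) = (\<integral>\<^sup>+s. indicator Q s * G (ivec n + s) \<partial>lborel)"
      by simp
  qed
  also have "\<dots> = (\<integral>\<^sup>+s. indicator Q s * (\<Sum>n\<in>index_cube N. G (ivec n + s)) \<partial>lborel)"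
    unfolding sum_distrib_left by (intro nn_integral_sum[symmetric]) measurable
  also have "\<dots> \<le> (\<integral>\<^sup>+s. indicator Q s * ennreal ((L2_norm_on (cube pi) u)\<^sup>2) \<partial>lborel)"
  proof (intro nn_integral_mono mult_left_mono)
    fix s
    show "(\<Sum>n\<in>index_cube N. G (ivec n + s)) \<le> ennreal ((L2_norm_on (cube pi) u)\<^sup>2)"
      unfolding G_def using Bessel_shift[OF u finite_index_cube, of s N]
      by (subst sum_ennreal) (auto intro!: ennreal_leI simp: add.commute)
  qed simp
  also have "\<dots> = ennreal ((L2_norm_on (cube pi) u)\<^sup>2)"
  proof -
    have "emeasure lborel Q = 1"
    proof -
      have "(\<Prod>b\<in>Basis. (1 - 0 :: real^'d) \<bullet> b) = 1"
        by (rule prod.neutral) (auto simp: Basis_vec_def inner_axis)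
      moreover have "(0 :: real^'d) \<bullet> b \<le> 1 \<bullet> b" if "b \<in> Basis" for b
        using that by (auto simp: Basis_vec_def inner_axis)
      ultimately show ?thesis unfolding Q_def by (subst emeasure_lborel_cbox) auto
    qed
    then show ?thesis
      using nn_integral_cmult_indicator[of Q lborel "ennreal ((L2_norm_on (cube pi) u)\<^sup>2)"]
      by (simp only: mult.commute[of "indicator _ _"] sets_lborel \<open>Q \<in> sets borel\<close> simp_thms) simp
  qed
  finally have le: "(\<integral>\<^sup>+t. indicator (cube r) t * G t \<partial>lborel) \<le> ennreal ((L2_norm_on (cube pi) u)\<^sup>2)" .
  have "(L2_norm_on (cube r) (hat u))\<^sup>2 = (\<integral>t. indicator (cube r) t *\<^sub>R (cmod (hat u t))\<^sup>2 \<partial>lborel)"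
    by (simp add: L2_norm_square integral_restrict_space integral_completion)
  also have "\<dots> = enn2real (\<integral>\<^sup>+t. ennreal (indicator (cube r) t *\<^sub>R (cmod (hat u t))\<^sup>2) \<partial>lborel)"
    by (rule integral_eq_nn_integral) auto
  also have "(\<integral>\<^sup>+t. ennreal (indicator (cube r) t *\<^sub>R (cmod (hat u t))\<^sup>2) \<partial>lborel) = (\<integral>\<^sup>+t. indicator (cube r) t * G t \<partial>lborel)"
    by (intro nn_integral_cong) (simp add: G_def indicator_def)
  also have "enn2real \<dots> \<le> (L2_norm_on (cube pi) u)\<^sup>2"
    using enn2real_mono[OF le] by simp
  finally show ?thesis by (rule power2_le_imp_le) simp
qed

section \<open>Fourier inversion for Paley--Wiener functions\<close>

lemma L2_UNIV: "L2 UNIV = {f. f \<in> borel_measurable lebesgue \<and> integrable lebesgue (\<lambda>x. (norm (f x))\<^sup>2)}"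
  by (simp add: L2_def lebesgue_on_UNIV_eq)

lemma integrable_lborel_lebesgue:
  fixes f :: "'a::euclidean_space \<Rightarrow> complex"
  assumes "integrable lborel f"
  shows "integrable lebesgue f" "integral\<^sup>L lebesgue f = integral\<^sup>L lborel f"
  using has_bochner_integral_lebesgue[of f "integral\<^sup>L lborel f"] assms
  by (auto simp: has_bochner_integral_iff)

text \<open>
Fubini's theorem concerns the product of Borel measures, whereas the functions of the statement are only
Lebesgue measurable.
\<close>

lemma lebesgue_integrable_borel_version:
  fixes f :: "'a::euclidean_space \<Rightarrow> complex"
  assumes f: "integrable lebesgue f"
  obtains f' where "integrable lborel f'" "AE x in lebesgue. f x = f' x"
proof -
  have m: "(\<lambda>x. Re (f x)) \<in> borel_measurable lebesgue" "(\<lambda>x. Im (f x)) \<in> borel_measurable lebesgue"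
    using f by auto
  obtain r i where r: "r \<in> borel_measurable lborel" "AE x in lborel. Re (f x) = r x"
    and i: "i \<in> borel_measurable lborel" "AE x in lborel. Im (f x) = i x"
    using completion_ex_borel_measurable_real[OF m(1)] completion_ex_borel_measurable_real[OF m(2)] by blast
  define f' where "f' x = Complex (r x) (i x)" for x
  have f'_alt: "f' x = complex_of_real (r x) + \<i> * complex_of_real (i x)" for x
    by (simp add: f'_def Complex_eq)
  have f'm: "f' \<in> borel_measurable lborel" unfolding f'_alt[abs_def] using r(1) i(1) by measurable
  have "AE x in lborel. f x = f' x"
    using r(2) i(2) by eventually_elim (simp add: f'_def complex_eq_iff)
  then have ae: "AE x in lebesgue. f x = f' x" by (rule AE_completion)
  then have "integrable lebesgue f'"
    using f f'm by (subst integrable_cong_AE[of f' lebesgue f]) (auto simp: measurable_completion elim!: eventually_mono)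
  then have "integrable lborel f'" using f'm by (simp add: integrable_completion)
  then show ?thesis using ae by (rule that)
qed

lemma multiplication_formula_borel:
  fixes a b :: "real^'d::finite \<Rightarrow> complex" and k :: "real^'d \<Rightarrow> real^'d \<Rightarrow> complex"
  assumes a: "integrable lborel a" and b: "integrable lborel b"
    and k: "case_prod k \<in> borel_measurable (borel \<Otimes>\<^sub>M borel)" "\<And>x y. cmod (k x y) \<le> C"
  shows "(\<integral>y. (\<integral>x. a x * k x y \<partial>lborel) * b y \<partial>lborel) = (\<integral>x. a x * (\<integral>y. k x y * b y \<partial>lborel) \<partial>lborel)"
proof -
  have [measurable]: "a \<in> borel_measurable borel" "b \<in> borel_measurable borel" using a b by auto
  note [measurable] = k(1)
  have kx [measurable]: "(\<lambda>y. k x y) \<in> borel_measurable borel" for x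
    using measurable_compose[OF measurable_Pair1' k(1), of x] by simp
  have m: "(\<lambda>(x, y). a x * k x y * b y) \<in> borel_measurable (lborel \<Otimes>\<^sub>M lborel)" by measurable
  have bd: "integrable lborel (\<lambda>y. a x * k x y * b y)" for x
  proof (rule Bochner_Integration.integrable_bound[where f = "\<lambda>y. cmod (a x) * C * cmod (b y)"])
    show "integrable lborel (\<lambda>y. cmod (a x) * C * cmod (b y))" using b by simp
    have "cmod (a x * k x y * b y) \<le> norm (cmod (a x) * C * cmod (b y))" for y
    proof -
      have "cmod (a x * k x y * b y) \<le> cmod (a x) * C * cmod (b y)"
        unfolding norm_mult by (intro mult_right_mono mult_left_mono k(2)) auto
      then show ?thesis by simp
    qed
    then show "AE y in lborel. cmod (a x * k x y * b y) \<le> norm (cmod (a x) * C * cmod (b y))" by simp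
  qed measurable
  have "integrable (lborel \<Otimes>\<^sub>M lborel) (\<lambda>(x, y). a x * k x y * b y)"
  proof (rule lborel_pair.Fubini_integrable[OF m])
    show "integrable lborel (\<lambda>x. \<integral>y. cmod (case (x, y) of (x, y) \<Rightarrow> a x * k x y * b y) \<partial>lborel)"
    proof (rule Bochner_Integration.integrable_bound[where f = "\<lambda>x. cmod (a x) * C * (\<integral>y. cmod (b y) \<partial>lborel)"])
      show "integrable lborel (\<lambda>x. cmod (a x) * C * (\<integral>y. cmod (b y) \<partial>lborel))" using a by simp
      have "norm (\<integral>y. cmod (a x * k x y * b y) \<partial>lborel) \<le> norm (cmod (a x) * C * (\<integral>y. cmod (b y) \<partial>lborel))" for x
      proof -
        have "(\<integral>y. cmod (a x * k x y * b y) \<partial>lborel) \<le> (\<integral>y. cmod (a x) * C * cmod (b y) \<partial>lborel)"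
          unfolding norm_mult using b integrable_norm[OF bd[of x]]
          by (intro integral_mono mult_right_mono mult_left_mono k(2)) (auto simp: norm_mult)
        moreover have "0 \<le> (\<integral>y. cmod (a x * k x y * b y) \<partial>lborel)" by simp
        ultimately show ?thesis by simp
      qed
      then show "AE x in lborel. norm (\<integral>y. cmod (case (x, y) of (x, y) \<Rightarrow> a x * k x y * b y) \<partial>lborel) \<le> norm (cmod (a x) * C * (\<integral>y. cmod (b y) \<partial>lborel))"
        by simp
    qed measurable
    show "AE x in lborel. integrable lborel (\<lambda>y. case (x, y) of (x, y) \<Rightarrow> a x * k x y * b y)"
      using bd by simp
  qed
  from lborel_pair.Fubini_integral[OF this]
  have "(\<integral>y. (\<integral>x. a x * k x y * b y \<partial>lborel) \<partial>lborel) = (\<integral>x. (\<integral>y. a x * k x y * b y \<partial>lborel) \<partial>lborel)" .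
  moreover have "(\<integral>x. a x * k x y * b y \<partial>lborel) = (\<integral>x. a x * k x y \<partial>lborel) * b y" for y
    by (rule integral_mult_left_zero)
  moreover have "(\<integral>y. a x * k x y * b y \<partial>lborel) = a x * (\<integral>y. k x y * b y \<partial>lborel)" for x
    unfolding mult.assoc by (rule integral_mult_right_zero)
  ultimately show ?thesis by simp
qed

text \<open>
Fubini's theorem for an integral transform with a bounded kernel. It is applied with the Fourier kernel and
with its conjugate.
\<close>

lemma multiplication_formula:
  fixes a b :: "real^'d::finite \<Rightarrow> complex" and k :: "real^'d \<Rightarrow> real^'d \<Rightarrow> complex"
  assumes a: "integrable lebesgue a" and b: "integrable lborel b"
    and k: "case_prod k \<in> borel_measurable (borel \<Otimes>\<^sub>M borel)" "\<And>x y. cmod (k x y) \<le> C"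
  shows "(\<integral>y. (\<integral>x. a x * k x y \<partial>lebesgue) * b y \<partial>lebesgue) = (\<integral>x. a x * (\<integral>y. k x y * b y \<partial>lborel) \<partial>lebesgue)"
proof -
  obtain a' where a': "integrable lborel a'" and ae: "AE x in lebesgue. a x = a' x"
    using lebesgue_integrable_borel_version[OF a] by blast
  note [measurable] = k(1)
  have [measurable]: "a' \<in> borel_measurable borel" "b \<in> borel_measurable borel" using a' b by auto
  have ky [measurable]: "(\<lambda>x. k x y) \<in> borel_measurable borel" for y
    using measurable_compose[OF measurable_Pair2' k(1), of y] by simp
  have kx [measurable]: "(\<lambda>y. k x y) \<in> borel_measurable borel" for x
    using measurable_compose[OF measurable_Pair1' k(1), of x] by simp
  have am: "a \<in> borel_measurable lebesgue" "a' \<in> borel_measurable lebesgue"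
    using a by (auto intro: measurable_completion)
  have 1: "(\<integral>x. a x * k x y \<partial>lebesgue) = (\<integral>x. a' x * k x y \<partial>lborel)" for y
  proof -
    have "(\<integral>x. a x * k x y \<partial>lebesgue) = (\<integral>x. a' x * k x y \<partial>lebesgue)"
    proof (rule integral_cong_AE)
      have "(\<lambda>x. k x y) \<in> borel_measurable lebesgue" by (rule measurable_completion) simp
      then show "(\<lambda>x. a x * k x y) \<in> borel_measurable lebesgue" "(\<lambda>x. a' x * k x y) \<in> borel_measurable lebesgue"
        using am by measurable
      show "AE x in lebesgue. a x * k x y = a' x * k x y" using ae by eventually_elim simp
    qed
    also have "\<dots> = (\<integral>x. a' x * k x y \<partial>lborel)" by (rule integral_completion) measurable
    finally show ?thesis .
  qed
  have 2: "(\<integral>x. a x * (\<integral>y. k x y * b y \<partial>lborel) \<partial>lebesgue) = (\<integral>x. a' x * (\<integral>y. k x y * b y \<partial>lborel) \<partial>lborel)"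
  proof -
    have m: "(\<lambda>x. \<integral>y. k x y * b y \<partial>lborel) \<in> borel_measurable borel" by measurable
    have "(\<integral>x. a x * (\<integral>y. k x y * b y \<partial>lborel) \<partial>lebesgue) = (\<integral>x. a' x * (\<integral>y. k x y * b y \<partial>lborel) \<partial>lebesgue)"
    proof (rule integral_cong_AE)
      have "(\<lambda>x. \<integral>y. k x y * b y \<partial>lborel) \<in> borel_measurable lebesgue" by (rule measurable_completion) (use m in simp)
      then show "(\<lambda>x. a x * (\<integral>y. k x y * b y \<partial>lborel)) \<in> borel_measurable lebesgue" "(\<lambda>x. a' x * (\<integral>y. k x y * b y \<partial>lborel)) \<in> borel_measurable lebesgue"
        using am by measurable
      show "AE x in lebesgue. a x * (\<integral>y. k x y * b y \<partial>lborel) = a' x * (\<integral>y. k x y * b y \<partial>lborel)" using ae by eventually_elim simp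
    qed
    also have "\<dots> = (\<integral>x. a' x * (\<integral>y. k x y * b y \<partial>lborel) \<partial>lborel)" by (rule integral_completion) (use m in measurable)
    finally show ?thesis .
  qed
  have "(\<integral>y. (\<integral>x. a' x * k x y \<partial>lborel) * b y \<partial>lebesgue) = (\<integral>y. (\<integral>x. a' x * k x y \<partial>lborel) * b y \<partial>lborel)"
    by (rule integral_completion) measurable
  then show ?thesis unfolding 1 2 using multiplication_formula_borel[OF a' b k] by simp
qed

text \<open>
The characteristic function of the standard normal distribution, after an affine substitution.
\<close>

lemma gauss_transform:
  assumes s: "s > 0"
  shows "(\<integral>x. exp (\<i> * complex_of_real (t * x)) * complex_of_real (normal_density m s x) \<partial>lborel)
    = exp (\<i> * complex_of_real (t * m)) * complex_of_real (exp (- (s * t)\<^sup>2 / 2))"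
proof -
  have "(\<integral>x. exp (\<i> * complex_of_real (t * x)) * complex_of_real (normal_density m s x) \<partial>lborel)
     = \<bar>s\<bar> *\<^sub>R (\<integral>x. exp (\<i> * complex_of_real (t * (m + s * x))) * complex_of_real (normal_density m s (m + s * x)) \<partial>lborel)"
    using s by (intro lborel_integral_real_affine) simp
  also have "\<dots> = (\<integral>x. exp (\<i> * complex_of_real (t * m)) * (std_normal_density x *\<^sub>R iexp ((s * t) * x)) \<partial>lborel)"
  proof -
    have "s * normal_density m s (m + s * x) = std_normal_density x" for x
      using s by (simp add: normal_density_def real_sqrt_mult power_mult_distrib field_simps)
    then have nd: "complex_of_real s * complex_of_real (normal_density m s (m + s * x)) = complex_of_real (std_normal_density x)" for x
      by (simp only: of_real_mult[symmetric])
    have E: "exp (\<i> * complex_of_real (t * (m + s * x))) = exp (\<i> * complex_of_real (t * m)) * iexp ((s * t) * x)" for x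
      unfolding exp_add[symmetric] by (simp add: algebra_simps)
    have "s *\<^sub>R (exp (\<i> * complex_of_real (t * (m + s * x))) * complex_of_real (normal_density m s (m + s * x)))
       = exp (\<i> * complex_of_real (t * m)) * (std_normal_density x *\<^sub>R iexp ((s * t) * x))" for x
      unfolding scaleR_conv_of_real nd[symmetric] E by (simp only: mult_ac)
    then show ?thesis using s by (subst integral_scaleR_right[symmetric]) simp
  qed
  also have "\<dots> = exp (\<i> * complex_of_real (t * m)) * (\<integral>x. std_normal_density x *\<^sub>R iexp ((s * t) * x) \<partial>lborel)"
    by (rule integral_mult_right_zero)
  also have "(\<integral>x. std_normal_density x *\<^sub>R iexp ((s * t) * x) \<partial>lborel) = char std_normal_distribution (s * t)"
    unfolding char_def by (rule integral_density[symmetric]) auto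
  also have "char std_normal_distribution (s * t) = complex_of_real (exp (- (s * t)\<^sup>2 / 2))"
    by (simp add: char_std_normal_distribution)
  finally show ?thesis .
qed

definition gauss :: "real^'d \<Rightarrow> real \<Rightarrow> real^'d \<Rightarrow> complex" where
  "gauss m s t = (\<Prod>i\<in>UNIV. complex_of_real (normal_density (m $ i) s (t $ i)))"

text \<open>
The conjugate Fourier transform of \<open>gauss m s\<close>; the inverse transform leads back
(\<open>gauss_transform_vec\<close>, \<open>gauss_dual_transform_vec\<close>).
\<close>

definition gauss_dual :: "real^'d \<Rightarrow> real \<Rightarrow> real^'d \<Rightarrow> complex" where
  "gauss_dual m s x = (\<Prod>i\<in>UNIV. cnj (exp1 (m $ i) (x $ i)) * complex_of_real (exp (- (s * x $ i)\<^sup>2 / 2)))"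

lemma exp1_measurable [measurable]: "exp1 s \<in> borel_measurable borel"
  by (intro borel_measurable_continuous_onI continuous_intros)

lemma exp1_commute: "exp1 s x = exp1 x s"
  by (simp add: exp1_def mult.commute)

lemma gauss_transform_exp1:
  assumes s: "s > 0"
  shows "(\<integral>t. cnj (exp1 t x) * complex_of_real (normal_density m s t) \<partial>lborel) = cnj (exp1 m x) * complex_of_real (exp (- (s * x)\<^sup>2 / 2))"
proof -
  define c where "c = complex_of_real (1 / sqrt (2 * pi))"
  have 1: "cnj (exp1 t x) = c * exp (\<i> * complex_of_real ((- x) * t))" for t
    by (simp add: exp1_def c_def exp_cnj mult.commute)
  have "(\<integral>t. c * (exp (\<i> * complex_of_real ((- x) * t)) * complex_of_real (normal_density m s t)) \<partial>lborel)
    = c * (exp (\<i> * complex_of_real ((- x) * m)) * complex_of_real (exp (- (s * (- x))\<^sup>2 / 2)))"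
    by (subst integral_mult_right_zero) (simp only: gauss_transform[OF s])
  then show ?thesis unfolding 1 mult.assoc by simp
qed

lemma exp_normal_density:
  assumes "s > 0"
  shows "exp (- (s * x)\<^sup>2 / 2) = sqrt (2 * pi) / s * normal_density 0 (1 / s) x"
  using assms by (simp add: normal_density_def real_sqrt_divide power_mult_distrib power_divide real_sqrt_mult field_simps)

lemma gauss_dual_transform_exp1:
  assumes s: "s > 0"
  shows "(\<integral>x. exp1 t x * (cnj (exp1 m x) * complex_of_real (exp (- (s * x)\<^sup>2 / 2))) \<partial>lborel) = complex_of_real (normal_density m s t)"
proof -
  define c where "c = complex_of_real (1 / sqrt (2 * pi))"
  define K where "K = c * c * complex_of_real (sqrt (2 * pi) / s)"
  have 1: "exp1 t x * (cnj (exp1 m x) * complex_of_real (exp (- (s * x)\<^sup>2 / 2)))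
    = K * (exp (\<i> * complex_of_real ((t - m) * x)) * complex_of_real (normal_density 0 (1 / s) x))" for x
  proof -
    have "cnj (exp1 m x) = c * exp (- (\<i> * complex_of_real (m * x)))"
      by (simp add: exp1_def c_def exp_cnj)
    moreover have "exp1 t x = c * exp (\<i> * complex_of_real (t * x))" by (simp only: exp1_def c_def)
    moreover have "exp (\<i> * complex_of_real ((t - m) * x)) = exp (\<i> * complex_of_real (t * x)) * exp (- (\<i> * complex_of_real (m * x)))"
      unfolding exp_add[symmetric] by (simp add: algebra_simps)
    ultimately show ?thesis
      unfolding exp_normal_density[OF s] K_def of_real_mult[of _ "normal_density 0 (1 / s) x"] by (simp only: mult_ac)
  qed
  have "(\<integral>x. exp1 t x * (cnj (exp1 m x) * complex_of_real (exp (- (s * x)\<^sup>2 / 2))) \<partial>lborel)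
    = K * (exp (\<i> * complex_of_real ((t - m) * 0)) * complex_of_real (exp (- (1 / s * (t - m))\<^sup>2 / 2)))"
    unfolding 1 using s by (subst integral_mult_right_zero, subst gauss_transform) auto
  also have "\<dots> = complex_of_real (1 / sqrt (2 * pi) * (1 / sqrt (2 * pi)) * (sqrt (2 * pi) / s) * exp (- (1 / s * (t - m))\<^sup>2 / 2))"
    by (simp only: K_def c_def of_real_mult mult_zero_right of_real_0 exp_zero mult_1_left mult.assoc)
  also have "1 / sqrt (2 * pi) * (1 / sqrt (2 * pi)) * (sqrt (2 * pi) / s) * exp (- (1 / s * (t - m))\<^sup>2 / 2) = normal_density m s t"
  proof -
    have "1 / sqrt (2 * pi) * (1 / sqrt (2 * pi)) * (sqrt (2 * pi) / s) = 1 / sqrt (2 * pi * s\<^sup>2)"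
      using s by (simp add: real_sqrt_mult)
    moreover have "- (1 / s * (t - m))\<^sup>2 / 2 = - (t - m)\<^sup>2 / (2 * s\<^sup>2)"
      by (simp add: power_divide)
    ultimately show ?thesis by (simp only: normal_density_def)
  qed
  finally show ?thesis .
qed

lemma integrable_exp1_normal:
  assumes "s > 0"
  shows "integrable lborel (\<lambda>t. cnj (exp1 t x) * complex_of_real (normal_density m s t))"
proof (rule Bochner_Integration.integrable_bound[where f = "\<lambda>t. 1 / sqrt (2 * pi) * normal_density m s t"])
  show "integrable lborel (\<lambda>t. 1 / sqrt (2 * pi) * normal_density m s t)"
    using integrable_normal_density[OF assms] by simp
  have "(\<lambda>t. exp1 t x) \<in> borel_measurable borel" unfolding exp1_commute[of _ x] by measurable
  then show "(\<lambda>t. cnj (exp1 t x) * complex_of_real (normal_density m s t)) \<in> borel_measurable lborel" by measurable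
qed (auto simp: norm_mult norm_exp1 normal_density_nonneg)

lemma integrable_exp1_gauss_dual:
  assumes s: "s > 0"
  shows "integrable lborel (\<lambda>x. cnj (exp1 m x) * complex_of_real (exp (- (s * x)\<^sup>2 / 2)))"
  unfolding exp_normal_density[OF s]
proof (rule Bochner_Integration.integrable_bound[where f = "\<lambda>x. normal_density 0 (1 / s) x / s"])
  show "integrable lborel (\<lambda>x. normal_density 0 (1 / s) x / s)"
    using integrable_normal_density[of "1 / s" 0] s by simp
  show "AE x in lborel. cmod (cnj (exp1 m x) * complex_of_real (sqrt (2 * pi) / s * normal_density 0 (1 / s) x)) \<le> norm (normal_density 0 (1 / s) x / s)"
    using s by (simp add: norm_mult norm_exp1 norm_divide normal_density_nonneg abs_mult)
qed measurable

lemma integrable_gauss: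
  assumes "s > 0"
  shows "integrable lborel (gauss m s :: real^'d::finite \<Rightarrow> complex)" "(\<integral>t. gauss m s t \<partial>lborel) = (1 :: complex)"
proof -
  have "integrable lborel (\<lambda>x. complex_of_real (normal_density (m $ i) s x))" for i
    using integrable_normal_density[OF assms] by simp
  from lborel_vec_prod[of "\<lambda>i x. complex_of_real (normal_density (m $ i) s x)", OF this]
  show "integrable lborel (gauss m s :: real^'d::finite \<Rightarrow> complex)" "(\<integral>t. gauss m s t \<partial>lborel) = (1 :: complex)"
    using integral_normal_density[OF assms] by (simp_all add: gauss_def[abs_def] has_bochner_integral_iff)
qed

lemma integrable_gauss_dual:
  assumes "s > 0"
  shows "integrable lborel (gauss_dual m s :: real^'d::finite \<Rightarrow> complex)"
  using lborel_vec_prod[OF integrable_exp1_gauss_dual[OF assms], of "\<lambda>i. m $ i"]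
  by (simp add: gauss_dual_def[abs_def] has_bochner_integral_iff)

lemma gauss_transform_vec:
  fixes m x :: "real^'d::finite"
  assumes "s > 0"
  shows "(\<integral>t. cnj (exponential t x) * gauss m s t \<partial>lborel) = gauss_dual m s x"
  using lborel_vec_prod[OF integrable_exp1_normal[OF assms], of "\<lambda>i. x $ i" "\<lambda>i. m $ i"]
  by (simp add: gauss_dual_def gauss_def exponential_eq_prod prod.distrib has_bochner_integral_iff gauss_transform_exp1[OF assms])

lemma gauss_dual_transform_vec:
  fixes m t :: "real^'d::finite"
  assumes "s > 0"
  shows "(\<integral>x. exponential t x * gauss_dual m s x \<partial>lborel) = gauss m s t"
proof -
  have "integrable lborel (\<lambda>x. exp1 (t $ i) x * (cnj (exp1 (m $ i) x) * complex_of_real (exp (- (s * x)\<^sup>2 / 2))))" for i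
    by (rule Bochner_Integration.integrable_bound[OF integrable_mult_right[OF integrable_exp1_gauss_dual[OF assms, of "m $ i"], of "complex_of_real (1 / sqrt (2 * pi))"]])
       (auto simp: norm_mult norm_exp1 norm_divide)
  from lborel_vec_prod[of "\<lambda>i x. exp1 (t $ i) x * (cnj (exp1 (m $ i) x) * complex_of_real (exp (- (s * x)\<^sup>2 / 2)))", OF this]
  show ?thesis
    by (simp add: gauss_dual_def gauss_def exponential_eq_prod prod.distrib has_bochner_integral_iff gauss_dual_transform_exp1[OF assms, simplified] mult.assoc)
qed

lemma exponential_pair_measurable [measurable]:
  "case_prod (\<lambda>x y. exponential y (x :: real^'d::finite)) \<in> borel_measurable (borel \<Otimes>\<^sub>M borel)"
proof -
  have "continuous_on UNIV (\<lambda>p :: (real^'d) \<times> (real^'d). exponential (snd p) (fst p))"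
    unfolding exponential_def by (intro continuous_intros)
  then show ?thesis unfolding borel_prod case_prod_beta' by (rule borel_measurable_continuous_onI)
qed

lemma L2_UNIV_bounded_integrable:
  fixes f :: "real^'d::finite \<Rightarrow> complex"
  assumes "integrable lborel f" "\<And>x. cmod (f x) \<le> B"
  shows "f \<in> L2 UNIV"
  unfolding L2_UNIV
proof (intro CollectI conjI)
  have m [measurable]: "f \<in> borel_measurable borel" using assms(1) by auto
  then show "f \<in> borel_measurable lebesgue" by (intro measurable_completion) simp
  have "integrable lborel (\<lambda>x. (cmod (f x))\<^sup>2)"
  proof (rule Bochner_Integration.integrable_bound[where f = "\<lambda>x. B * cmod (f x)"])
    show "integrable lborel (\<lambda>x. B * cmod (f x))" using assms(1) by simp
    have "(cmod (f x))\<^sup>2 \<le> B * cmod (f x)" for x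
      unfolding power2_eq_square by (intro mult_right_mono assms) auto
    then show "AE x in lborel. norm ((cmod (f x))\<^sup>2) \<le> norm (B * cmod (f x))"
      by (intro AE_I2) (metis abs_ge_self abs_power2 order_trans real_norm_def)
  qed measurable
  then show "integrable lebesgue (\<lambda>x. (cmod (f x))\<^sup>2)" by (simp add: integrable_completion)
qed

lemma L2_gauss: "s > 0 \<Longrightarrow> gauss m s \<in> L2 UNIV" for m :: "real^'d::finite"
proof (rule L2_UNIV_bounded_integrable[OF integrable_gauss(1)])
  assume s: "s > 0"
  show "cmod (gauss m s x) \<le> (\<Prod>i\<in>(UNIV :: 'd set). 1 / sqrt (2 * pi * s\<^sup>2))" for x :: "real^'d"
    unfolding gauss_def prod_norm[symmetric]
    using s by (intro prod_mono) (auto simp: normal_density_nonneg normal_density_def norm_divide intro!: divide_right_mono)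
qed

lemma L2_gauss_dual: "s > 0 \<Longrightarrow> gauss_dual m s \<in> L2 UNIV" for m :: "real^'d::finite"
proof (rule L2_UNIV_bounded_integrable[OF integrable_gauss_dual])
  show "cmod (gauss_dual m s x) \<le> (\<Prod>i\<in>(UNIV :: 'd set). 1 / sqrt (2 * pi) * 1)" for x :: "real^'d"
    unfolding gauss_dual_def prod_norm[symmetric]
    by (intro prod_mono) (auto simp: norm_mult norm_exp1 divide_le_cancel)
qed

lemma L2_inner_limit:
  fixes f :: "real^'d::finite \<Rightarrow> complex"
  assumes f: "f \<in> L2 S" and h: "h \<in> L2 S" and fk: "\<And>k::nat. \<phi> k \<in> L2 S"
    and lim: "(\<lambda>k. L2_norm_on S (\<lambda>x. \<phi> k x - f x)) \<longlonglongrightarrow> 0"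
  shows "(\<lambda>k. L2_inner_on S (\<phi> k) h) \<longlonglongrightarrow> L2_inner_on S f h"
proof (rule LIM_zero_cancel, rule Lim_null_comparison)
  show "(\<lambda>k. L2_norm_on S (\<lambda>x. \<phi> k x - f x) * L2_norm_on S h) \<longlonglongrightarrow> 0"
    by (rule tendsto_mult_left_zero[OF lim])
  have "norm (L2_inner_on S (\<phi> k) h - L2_inner_on S f h) \<le> L2_norm_on S (\<lambda>x. \<phi> k x - f x) * L2_norm_on S h" for k
    unfolding L2_inner_diff_left[OF fk f h, symmetric] by (rule L2_Cauchy_Schwarz[OF L2_diff[OF fk f] h])
  then show "\<forall>\<^sub>F k in sequentially. norm (L2_inner_on S (\<phi> k) h - L2_inner_on S f h) \<le> L2_norm_on S (\<lambda>x. \<phi> k x - f x) * L2_norm_on S h"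
    by simp
qed

lemma L2_cnj: "f \<in> L2 S \<Longrightarrow> (\<lambda>x. cnj (f x)) \<in> L2 S"
  by (auto simp: L2_def)

lemma inner_UNIV_cnj: "L2_inner_on UNIV f (\<lambda>x. cnj (h x)) = (\<integral>x. f x * h x \<partial>lebesgue)"
  by (simp add: L2_inner_on_def lebesgue_on_UNIV_eq)

text \<open>
For integrable functions this is the multiplication formula, since the transform of \<open>gauss_dual\<close>
is \<open>gauss\<close>. Both sides are continuous in \<open>L\<^sub>2\<close>, so it passes to the limit that defines the transform on \<open>L\<^sub>2\<close>.
\<close>

lemma has_inv_fourier_gauss:
  fixes f g :: "real^'d::finite \<Rightarrow> complex"
  assumes fg: "has_inv_fourier f g" and s: "s > 0"
  shows "(\<integral>\<xi>. g \<xi> * gauss_dual m s \<xi> \<partial>lebesgue) = (\<integral>x. f x * gauss m s x \<partial>lebesgue)"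
proof -
  obtain \<phi> where fL: "f \<in> L2 UNIV" and gL: "g \<in> L2 UNIV"
    and ph: "\<And>k::nat. integrable lebesgue (\<phi> k)" "\<And>k. \<phi> k \<in> L2 UNIV" "\<And>k. inv_fourier_L1 (\<phi> k) \<in> L2 UNIV"
    and lim: "(\<lambda>k. L2_norm_on UNIV (\<lambda>x. \<phi> k x - f x)) \<longlonglongrightarrow> 0"
      "(\<lambda>k. L2_norm_on UNIV (\<lambda>\<xi>. inv_fourier_L1 (\<phi> k) \<xi> - g \<xi>)) \<longlonglongrightarrow> 0"
    using fg unfolding has_inv_fourier_def by blast
  have eq: "(\<integral>\<xi>. inv_fourier_L1 (\<phi> k) \<xi> * gauss_dual m s \<xi> \<partial>lebesgue) = (\<integral>x. \<phi> k x * gauss m s x \<partial>lebesgue)" for k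
    unfolding inv_fourier_L1_def
    using multiplication_formula[OF ph(1)[of k] integrable_gauss_dual[OF s, of m] exponential_pair_measurable eq_refl[OF norm_exponential]]
    by (simp add: exponential_commute[of _ "_ :: real^'d"] gauss_dual_transform_vec[OF s])
  have "(\<lambda>k. \<integral>\<xi>. inv_fourier_L1 (\<phi> k) \<xi> * gauss_dual m s \<xi> \<partial>lebesgue) \<longlonglongrightarrow> (\<integral>\<xi>. g \<xi> * gauss_dual m s \<xi> \<partial>lebesgue)"
    unfolding inner_UNIV_cnj[symmetric] by (rule L2_inner_limit[OF gL L2_cnj[OF L2_gauss_dual[OF s]] ph(3) lim(2)])
  moreover have "(\<lambda>k. \<integral>\<xi>. inv_fourier_L1 (\<phi> k) \<xi> * gauss_dual m s \<xi> \<partial>lebesgue) \<longlonglongrightarrow> (\<integral>x. f x * gauss m s x \<partial>lebesgue)"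
    unfolding eq unfolding inner_UNIV_cnj[symmetric] by (rule L2_inner_limit[OF fL L2_cnj[OF L2_gauss[OF s]] ph(2) lim(1)])
  ultimately show ?thesis by (rule LIMSEQ_unique)
qed

lemma cube_integrable:
  fixes g :: "real^'d::finite \<Rightarrow> complex"
  assumes "g \<in> L2 (cube r)"
  shows "integrable lebesgue (\<lambda>x. indicator (cube r) x * g x)"
proof -
  have "(\<lambda>x. 1) \<in> L2 (cube r :: (real^'d) set)" by (rule L2_cube_bounded[where B = 1]) auto
  from L2_inner_integrable[OF assms this] have "integrable (lebesgue_on (cube r)) g" by simp
  then have "integrable lebesgue (\<lambda>x. indicator (cube r) x *\<^sub>R g x)" by (simp add: integrable_restrict_space)
  also have "(\<lambda>x. indicator (cube r) x *\<^sub>R g x) = (\<lambda>x. indicator (cube r) x * g x)" by (auto simp: indicator_def)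
  finally show ?thesis .
qed

lemma hat_gauss:
  fixes g :: "real^'d::finite \<Rightarrow> complex"
  assumes g: "g \<in> L2 (cube pi)" and s: "s > 0"
  shows "(\<integral>t. hat g t * gauss m s t \<partial>lebesgue) = (\<integral>x. indicator (cube pi) x * g x * gauss_dual m s x \<partial>lebesgue)"
proof -
  have hat: "hat g t = (\<integral>x. (indicator (cube pi) x * g x) * cnj (exponential t x) \<partial>lebesgue)" for t
    unfolding hat_def L2_inner_on_def by (subst integral_restrict_space) (auto simp: scaleR_conv_of_real indicator_def intro!: Bochner_Integration.integral_cong)
  have m: "case_prod (\<lambda>x y. cnj (exponential y (x :: real^'d))) \<in> borel_measurable (borel \<Otimes>\<^sub>M borel)"
    using borel_measurable_cnj[OF exponential_pair_measurable] by (simp add: case_prod_beta')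
  have b: "cmod (cnj (exponential y (x :: real^'d))) \<le> 1 / (2 * pi) powr (real CARD('d) / 2)" for x y :: "real^'d"
    by (simp add: norm_exponential)
  show ?thesis unfolding hat
    using multiplication_formula[OF cube_integrable[OF g] integrable_gauss(1)[OF s, of m] m b]
    by (simp add: gauss_transform_vec[OF s])
qed

text \<open>
Away from the mean, a narrow normal density is a small multiple of the fixed one with standard deviation
\<open>\<surd>2\<close>. This controls the part of an integral far from \<open>m\<close> for any integrand that is integrable against the
fixed density, bounded or not.
\<close>

lemma gauss_tail_bound:
  fixes m x :: "real^'d::finite"
  assumes k: "k \<ge> (1::nat)" and d: "\<delta> > 0" and far: "norm (x - m) \<ge> \<delta>"
  shows "cmod (gauss m (1 / real k) x) \<le> (sqrt 2 * real k) ^ CARD('d) * exp (- (\<delta>\<^sup>2 / 4) * (real k)\<^sup>2) * cmod (gauss m (sqrt 2) x)"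
proof -
  define q where "q i = (x $ i - m $ i)\<^sup>2" for i
  have Q: "(\<Sum>i\<in>UNIV. q i) = (norm (x - m))\<^sup>2"
    unfolding norm_vec_def L2_set_def q_def by (simp add: sum_nonneg)
  have K: "(real k)\<^sup>2 \<ge> 1" using k by simp
  have 1: "cmod (complex_of_real (normal_density (m $ i) (1 / real k) (x $ i))) =
     (sqrt 2 * real k) * exp (- (q i * (real k)\<^sup>2 / 2 - q i / 4)) * cmod (complex_of_real (normal_density (m $ i) (sqrt 2) (x $ i)))" for i
  proof -
    have "normal_density (m $ i) (1 / real k) (x $ i) = real k / sqrt (2 * pi) * exp (- (q i * (real k)\<^sup>2 / 2))"
      using k by (simp add: normal_density_def q_def real_sqrt_divide real_sqrt_mult power_divide)
    moreover have "normal_density (m $ i) (sqrt 2) (x $ i) = 1 / (sqrt 2 * sqrt (2 * pi)) * exp (- (q i / 4))"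
      by (simp add: normal_density_def q_def real_sqrt_mult)
    moreover have "exp (- (q i * (real k)\<^sup>2 / 2)) = exp (- (q i * (real k)\<^sup>2 / 2 - q i / 4)) * exp (- (q i / 4))"
      unfolding exp_add[symmetric] by simp
    ultimately show ?thesis by (simp add: normal_density_nonneg norm_mult norm_divide)
  qed
  have "cmod (gauss m (1 / real k) x) = (\<Prod>i\<in>UNIV. (sqrt 2 * real k) * exp (- (q i * (real k)\<^sup>2 / 2 - q i / 4)) * cmod (complex_of_real (normal_density (m $ i) (sqrt 2) (x $ i))))"
    unfolding gauss_def prod_norm[symmetric] by (intro prod.cong refl 1)
  also have "\<dots> = (sqrt 2 * real k) ^ CARD('d) * exp (\<Sum>i\<in>UNIV. - (q i * (real k)\<^sup>2 / 2 - q i / 4)) * cmod (gauss m (sqrt 2) x)"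
    by (simp only: prod.distrib prod_constant exp_sum[OF finite] gauss_def prod_norm power_mult_distrib)
  also have "(\<Sum>i\<in>UNIV. - (q i * (real k)\<^sup>2 / 2 - q i / 4)) = - ((norm (x - m))\<^sup>2 * ((real k)\<^sup>2 / 2 - 1 / 4))"
    unfolding Q[symmetric] by (simp add: sum_negf sum_subtractf sum_distrib_right sum_divide_distrib right_diff_distrib sum_distrib_left)
  also have "(sqrt 2 * real k) ^ CARD('d) * exp (- ((norm (x - m))\<^sup>2 * ((real k)\<^sup>2 / 2 - 1 / 4))) * cmod (gauss m (sqrt 2) x)
     \<le> (sqrt 2 * real k) ^ CARD('d) * exp (- (\<delta>\<^sup>2 / 4) * (real k)\<^sup>2) * cmod (gauss m (sqrt 2) x)"
  proof (intro mult_right_mono mult_left_mono)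
    have "\<delta>\<^sup>2 * ((real k)\<^sup>2 / 4) \<le> (norm (x - m))\<^sup>2 * ((real k)\<^sup>2 / 2 - 1 / 4)"
      using far d K by (intro mult_mono power_mono) auto
    then show "exp (- ((norm (x - m))\<^sup>2 * ((real k)\<^sup>2 / 2 - 1 / 4))) \<le> exp (- (\<delta>\<^sup>2 / 4) * (real k)\<^sup>2)" by simp
  qed auto
  finally show ?thesis .
qed

lemma gauss_factor_tendsto:
  assumes "c > 0"
  shows "(\<lambda>k. (sqrt 2 * real k) ^ d * exp (- c * (real k)\<^sup>2)) \<longlonglongrightarrow> 0"
proof (rule Lim_null_comparison)
  have "filterlim (\<lambda>k. c * (real k)\<^sup>2) at_top sequentially"
    using assms by real_asymp
  then have "(\<lambda>k. (c * (real k)\<^sup>2) ^ d / exp (c * (real k)\<^sup>2)) \<longlonglongrightarrow> 0"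
    by (rule filterlim_compose[OF tendsto_power_div_exp_0])
  from tendsto_mult_right_zero[OF this, of "(sqrt 2 / c) ^ d"]
  show "(\<lambda>k. (sqrt 2 / c) ^ d * ((c * (real k)\<^sup>2) ^ d / exp (c * (real k)\<^sup>2))) \<longlonglongrightarrow> 0" .
  show "\<forall>\<^sub>F k in sequentially. norm ((sqrt 2 * real k) ^ d * exp (- c * (real k)\<^sup>2)) \<le> (sqrt 2 / c) ^ d * ((c * (real k)\<^sup>2) ^ d / exp (c * (real k)\<^sup>2))"
    using eventually_ge_at_top[of 1]
  proof eventually_elim
    case (elim k)
    have "(sqrt 2 * real k) ^ d \<le> (sqrt 2 * (real k)\<^sup>2) ^ d"
      using elim by (intro power_mono mult_left_mono) (auto simp: power2_eq_square)
    also have "sqrt 2 * (real k)\<^sup>2 = sqrt 2 / c * (c * (real k)\<^sup>2)" using assms by simp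
    finally have "(sqrt 2 * real k) ^ d \<le> (sqrt 2 / c) ^ d * (c * (real k)\<^sup>2) ^ d" by (simp only: power_mult_distrib)
    then have "(sqrt 2 * real k) ^ d * exp (- c * (real k)\<^sup>2) \<le> (sqrt 2 / c) ^ d * (c * (real k)\<^sup>2) ^ d * exp (- c * (real k)\<^sup>2)"
      by (intro mult_right_mono) auto
    then show ?case by (simp add: exp_minus field_simps)
  qed
qed

text \<open>
Normal densities of shrinking width are an approximate identity, so their integrals against \<open>u\<close> recover
the value at a point of continuity.
\<close>

lemma gauss_annihilator_zero:
  fixes u :: "real^'d::finite \<Rightarrow> complex"
  assumes cont: "isCont u m"
    and int: "\<And>s. s > 0 \<Longrightarrow> integrable lebesgue (\<lambda>x. u x * gauss m s x)"
    and zero: "\<And>s. s > 0 \<Longrightarrow> (\<integral>x. u x * gauss m s x \<partial>lebesgue) = 0"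
  shows "u m = 0"
proof (rule ccontr)
  assume "u m \<noteq> 0"
  define e where "e = cmod (u m) / 2"
  have e: "e > 0" using \<open>u m \<noteq> 0\<close> by (simp add: e_def)
  obtain \<delta> where d: "\<delta> > 0" "\<And>x. norm (x - m) < \<delta> \<Longrightarrow> cmod (u x - u m) < e"
    using cont e unfolding continuous_at_eps_delta by (auto simp: dist_norm)
  have ig: "integrable lebesgue (gauss m s)" "(\<integral>x. gauss m s x \<partial>lebesgue) = 1" if "s > 0" for s
    using integrable_gauss[OF that, of m] integrable_lborel_lebesgue by (auto simp: integrable_lborel_lebesgue(2))
  have iw: "integrable lebesgue (\<lambda>x. (u m - u x) * gauss m s x)" if "s > 0" for s
    using ig(1)[OF that] int[OF that] by (simp add: left_diff_distrib)
  define K where "K = (\<integral>x. cmod ((u m - u x) * gauss m (sqrt 2) x) \<partial>lebesgue)"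
  define \<kappa> where "\<kappa> k = (sqrt 2 * real k) ^ CARD('d) * exp (- (\<delta>\<^sup>2 / 4) * (real k)\<^sup>2)" for k :: nat
  have bound: "cmod (u m) \<le> e + \<kappa> k * K" if k: "k \<ge> 1" for k
  proof -
    have s: "1 / real k > 0" using k by simp
    have "u m = (\<integral>x. u m * gauss m (1 / real k) x \<partial>lebesgue)" using ig(2)[OF s] by simp
    also have "\<dots> = (\<integral>x. u m * gauss m (1 / real k) x \<partial>lebesgue) - (\<integral>x. u x * gauss m (1 / real k) x \<partial>lebesgue)"
      using zero[OF s] by simp
    also have "\<dots> = (\<integral>x. (u m - u x) * gauss m (1 / real k) x \<partial>lebesgue)"
      using ig(1)[OF s] int[OF s] by (simp add: left_diff_distrib)
    finally have "cmod (u m) \<le> (\<integral>x. cmod ((u m - u x) * gauss m (1 / real k) x) \<partial>lebesgue)"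
      using integral_norm_bound[of lebesgue "\<lambda>x. (u m - u x) * gauss m (1 / real k) x"] by simp
    also have "\<dots> \<le> (\<integral>x. e * cmod (gauss m (1 / real k) x) + \<kappa> k * cmod ((u m - u x) * gauss m (sqrt 2) x) \<partial>lebesgue)"
    proof (rule integral_mono)
      show "integrable lebesgue (\<lambda>x. cmod ((u m - u x) * gauss m (1 / real k) x))" using iw[OF s] by (rule integrable_norm)
      show "integrable lebesgue (\<lambda>x. e * cmod (gauss m (1 / real k) x) + \<kappa> k * cmod ((u m - u x) * gauss m (sqrt 2) x))"
        by (intro Bochner_Integration.integrable_add integrable_mult_right integrable_norm iw ig s) simp
      fix x
      show "cmod ((u m - u x) * gauss m (1 / real k) x) \<le> e * cmod (gauss m (1 / real k) x) + \<kappa> k * cmod ((u m - u x) * gauss m (sqrt 2) x)"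
      proof (cases "norm (x - m) < \<delta>")
        case True
        have "cmod ((u m - u x) * gauss m (1 / real k) x) \<le> e * cmod (gauss m (1 / real k) x)"
          unfolding norm_mult using d(2)[OF True] by (intro mult_right_mono) (auto simp: norm_minus_commute)
        moreover have "0 \<le> \<kappa> k * cmod ((u m - u x) * gauss m (sqrt 2) x)" by (simp add: \<kappa>_def)
        ultimately show ?thesis by linarith
      next
        case False
        have "cmod ((u m - u x) * gauss m (1 / real k) x) \<le> cmod (u m - u x) * (\<kappa> k * cmod (gauss m (sqrt 2) x))"
          unfolding norm_mult using gauss_tail_bound[OF k d(1), of x m] False
          by (intro mult_left_mono) (auto simp: \<kappa>_def)
        moreover have "0 \<le> e * cmod (gauss m (1 / real k) x)" using e by simp
        ultimately show ?thesis by (simp add: norm_mult mult_ac)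
      qed
    qed
    also have "\<dots> = e * (\<integral>x. cmod (gauss m (1 / real k) x) \<partial>lebesgue) + \<kappa> k * K"
      unfolding K_def using s by (subst Bochner_Integration.integral_add) (auto intro!: integrable_norm iw ig integrable_mult_right)
    also have "(\<integral>x. cmod (gauss m (1 / real k) x) \<partial>lebesgue) = 1"
    proof -
      have "complex_of_real (cmod (gauss m (1 / real k) x)) = gauss m (1 / real k) x" for x
        unfolding gauss_def prod_norm[symmetric] by (simp add: normal_density_nonneg)
      then have "complex_of_real (\<integral>x. cmod (gauss m (1 / real k) x) \<partial>lebesgue) = 1"
        using ig(2)[OF s] by (simp only: integral_complex_of_real[symmetric])
      then show ?thesis using of_real_eq_1_iff by blast
    qed
    finally show ?thesis by simp
  qed
  have "(\<lambda>k. e + \<kappa> k * K) \<longlonglongrightarrow> e + 0 * K"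
    unfolding \<kappa>_def using d(1) by (intro tendsto_intros gauss_factor_tendsto) simp
  then have "cmod (u m) \<le> e + 0 * K"
    by (rule LIMSEQ_le_const) (use bound in blast)
  then show False using e by (simp add: e_def)
qed

text \<open>
The functions \<open>f\<close> and \<open>hat g\<close> have the same integral against every normal density: by
\<open>has_inv_fourier_gauss\<close> and \<open>hat_gauss\<close> both equal the integral of \<open>g\<close> against \<open>gauss_dual\<close>. As both
functions are continuous, they agree.
\<close>

theorem Paley_Wiener_hat:
  fixes f :: "real^'d::finite \<Rightarrow> complex"
  assumes "f \<in> Paley_Wiener (cube pi)"
  obtains g where "g \<in> L2 (cube pi)" "f \<in> L2 UNIV" "f = hat g"
proof -
  obtain g where cf: "continuous_on UNIV f" and fg: "has_inv_fourier f g" and supp: "AE \<xi> in lebesgue. \<xi> \<notin> cube pi \<longrightarrow> g \<xi> = 0"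
    using assms by (auto simp: Paley_Wiener_def)
  have fL: "f \<in> L2 UNIV" and gU: "g \<in> L2 UNIV" using fg by (auto simp: has_inv_fourier_def)
  have g: "g \<in> L2 (cube pi)" by (rule L2_mono_set(1)[OF _ _ _ gU]) auto
  have fi: "integrable lebesgue (\<lambda>x. f x * gauss m s x)" if "s > 0" for m s
    using L2_inner_integrable[OF fL L2_cnj[OF L2_gauss[OF that, of m]]] by (simp add: lebesgue_on_UNIV_eq)
  have gi: "integrable lebesgue (\<lambda>x. hat g x * gauss m s x)" if "s > 0" for m s
  proof -
    have "integrable lborel (\<lambda>x. hat g x * gauss m s x)"
    proof (rule Bochner_Integration.integrable_bound[where f = "\<lambda>x. L2_norm_on (cube pi) g * cmod (gauss m s x)"])
      show "integrable lborel (\<lambda>x. L2_norm_on (cube pi) g * cmod (gauss m s x))"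
        by (intro integrable_mult_right integrable_norm integrable_gauss that)
      have [measurable]: "hat g \<in> borel_measurable borel" by (intro borel_measurable_continuous_onI continuous_hat g)
      have [measurable]: "gauss m s \<in> borel_measurable borel" using integrable_gauss(1)[OF that, of m] by auto
      show "(\<lambda>x. hat g x * gauss m s x) \<in> borel_measurable lborel" by measurable
    qed (use norm_hat_le[OF g] in \<open>auto simp: norm_mult intro!: mult_right_mono\<close>)
    then show ?thesis by (rule integrable_lborel_lebesgue)
  qed
  have "f m = hat g m" for m
  proof -
    have "f m - hat g m = 0"
    proof (rule gauss_annihilator_zero[where u = "\<lambda>x. f x - hat g x"])
      have "continuous_on UNIV (\<lambda>x. f x - hat g x)" by (intro continuous_intros cf continuous_hat g)
      then show "isCont (\<lambda>x. f x - hat g x) m" by (simp add: continuous_on_eq_continuous_at)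
      fix s :: real assume s: "s > 0"
      show "integrable lebesgue (\<lambda>x. (f x - hat g x) * gauss m s x)" using fi[OF s] gi[OF s] by (simp add: left_diff_distrib)
      have "(\<integral>x. f x * gauss m s x \<partial>lebesgue) = (\<integral>x. g x * gauss_dual m s x \<partial>lebesgue)"
        by (rule has_inv_fourier_gauss[OF fg s, symmetric])
      also have "\<dots> = (\<integral>x. indicator (cube pi) x * g x * gauss_dual m s x \<partial>lebesgue)"
      proof (rule integral_cong_AE)
        have gm: "g \<in> borel_measurable lebesgue" "gauss_dual m s \<in> borel_measurable lebesgue"
          using gU L2_gauss_dual[OF s, of m] by (auto simp: L2_UNIV)
        then show "(\<lambda>x. g x * gauss_dual m s x) \<in> borel_measurable lebesgue" by measurable
        have "(\<lambda>x. indicator (cube pi) x :: complex) \<in> borel_measurable lebesgue" by simp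
        then show "(\<lambda>x. indicator (cube pi) x * g x * gauss_dual m s x) \<in> borel_measurable lebesgue" using gm by measurable
        show "AE x in lebesgue. g x * gauss_dual m s x = indicator (cube pi) x * g x * gauss_dual m s x"
          using supp by eventually_elim (auto simp: indicator_def)
      qed
      also have "\<dots> = (\<integral>t. hat g t * gauss m s t \<partial>lebesgue)" by (rule hat_gauss[OF g s, symmetric])
      finally show "(\<integral>x. (f x - hat g x) * gauss m s x \<partial>lebesgue) = 0"
        using fi[OF s, of m] gi[OF s, of m] by (simp add: left_diff_distrib)
    qed
    then show ?thesis by simp
  qed
  then show thesis using that[OF g fL] by blast
qed

section \<open>Perturbed exponentials and their sampling equations\<close>

lemma hat_add: "u \<in> L2 (cube pi) \<Longrightarrow> v \<in> L2 (cube pi) \<Longrightarrow> hat (\<lambda>x. u x + v x) t = hat u t + hat v t"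
  for u v :: "real^'d::finite \<Rightarrow> complex"
  by (simp add: hat_def L2_inner_add_left)

lemma hat_scale: "hat (\<lambda>x. c * u x) t = c * hat u t"
  by (simp add: hat_def L2_inner_scale_left)

lemma trig_poly_eq_0_if_norm_0:
  fixes h :: "real^'d::finite \<Rightarrow> complex"
  assumes h: "h \<in> trig_polys l" and z: "L2_norm_on (cube pi) h = 0"
  shows "h = (\<lambda>x. 0)"
proof -
  have "(\<Sum>n\<in>index_cube l. (cmod (hat h (ivec n)))\<^sup>2) = 0"
    using norm_trig_sum[of l "\<lambda>n. hat h (ivec n)"] trig_polys_expansion[OF h] z by simp
  then have "hat h (ivec n) = 0" if "n \<in> index_cube l" for n
    using that by (simp add: sum_nonneg_eq_0_iff)
  then show ?thesis using trig_polys_expansion[OF h] unfolding trig_sum_def fun_eq_iff by simp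
qed

lemma trig_polys_add: "y \<in> trig_polys l \<Longrightarrow> z \<in> trig_polys l \<Longrightarrow> (\<lambda>x. y x + z x) \<in> trig_polys l"
  for y z :: "real^'d::finite \<Rightarrow> complex"
  unfolding trig_polys_eq
proof (elim rangeE)
  fix a b assume "y = trig_sum l a" "z = trig_sum l b"
  then have "(\<lambda>x. y x + z x) = trig_sum l (\<lambda>n. a n + b n)"
    by (simp add: trig_sum_def fun_eq_iff distrib_right sum.distrib)
  then show "(\<lambda>x. y x + z x) \<in> range (trig_sum l)" by simp
qed

lemma trig_polys_scale: "y \<in> trig_polys l \<Longrightarrow> (\<lambda>x. c * y x) \<in> trig_polys l"
  for y :: "real^'d::finite \<Rightarrow> complex"
  unfolding trig_polys_eq
proof (elim rangeE)
  fix a assume "y = trig_sum l a"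
  then have "(\<lambda>x. c * y x) = trig_sum l (\<lambda>n. c * a n)"
    by (simp add: trig_sum_def fun_eq_iff sum_distrib_left mult.assoc)
  then show "(\<lambda>x. c * y x) \<in> range (trig_sum l)" by simp
qed

lemma trig_polys_diff: "y \<in> trig_polys l \<Longrightarrow> z \<in> trig_polys l \<Longrightarrow> (\<lambda>x. y x - z x) \<in> trig_polys l"
  for y z :: "real^'d::finite \<Rightarrow> complex"
  using trig_polys_add[of y l "\<lambda>x. - 1 * z x"] trig_polys_scale[of z l "- 1"] by simp

lemma trig_polys_zero: "(\<lambda>x. 0) \<in> trig_polys l"
  unfolding trig_polys_def by (intro CollectI exI[of _ "\<lambda>_. 0"]) simp

lemma trig_polys_sum:
  fixes u :: "'i \<Rightarrow> real^'d::finite \<Rightarrow> complex"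
  assumes "finite I" "\<And>i. i \<in> I \<Longrightarrow> u i \<in> trig_polys l"
  shows "(\<lambda>x. \<Sum>i\<in>I. c i * u i x) \<in> trig_polys l"
  using assms
proof (induction I rule: finite_induct)
  case empty
  show ?case by (simp add: trig_polys_zero)
next
  case (insert i I)
  then show ?case using trig_polys_add[OF trig_polys_scale[of "u i" l "c i"], of "\<lambda>x. \<Sum>i\<in>I. c i * u i x"] by simp
qed

lemma inner_trig_sum:
  fixes u :: "real^'d::finite \<Rightarrow> complex"
  assumes "u \<in> L2 (cube pi)"
  shows "L2_inner_on (cube pi) u (trig_sum l c) = (\<Sum>n\<in>index_cube l. cnj (c n) * hat u (ivec n))"
  unfolding trig_sum_def[abs_def] hat_def lattice_exp_ivec using assms by (intro L2_inner_sum_right) auto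

text \<open>
The part of the hypothesis that does not involve compressions: a bounded operator that carries the
lattice exponentials to those with frequencies \<open>t n\<close>.
\<close>

locale riesz_operator =
  fixes L :: "(real^'d::finite \<Rightarrow> complex) \<Rightarrow> (real^'d \<Rightarrow> complex)" and t :: "int^'d \<Rightarrow> real^'d"
  assumes lin: "L2_bounded_linear (cube pi) L"
    and basis: "\<And>n. ae_eq_on (cube pi) (L (lattice_exp n)) (exponential (t n))"
begin

lemma L_L2: "f \<in> L2 (cube pi) \<Longrightarrow> L f \<in> L2 (cube pi)"
  and L_add: "f \<in> L2 (cube pi) \<Longrightarrow> g \<in> L2 (cube pi) \<Longrightarrow> ae_eq_on (cube pi) (L (\<lambda>x. f x + g x)) (\<lambda>x. L f x + L g x)"
  and L_scale: "f \<in> L2 (cube pi) \<Longrightarrow> ae_eq_on (cube pi) (L (\<lambda>x. c * f x)) (\<lambda>x. c * L f x)"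
  using lin unfolding L2_bounded_linear_def by blast+

lemma L_bounded: "\<exists>C\<ge>0. \<forall>f\<in>L2 (cube pi). L2_norm_on (cube pi) (L f) \<le> C * L2_norm_on (cube pi) f"
proof -
  obtain C where C: "\<forall>f\<in>L2 (cube pi). L2_norm_on (cube pi) (L f) \<le> C * L2_norm_on (cube pi) f"
    using lin unfolding L2_bounded_linear_def by blast
  have "L2_norm_on (cube pi) (L f) \<le> \<bar>C\<bar> * L2_norm_on (cube pi) f" if "f \<in> L2 (cube pi)" for f
  proof -
    have "C * L2_norm_on (cube pi) f \<le> \<bar>C\<bar> * L2_norm_on (cube pi) f" by (intro mult_right_mono) auto
    then show ?thesis using bspec[OF C that] by linarith
  qed
  then show ?thesis by (intro exI[of _ "\<bar>C\<bar>"]) auto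
qed

lemma L_sum:
  assumes "finite I"
  shows "ae_eq_on (cube pi) (L (\<lambda>x. \<Sum>n\<in>I. c n * lattice_exp n x)) (\<lambda>x. \<Sum>n\<in>I. c n * exponential (t n) x)"
  using assms
proof (induction I rule: finite_induct)
  case empty
  show ?case using L_scale[OF L2_zero, of 0] by simp
next
  case (insert n I)
  let ?s = "\<lambda>x. \<Sum>n\<in>I. c n * lattice_exp n x"
  have L2: "(\<lambda>x. c n * lattice_exp n x) \<in> L2 (cube pi)" "?s \<in> L2 (cube pi)"
    by (intro L2_scale L2_sum L2_lattice_exp)+
  have "L (\<lambda>x. c n * lattice_exp n x + ?s x) = L (\<lambda>x. \<Sum>n\<in>insert n I. c n * lattice_exp n x)"
    using insert.hyps by simp
  then show ?case
    using L_add[OF L2] L_scale[OF L2_lattice_exp, of "c n" n] basis[of n] insert.IH insert.hyps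
    unfolding ae_eq_on_def by simp (elim AE_mp, auto)
qed

text \<open>
The samples of \<open>hat u\<close> at the points \<open>t n\<close> are the values of the functional \<open>\<langle>u, L \<cdot>\<rangle>\<close> on the lattice
exponentials. In this form the adjoint of \<open>L\<close> is used without being constructed.
\<close>

lemma inner_L:
  assumes u: "u \<in> L2 (cube pi)"
  shows "L2_inner_on (cube pi) u (L (trig_sum l c)) = (\<Sum>n\<in>index_cube l. cnj (c n) * hat u (t n))"
proof -
  have "L2_inner_on (cube pi) u (L (trig_sum l c)) = L2_inner_on (cube pi) u (\<lambda>x. \<Sum>n\<in>index_cube l. c n * exponential (t n) x)"
  proof (rule L2_inner_cong_AE[OF L_L2[OF L2_trig_sum] _ _ u])
    show "(\<lambda>x. \<Sum>n\<in>index_cube l. c n * exponential (t n) x) \<in> L2 (cube pi)"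
      by (intro L2_sum L2_scale L2_exponential)
    show "ae_eq_on (cube pi) (L (trig_sum l c)) (\<lambda>x. \<Sum>n\<in>index_cube l. c n * exponential (t n) x)"
      using L_sum[OF finite_index_cube, of c l] by (simp add: trig_sum_def[abs_def])
  qed
  also have "\<dots> = (\<Sum>n\<in>index_cube l. cnj (c n) * hat u (t n))"
    unfolding hat_def using u by (intro L2_inner_sum_right) auto
  finally show ?thesis .
qed

lemma compression_eq: "y \<in> trig_polys l \<Longrightarrow> compression l L y = fourier_sum l (L y)"
  by (simp add: compression_def trig_proj_trig_polys trig_proj_eq L_L2 L2_trig_polys)

lemma compression_trig: "y \<in> trig_polys l \<Longrightarrow> compression l L y \<in> trig_polys l"
  by (simp add: compression_eq fourier_sum_trig)

lemma inner_compression: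
  assumes h: "h \<in> trig_polys l" and y: "y \<in> trig_polys l"
  shows "L2_inner_on (cube pi) h (compression l L y) = L2_inner_on (cube pi) h (L y)"
proof -
  have Ly: "L y \<in> L2 (cube pi)" by (rule L_L2[OF L2_trig_polys[OF y]])
  have "L2_inner_on (cube pi) (\<lambda>x. L y x - fourier_sum l (L y) x) h = 0" by (rule inner_diff_fourier_sum[OF Ly h])
  then have "L2_inner_on (cube pi) (L y) h = L2_inner_on (cube pi) (fourier_sum l (L y)) h"
    using Ly h by (simp add: L2_inner_diff_left L2_trig_polys)
  then show ?thesis unfolding compression_eq[OF y] by (metis L2_inner_cnj)
qed

lemma hat_cong_AE: "f \<in> L2 (cube pi) \<Longrightarrow> g \<in> L2 (cube pi) \<Longrightarrow> ae_eq_on (cube pi) f g \<Longrightarrow> hat f s = hat g s"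
  unfolding hat_def using L2_inner_cong_AE[of f "cube pi" g "exponential s"] by (metis L2_inner_cnj L2_exponential)

lemma compression_add:
  assumes "y \<in> trig_polys l" "z \<in> trig_polys l"
  shows "compression l L (\<lambda>x. y x + z x) = (\<lambda>x. compression l L y x + compression l L z x)"
proof -
  have L2: "y \<in> L2 (cube pi)" "z \<in> L2 (cube pi)" using assms by (auto intro: L2_trig_polys)
  have "hat (L (\<lambda>x. y x + z x)) s = hat (L y) s + hat (L z) s" for s
    using hat_cong_AE[OF _ _ L_add[OF L2]] L2 by (simp add: L_L2 L2_add hat_add)
  then show ?thesis using assms
    by (simp add: compression_eq trig_polys_add fourier_sum_def trig_sum_def fun_eq_iff distrib_right sum.distrib)
qed

lemma compression_scale:
  assumes "y \<in> trig_polys l"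
  shows "compression l L (\<lambda>x. c * y x) = (\<lambda>x. c * compression l L y x)"
proof -
  have L2: "y \<in> L2 (cube pi)" using assms by (auto intro: L2_trig_polys)
  have "hat (L (\<lambda>x. c * y x)) s = c * hat (L y) s" for s
    using hat_cong_AE[OF _ _ L_scale[OF L2]] L2 by (simp add: L_L2 L2_scale hat_scale)
  then show ?thesis using assms
    by (simp add: compression_eq trig_polys_scale fourier_sum_def trig_sum_def fun_eq_iff sum_distrib_left mult.assoc)
qed

text \<open>
Test against \<open>L y\<close>, where \<open>y\<close> is the trigonometric polynomial whose coefficients are the samples
themselves. The sum in question is \<open>\<parallel>y\<parallel>\<^sup>2 = \<langle>g, L y\<rangle> \<le> \<parallel>g\<parallel> C \<parallel>y\<parallel>\<close>.
\<close>

lemma sum_squared_samples_le: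
  assumes g: "g \<in> L2 (cube pi)"
    and C: "C \<ge> 0" "\<forall>f\<in>L2 (cube pi). L2_norm_on (cube pi) (L f) \<le> C * L2_norm_on (cube pi) f"
  shows "(\<Sum>n\<in>index_cube l. (cmod (hat g (t n)))\<^sup>2) \<le> (C * L2_norm_on (cube pi) g)\<^sup>2"
proof -
  define y where "y = trig_sum l (\<lambda>n. hat g (t n))"
  define q where "q = L2_norm_on (cube pi) y"
  have S: "(\<Sum>n\<in>index_cube l. (cmod (hat g (t n)))\<^sup>2) = q\<^sup>2"
    unfolding q_def y_def norm_trig_sum ..
  have "complex_of_real (q\<^sup>2) = L2_inner_on (cube pi) g (L y)"
    unfolding S[symmetric] y_def inner_L[OF g] by (simp only: of_real_sum complex_norm_square mult.commute)
  then have "q\<^sup>2 = cmod (L2_inner_on (cube pi) g (L y))" by (metis abs_of_nonneg norm_of_real zero_le_power2)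
  also have "\<dots> \<le> L2_norm_on (cube pi) g * L2_norm_on (cube pi) (L y)"
    by (intro L2_Cauchy_Schwarz g L_L2) (simp add: y_def)
  also have "\<dots> \<le> L2_norm_on (cube pi) g * (C * q)"
    using C(2) by (intro mult_left_mono) (auto simp: q_def y_def)
  finally have "q * q \<le> (C * L2_norm_on (cube pi) g) * q" by (simp add: power2_eq_square mult_ac)
  then have "q \<le> C * L2_norm_on (cube pi) g"
    using C(1) by (cases "q = 0") (auto simp: q_def mult_le_cancel_right less_le)
  then show ?thesis unfolding S by (intro power_mono) (simp_all add: q_def)
qed

end

locale riesz_invertible = riesz_operator +
  assumes bij: "\<And>l. l \<ge> 1 \<Longrightarrow> bij_betw (compression l L) (trig_polys l) (trig_polys l)"
    and sup: "(SUP l\<in>{1..}. trig_op_norm l (inv_into (trig_polys l) (compression l L))) < \<infinity>"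
begin

definition compr_inv :: "nat \<Rightarrow> (real^'a \<Rightarrow> complex) \<Rightarrow> real^'a \<Rightarrow> complex" where
  "compr_inv l = inv_into (trig_polys l) (compression l L)"

lemma compr_inv_trig: "l \<ge> 1 \<Longrightarrow> y \<in> trig_polys l \<Longrightarrow> compr_inv l y \<in> trig_polys l"
  unfolding compr_inv_def using bij_betw_inv_into[OF bij] by (auto simp: bij_betw_def)

lemma compression_compr_inv: "l \<ge> 1 \<Longrightarrow> y \<in> trig_polys l \<Longrightarrow> compression l L (compr_inv l y) = y"
  unfolding compr_inv_def by (rule bij_betw_inv_into_right[OF bij])

lemma compr_inv_compression: "l \<ge> 1 \<Longrightarrow> y \<in> trig_polys l \<Longrightarrow> compr_inv l (compression l L y) = y"
  unfolding compr_inv_def by (rule bij_betw_inv_into_left[OF bij])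

lemma compr_inv_add:
  assumes l: "l \<ge> 1" and y: "y \<in> trig_polys l" and z: "z \<in> trig_polys l"
  shows "compr_inv l (\<lambda>x. y x + z x) = (\<lambda>x. compr_inv l y x + compr_inv l z x)"
proof -
  have "compression l L (\<lambda>x. compr_inv l y x + compr_inv l z x) = (\<lambda>x. y x + z x)"
    using assms by (simp add: compression_add compr_inv_trig compression_compr_inv)
  then show ?thesis using compr_inv_compression[OF l trig_polys_add[OF compr_inv_trig[OF l y] compr_inv_trig[OF l z]]] by simp
qed

lemma compr_inv_scale:
  assumes l: "l \<ge> 1" and y: "y \<in> trig_polys l"
  shows "compr_inv l (\<lambda>x. c * y x) = (\<lambda>x. c * compr_inv l y x)"
proof -
  have "compression l L (\<lambda>x. c * compr_inv l y x) = (\<lambda>x. c * y x)"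
    using assms by (simp add: compression_scale compr_inv_trig compression_compr_inv)
  then show ?thesis using compr_inv_compression[OF l trig_polys_scale[OF compr_inv_trig[OF l y]], of c] by simp
qed

lemma compr_inv_sum:
  assumes l: "l \<ge> 1" and fin: "finite I" and u: "\<And>i. i \<in> I \<Longrightarrow> u i \<in> trig_polys l"
  shows "compr_inv l (\<lambda>x. \<Sum>i\<in>I. c i * u i x) = (\<lambda>x. \<Sum>i\<in>I. c i * compr_inv l (u i) x)"
  using fin u
proof (induction I rule: finite_induct)
  case empty
  from compr_inv_scale[OF l trig_polys_zero, of 0] show ?case by simp
next
  case (insert i I)
  then show ?case
    using compr_inv_add[OF l trig_polys_scale[of "u i" l "c i"] trig_polys_sum[of I u l c]] compr_inv_scale[OF l, of "u i" "c i"] by simp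
qed

lemma compr_inv_bounded: "\<exists>M\<ge>0. \<forall>l\<ge>1. \<forall>y\<in>trig_polys l. L2_norm_on (cube pi) (compr_inv l y) \<le> M * L2_norm_on (cube pi) y"
proof -
  obtain M :: nat where M: "(SUP l\<in>{1..}. trig_op_norm l (compr_inv l)) < ereal (real M)"
    using less_PInf_Ex_of_nat[THEN iffD1, OF less_imp_neq[OF sup[folded compr_inv_def]]] by auto
  have "L2_norm_on (cube pi) (compr_inv l y) \<le> real M * L2_norm_on (cube pi) y" if l: "l \<ge> 1" and y: "y \<in> trig_polys l" for l y
  proof (cases "L2_norm_on (cube pi) y = 0")
    case True
    then have "y = (\<lambda>x. 0)" by (rule trig_poly_eq_0_if_norm_0[OF y])
    then have "compr_inv l y = (\<lambda>x. 0)" using compr_inv_scale[OF l y, of 0] by simp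
    then show ?thesis using True by (simp add: L2_norm_on_def)
  next
    case False
    define q where "q = L2_norm_on (cube pi) y"
    have q: "q > 0" using False L2_norm_nonneg[of "cube pi" y] unfolding q_def by linarith
    define z where "z x = complex_of_real (1 / q) * y x" for x
    have z: "z \<in> trig_polys l" unfolding z_def[abs_def] by (rule trig_polys_scale[OF y])
    have zn: "L2_norm_on (cube pi) z = 1"
      unfolding z_def[abs_def] L2_norm_scale using q by (simp add: q_def[symmetric] norm_divide)
    have "ereal (L2_norm_on (cube pi) (compr_inv l z)) \<le> trig_op_norm l (compr_inv l)"
      unfolding trig_op_norm_def by (rule SUP_upper) (simp add: z zn)
    also have "\<dots> \<le> (SUP l\<in>{1..}. trig_op_norm l (compr_inv l))" using l by (intro SUP_upper) simp
    also have "\<dots> \<le> ereal (real M)" using M by (rule less_imp_le)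
    finally have "L2_norm_on (cube pi) (compr_inv l z) \<le> real M" by simp
    moreover have "L2_norm_on (cube pi) (compr_inv l z) = 1 / q * L2_norm_on (cube pi) (compr_inv l y)"
      unfolding z_def[abs_def] compr_inv_scale[OF l y] L2_norm_scale using q by (simp add: norm_divide)
    ultimately show ?thesis using q by (simp add: q_def[symmetric] divide_le_eq mult.commute)
  qed
  then show ?thesis by (intro exI[of _ "real M"]) auto
qed

text \<open>
The functional \<open>z \<mapsto> \<Sum>\<^sub>n b\<^sub>n cnj (n-th coefficient of (P\<^sub>l L P\<^sub>l)\<^sup>-\<^sup>1 z)\<close> on trigonometric polynomials is
represented by some \<open>h\<close>. At \<open>z = P\<^sub>l L e\<^sub>n\<close> it takes the value \<open>b\<^sub>n\<close>, which is thus
\<open>\<langle>h, L e\<^sub>n\<rangle> = hat h (t n)\<close>.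
\<close>

lemma samples_solvable:
  assumes l: "l \<ge> 1"
  shows "\<exists>h\<in>trig_polys l. \<forall>n\<in>index_cube l. hat h (t n) = b n"
proof -
  \<comment> \<open>the values of the functional at the lattice exponentials, which are the coefficients of \<open>h\<close>\<close>
  define c where "c m = (\<Sum>n\<in>index_cube l. b n * cnj (hat (compr_inv l (lattice_exp m)) (ivec n)))" for m
  define h where "h = trig_sum l c"
  have h: "h \<in> trig_polys l" by (simp add: h_def trig_polys_eq)
  have inner: "L2_inner_on (cube pi) h z = (\<Sum>n\<in>index_cube l. b n * cnj (hat (compr_inv l z) (ivec n)))" if z: "z \<in> trig_polys l" for z
  proof -
    define a where "a m = hat z (ivec m)" for m
    have za: "z = trig_sum l a" unfolding a_def by (rule trig_polys_expansion[OF z])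
    have Bz: "hat (compr_inv l z) s = (\<Sum>m\<in>index_cube l. a m * hat (compr_inv l (lattice_exp m)) s)" for s
    proof -
      have "compr_inv l z = (\<lambda>x. \<Sum>m\<in>index_cube l. a m * compr_inv l (lattice_exp m) x)"
        unfolding za trig_sum_def[abs_def] by (rule compr_inv_sum[OF l finite_index_cube lattice_exp_trig_polys])
      then show ?thesis unfolding hat_def
        using L2_inner_sum_left[of "index_cube l" "\<lambda>m. compr_inv l (lattice_exp m)" "cube pi" "exponential s" a]
        by (simp add: L2_trig_polys[OF compr_inv_trig[OF l lattice_exp_trig_polys]])
    qed
    have "L2_inner_on (cube pi) h z = (\<Sum>m\<in>index_cube l. cnj (a m) * c m)"
      unfolding za by (subst inner_trig_sum) (auto simp: h_def hat_trig_sum_ivec)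
    also have "\<dots> = (\<Sum>m\<in>index_cube l. \<Sum>n\<in>index_cube l. b n * (cnj (a m) * cnj (hat (compr_inv l (lattice_exp m)) (ivec n))))"
      unfolding c_def sum_distrib_left by (intro sum.cong refl) (simp add: mult_ac)
    also have "\<dots> = (\<Sum>n\<in>index_cube l. \<Sum>m\<in>index_cube l. b n * (cnj (a m) * cnj (hat (compr_inv l (lattice_exp m)) (ivec n))))"
      by (rule sum.swap)
    also have "\<dots> = (\<Sum>n\<in>index_cube l. b n * cnj (hat (compr_inv l z) (ivec n)))"
      unfolding Bz by (simp add: sum_distrib_left)
    finally show ?thesis .
  qed
  have "hat h (t n) = b n" if n: "n \<in> index_cube l" for n
  proof -
    note e = lattice_exp_trig_polys[OF n]
    have "hat h (t n) = L2_inner_on (cube pi) h (L (lattice_exp n))"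
      unfolding hat_def using basis[of n] by (intro L2_inner_cong_AE[symmetric] L_L2 L2_trig_polys[OF h]) auto
    also have "\<dots> = L2_inner_on (cube pi) h (compression l L (lattice_exp n))"
      by (rule inner_compression[OF h e, symmetric])
    also have "\<dots> = (\<Sum>k\<in>index_cube l. b k * cnj (hat (lattice_exp n) (ivec k)))"
      unfolding inner[OF compression_trig[OF e]] compr_inv_compression[OF l e] ..
    also have "\<dots> = (\<Sum>k\<in>index_cube l. if n = k then b k else 0)"
      by (intro sum.cong refl) (simp add: hat_def inner_lattice_exp flip: lattice_exp_ivec)
    finally show ?thesis using n by simp
  qed
  with h show ?thesis by blast
qed

text \<open>
If all samples vanish, then \<open>h\<close> is orthogonal to the range of the compression, which contains \<open>h\<close>.
\<close>

lemma samples_unique: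
  assumes l: "l \<ge> 1" and h: "h \<in> trig_polys l" and zero: "\<And>n. n \<in> index_cube l \<Longrightarrow> hat h (t n) = 0"
  shows "h = (\<lambda>x. 0)"
proof (rule trig_poly_eq_0_if_norm_0[OF h])
  define y where "y = compr_inv l h"
  have y: "y \<in> trig_polys l" unfolding y_def by (rule compr_inv_trig[OF l h])
  have "L2_inner_on (cube pi) h h = L2_inner_on (cube pi) h (L y)"
    using inner_compression[OF h y] compression_compr_inv[OF l h] by (simp add: y_def)
  also have "\<dots> = L2_inner_on (cube pi) h (L (trig_sum l (\<lambda>n. hat y (ivec n))))"
    using trig_polys_expansion[OF y] by simp
  also have "\<dots> = 0"
    unfolding inner_L[OF L2_trig_polys[OF h]] using zero by simp
  finally show "L2_norm_on (cube pi) h = 0" by (simp add: L2_inner_self)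
qed

end

text \<open>
Dominated convergence for square summable sequences: outside a fixed index cube the sum of \<open>|a\<^sub>n|\<^sup>2\<close> is small and
the weights are at most \<open>2\<close>, inside it there are finitely many terms.
\<close>

lemma weighted_tail_tendsto:
  fixes a :: "int^'d::finite \<Rightarrow> complex" and r :: "nat \<Rightarrow> int^'d \<Rightarrow> real"
  assumes bdd: "\<And>l. (\<Sum>n\<in>index_cube l. (cmod (a n))\<^sup>2) \<le> K"
    and r1: "\<And>l n. l \<ge> 1 \<Longrightarrow> \<bar>r l n\<bar> \<le> 1" and lim: "\<And>n. (\<lambda>l. r l n) \<longlonglongrightarrow> 1"
  shows "(\<lambda>l. \<Sum>n\<in>index_cube l. (cmod (of_real (r l n - 1) * a n))\<^sup>2) \<longlonglongrightarrow> 0"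
proof (rule LIMSEQ_I)
  fix e :: real assume e: "e > 0"
  define s where "s l = (\<Sum>n\<in>index_cube l. (cmod (a n))\<^sup>2)" for l
  have mono: "index_cube l \<subseteq> (index_cube m :: (int^'d) set)" if "l \<le> m" for l m
  proof
    fix n :: "int^'d" assume "n \<in> index_cube l"
    then have "- int m \<le> n $ i \<and> n $ i \<le> int m" for i
      using that unfolding index_cube_def by (auto dest!: spec[of _ i])
    then show "n \<in> index_cube m" by (simp add: index_cube_def)
  qed
  have "incseq s" unfolding incseq_def s_def by (intro allI impI sum_mono2 finite_index_cube mono) auto
  moreover have "s l \<le> K" for l using bdd by (simp add: s_def)
  ultimately have "convergent s"
    by (intro Bseq_mono_convergent[of s] BseqI'[of _ "\<bar>K\<bar>"]) (auto simp: s_def sum_nonneg monotone_def abs_le_iff intro: order_trans[OF _ abs_ge_self])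
  then have "Cauchy s" by (rule convergent_Cauchy)
  then obtain N where N: "\<And>l m. l \<ge> N \<Longrightarrow> m \<ge> N \<Longrightarrow> \<bar>s l - s m\<bar> < e / 8"
    using e unfolding Cauchy_def dist_real_def by (metis divide_pos_pos zero_less_numeral)
  have "(\<lambda>l. \<Sum>n\<in>index_cube N. (cmod (of_real (r l n - 1) * a n))\<^sup>2) \<longlonglongrightarrow> (\<Sum>n\<in>(index_cube N :: (int^'d) set). (cmod (of_real (1 - 1) * a n))\<^sup>2)"
    by (intro tendsto_intros lim)
  then have "(\<lambda>l. \<Sum>n\<in>index_cube N. (cmod (of_real (r l n - 1) * a n))\<^sup>2) \<longlonglongrightarrow> 0" by simp
  from LIMSEQ_D[OF this, of "e / 2"] e obtain N2 where N2: "\<And>l. l \<ge> N2 \<Longrightarrow> (\<Sum>n\<in>index_cube N. (cmod (of_real (r l n - 1) * a n))\<^sup>2) < e / 2"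
    by (auto simp: sum_nonneg)
  show "\<exists>M. \<forall>l\<ge>M. norm ((\<Sum>n\<in>index_cube l. (cmod (of_real (r l n - 1) * a n))\<^sup>2) - 0) < e"
  proof (intro exI[of _ "max 1 (max N N2)"] allI impI)
    fix l assume "l \<ge> max 1 (max N N2)"
    then have l: "l \<ge> 1" "l \<ge> N" "l \<ge> N2" by auto
    have term_le: "(cmod (of_real (r l n - 1) * a n))\<^sup>2 \<le> 4 * (cmod (a n))\<^sup>2" for n
    proof -
      have "\<bar>r l n - 1\<bar> \<le> 2" using r1[OF l(1), of n] by linarith
      then have "(\<bar>r l n - 1\<bar> * cmod (a n))\<^sup>2 \<le> (2 * cmod (a n))\<^sup>2" by (intro power_mono mult_right_mono) auto
      then show ?thesis by (simp add: norm_mult power_mult_distrib del: of_real_diff)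
    qed
    have split: "(\<Sum>n\<in>index_cube l. g n) = (\<Sum>n\<in>index_cube N. g n) + (\<Sum>n\<in>index_cube l - index_cube N. g n)" for g :: "int^'d \<Rightarrow> real"
      using sum.subset_diff[OF mono[OF l(2)] finite_index_cube, of g] by simp
    have "(\<Sum>n\<in>index_cube l - index_cube N. (cmod (of_real (r l n - 1) * a n))\<^sup>2) \<le> (\<Sum>n\<in>index_cube l - index_cube N. 4 * (cmod (a n))\<^sup>2)"
      by (intro sum_mono term_le)
    also have "\<dots> = 4 * (s l - s N)" unfolding s_def split[of "\<lambda>n. (cmod (a n))\<^sup>2"] by (simp add: sum_distrib_left)
    also have "4 * (s l - s N) < e / 2"
    proof -
      have "s l - s N < e / 8" using N[OF l(2) order_refl] by (rule le_less_trans[OF abs_ge_self])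
      then show ?thesis by simp
    qed
    finally have "(\<Sum>n\<in>index_cube l. (cmod (of_real (r l n - 1) * a n))\<^sup>2) < e"
      unfolding split[of "\<lambda>n. (cmod (of_real (r l n - 1) * a n))\<^sup>2"] using N2[OF l(3)] by linarith
    then show "norm ((\<Sum>n\<in>index_cube l. (cmod (of_real (r l n - 1) * a n))\<^sup>2) - 0) < e"
      by (simp add: sum_nonneg)
  qed
qed

context riesz_invertible
begin

text \<open>
For \<open>k = h\<^sub>l - P\<^sub>l g\<close> and \<open>y = (P\<^sub>l L P\<^sub>l)\<^sup>-\<^sup>1 k\<close> one has
\<open>\<parallel>k\<parallel>\<^sup>2 = \<langle>k, L y\<rangle> = \<langle>h\<^sub>l - g, L y\<rangle> + \<langle>g - P\<^sub>l g, L y\<rangle>\<close>. The first term only involves samples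
and is at most \<open>\<parallel>y\<parallel>\<close> times the \<open>\<ell>\<^sub>2\<close> norm of the perturbation, the second is at most
\<open>C \<parallel>g - P\<^sub>l g\<parallel> \<parallel>y\<parallel>\<close>, and \<open>\<parallel>y\<parallel> \<le> M \<parallel>k\<parallel>\<close> with \<open>M\<close> independent of \<open>l\<close>.
\<close>

lemma perturbed_projection_converges:
  fixes r :: "nat \<Rightarrow> int^'a \<Rightarrow> real"
  assumes g: "g \<in> L2 (cube pi)"
    and h: "\<And>l. l \<ge> 1 \<Longrightarrow> h l \<in> trig_polys l"
    and samples: "\<And>l n. l \<ge> 1 \<Longrightarrow> n \<in> index_cube l \<Longrightarrow> hat (h l) (t n) = of_real (r l n) * hat g (t n)"
    and r1: "\<And>l n. l \<ge> 1 \<Longrightarrow> \<bar>r l n\<bar> \<le> 1" and lim: "\<And>n. (\<lambda>l. r l n) \<longlonglongrightarrow> 1"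
  shows "(\<lambda>l. L2_norm_on (cube pi) (\<lambda>x. g x - h l x)) \<longlonglongrightarrow> 0"
proof -
  obtain C where C: "C \<ge> 0" "\<forall>f\<in>L2 (cube pi). L2_norm_on (cube pi) (L f) \<le> C * L2_norm_on (cube pi) f"
    using L_bounded by blast
  obtain M where M: "M \<ge> 0" "\<forall>l\<ge>1. \<forall>y\<in>trig_polys l. L2_norm_on (cube pi) (compr_inv l y) \<le> M * L2_norm_on (cube pi) y"
    using compr_inv_bounded by blast
  define D where "D l = L2_norm_on (cube pi) (\<lambda>x. g x - fourier_sum l g x)" for l
  define E where "E l = sqrt (\<Sum>n\<in>index_cube l. (cmod (of_real (r l n - 1) * hat g (t n)))\<^sup>2)" for l
  have D0: "D \<longlonglongrightarrow> 0" unfolding D_def using fourier_sum_converges[OF g] .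
  have E0: "E \<longlonglongrightarrow> 0"
    using tendsto_real_sqrt[OF weighted_tail_tendsto[where a = "\<lambda>n. hat g (t n)" and r = r, OF sum_squared_samples_le[OF g C] r1 lim]]
    by (simp add: E_def[abs_def])
  have bound: "L2_norm_on (cube pi) (\<lambda>x. g x - h l x) \<le> D l + M * (C * D l + E l)" if l: "l \<ge> 1" for l
  proof -
    define k where "k x = h l x - fourier_sum l g x" for x
    have k: "k \<in> trig_polys l" unfolding k_def[abs_def] by (intro trig_polys_diff h[OF l] fourier_sum_trig)
    have kL: "k \<in> L2 (cube pi)" by (rule L2_trig_polys[OF k])
    have hL: "h l \<in> L2 (cube pi)" by (rule L2_trig_polys[OF h[OF l]])
    have dL: "(\<lambda>x. g x - fourier_sum l g x) \<in> L2 (cube pi)" by (intro L2_diff g L2_fourier_sum)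
    define y where "y = compr_inv l k"
    have y: "y \<in> trig_polys l" unfolding y_def by (rule compr_inv_trig[OF l k])
    have LyL: "L y \<in> L2 (cube pi)" by (intro L_L2 L2_trig_polys[OF y])
    define c where "c n = hat y (ivec n)" for n
    have yc: "y = trig_sum l c" unfolding c_def by (rule trig_polys_expansion[OF y])
    define q where "q = L2_norm_on (cube pi) k"
    have yq: "L2_norm_on (cube pi) y \<le> M * q" unfolding y_def q_def using M(2) l k by blast
    have ih: "L2_inner_on (cube pi) (h l) (L y) = (\<Sum>n\<in>index_cube l. cnj (c n) * (of_real (r l n) * hat g (t n)))"
      unfolding yc inner_L[OF hL] by (intro sum.cong refl) (simp add: samples[OF l])
    have ig: "L2_inner_on (cube pi) g (L y) = (\<Sum>n\<in>index_cube l. cnj (c n) * hat g (t n))"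
      unfolding yc inner_L[OF g] ..
    have diff: "L2_inner_on (cube pi) (h l) (L y) - L2_inner_on (cube pi) g (L y) = (\<Sum>n\<in>index_cube l. cnj (c n) * (of_real (r l n - 1) * hat g (t n)))"
      unfolding ih ig sum_subtractf[symmetric] by (intro sum.cong refl) (simp add: algebra_simps)
    have "complex_of_real (q\<^sup>2) = L2_inner_on (cube pi) k (compression l L y)"
      unfolding q_def L2_inner_self[symmetric] y_def compression_compr_inv[OF l k] ..
    also have "\<dots> = L2_inner_on (cube pi) k (L y)" by (rule inner_compression[OF k y])
    also have "\<dots> = L2_inner_on (cube pi) (h l) (L y) - L2_inner_on (cube pi) (fourier_sum l g) (L y)"
      unfolding k_def[abs_def] by (rule L2_inner_diff_left[OF hL L2_fourier_sum LyL])
    also have "\<dots> = (\<Sum>n\<in>index_cube l. cnj (c n) * (of_real (r l n - 1) * hat g (t n))) + L2_inner_on (cube pi) (\<lambda>x. g x - fourier_sum l g x) (L y)"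
      unfolding diff[symmetric] L2_inner_diff_left[OF g L2_fourier_sum LyL] by simp
    finally have "q\<^sup>2 = cmod ((\<Sum>n\<in>index_cube l. cnj (c n) * (of_real (r l n - 1) * hat g (t n))) + L2_inner_on (cube pi) (\<lambda>x. g x - fourier_sum l g x) (L y))"
      by (metis abs_of_nonneg norm_of_real zero_le_power2)
    also have "\<dots> \<le> cmod (\<Sum>n\<in>index_cube l. cnj (c n) * (of_real (r l n - 1) * hat g (t n))) + cmod (L2_inner_on (cube pi) (\<lambda>x. g x - fourier_sum l g x) (L y))"
      by (rule norm_triangle_ineq)
    also have "cmod (\<Sum>n\<in>index_cube l. cnj (c n) * (of_real (r l n - 1) * hat g (t n))) \<le> L2_norm_on (cube pi) y * E l"
    proof -
      have "cmod (\<Sum>n\<in>index_cube l. cnj (c n) * (of_real (r l n - 1) * hat g (t n))) \<le> (\<Sum>n\<in>index_cube l. \<bar>cmod (c n)\<bar> * \<bar>cmod (of_real (r l n - 1) * hat g (t n))\<bar>)"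
        by (rule sum_norm_le) (simp add: norm_mult)
      also have "\<dots> \<le> L2_set (\<lambda>n. cmod (c n)) (index_cube l) * L2_set (\<lambda>n. cmod (of_real (r l n - 1) * hat g (t n))) (index_cube l)"
        by (rule L2_set_mult_ineq)
      also have "L2_set (\<lambda>n. cmod (c n)) (index_cube l) = L2_norm_on (cube pi) y"
        unfolding L2_set_def yc norm_trig_sum[symmetric] by simp
      finally show ?thesis unfolding L2_set_def E_def .
    qed
    also have "cmod (L2_inner_on (cube pi) (\<lambda>x. g x - fourier_sum l g x) (L y)) \<le> D l * (C * L2_norm_on (cube pi) y)"
      using L2_Cauchy_Schwarz[OF dL LyL] C(2) L2_trig_polys[OF y, of pi] mult_left_mono[of "L2_norm_on (cube pi) (L y)" "C * L2_norm_on (cube pi) y" "D l"]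
      by (force simp: D_def)
    finally have "q\<^sup>2 \<le> L2_norm_on (cube pi) y * (C * D l + E l)" by (simp add: algebra_simps)
    also have "\<dots> \<le> (M * q) * (C * D l + E l)"
      using yq C(1) by (intro mult_right_mono) (auto simp: D_def E_def sum_nonneg)
    finally have "q * q \<le> (M * (C * D l + E l)) * q" by (simp add: power2_eq_square mult_ac)
    moreover have "0 \<le> M * (C * D l + E l)" using M(1) C(1) by (simp add: D_def E_def sum_nonneg)
    ultimately have q: "q \<le> M * (C * D l + E l)"
      by (cases "q = 0") (auto simp: q_def mult_le_cancel_right less_le)
    have "L2_norm_on (cube pi) (\<lambda>x. g x - h l x) = L2_norm_on (cube pi) (\<lambda>x. (g x - fourier_sum l g x) - k x)"
      by (simp add: k_def)
    also have "\<dots> \<le> D l + q" unfolding D_def q_def by (rule L2_norm_triangle_diff[OF dL kL])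
    finally show ?thesis using q by simp
  qed
  have "(\<lambda>l. D l + M * (C * D l + E l)) \<longlonglongrightarrow> 0 + M * (C * 0 + 0)" by (intro tendsto_intros D0 E0)
  then have lim0: "(\<lambda>l. D l + M * (C * D l + E l)) \<longlonglongrightarrow> 0" by simp
  show ?thesis
  proof (rule Lim_null_comparison[OF _ lim0])
    show "\<forall>\<^sub>F l in sequentially. norm (L2_norm_on (cube pi) (\<lambda>x. g x - h l x)) \<le> D l + M * (C * D l + E l)"
      using eventually_ge_at_top[of 1] by eventually_elim (simp add: bound)
  qed
qed

text \<open>
Otherwise \<open>hat h (t n) = 0\<close> for every trigonometric polynomial \<open>h\<close> of order \<open>l\<close>, since \<open>hat h\<close> is a multiple
of the tail. This contradicts \<open>samples_solvable\<close>.
\<close>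

lemma tail_prod_nonzero_at_nodes:
  fixes n :: "int^'a"
  assumes l: "l \<ge> 1" and n: "n \<in> index_cube l"
  shows "tail_prod l (t n) \<noteq> 0"
proof -
  obtain h where h: "h \<in> trig_polys l" "hat h (t n) = 1"
    using samples_solvable[OF l, of "\<lambda>_. 1"] n by blast
  obtain p where "\<And>x. of_real (tail_prod l x) * p x = hat h x"
    using trig_poly_coord_poly[OF h(1)] by blast
  from this[of "t n"] show ?thesis using h(2) by auto
qed

text \<open>
Multiplication with the tail translates the interpolation problem into a sampling problem for trigonometric
polynomials, to which \<open>samples_solvable\<close> and \<open>samples_unique\<close> apply.
\<close>

theorem interpolation_unique_existence:
  assumes l: "l \<ge> 1"
  shows "\<exists>!p. interpolates t f l p"
proof (rule ex_ex1I)
  obtain h where h: "h \<in> trig_polys l" "\<And>n. n \<in> index_cube l \<Longrightarrow> hat h (t n) = of_real (tail_prod l (t n)) * f (t n)"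
    using samples_solvable[OF l, of "\<lambda>n. of_real (tail_prod l (t n)) * f (t n)"] by blast
  obtain p where p: "p \<in> coord_polys (2 * l)" "\<And>x. of_real (tail_prod l x) * p x = hat h x"
    using trig_poly_coord_poly[OF h(1)] by blast
  have "p (t n) = f (t n)" if n: "n \<in> index_cube l" for n
    using p(2)[of "t n"] h(2)[OF n] tail_prod_nonzero_at_nodes[OF l n] by simp
  with p(1) show "\<exists>p. interpolates t f l p" by (auto simp: interpolates_def)
next
  fix p q assume pq: "interpolates t f l p" "interpolates t f l q"
  then have p: "p \<in> coord_polys (2 * l)" and q: "q \<in> coord_polys (2 * l)" by (auto simp: interpolates_def)
  define h where "h p = trig_sum l (\<lambda>n. of_real (tail_prod l (ivec n)) * p (ivec n))" for p :: "real^'a \<Rightarrow> complex"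
  have hT: "h p \<in> trig_polys l" for p by (simp add: h_def trig_polys_eq)
  have hat_h: "of_real (tail_prod l x) * p x = hat (h p) x" "of_real (tail_prod l x) * q x = hat (h q) x" for x
    unfolding h_def by (rule tail_prod_coord_poly[OF p], rule tail_prod_coord_poly[OF q])
  have "(\<lambda>x. h p x - h q x) = (\<lambda>x. 0)"
  proof (rule samples_unique[OF l trig_polys_diff[OF hT hT]])
    fix n :: "int^'a" assume "n \<in> index_cube l"
    then have "p (t n) = q (t n)" using pq by (simp add: interpolates_def)
    then show "hat (\<lambda>x. h p x - h q x) (t n) = 0"
      using hat_h[of "t n"] by (simp add: hat_diff L2_trig_polys[OF hT])
  qed
  then have "h p = h q" by (simp add: fun_eq_iff)
  then have eq: "of_real (tail_prod l x) * p x = of_real (tail_prod l x) * q x" for x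
    unfolding hat_h by simp
  have nodes: "p (ivec n) = q (ivec n)" if "n \<in> index_cube l" for n
    using eq[of "ivec n"] tail_prod_ivec_pos[OF that] by simp
  show "p = q"
  proof
    fix x
    have "p x = (\<Sum>n\<in>index_cube l. p (ivec n) * of_real (lagrange_prod l n x))" by (rule coord_poly_lagrange[OF p])
    also have "\<dots> = (\<Sum>n\<in>index_cube l. q (ivec n) * of_real (lagrange_prod l n x))"
      by (intro sum.cong refl) (simp only: nodes)
    also have "\<dots> = q x" by (rule coord_poly_lagrange[OF q, symmetric])
    finally show "p x = q x" .
  qed
qed

end

section \<open>Convergence on the growing cubes\<close>

lemma sinc_tail_tendsto_1: "(\<lambda>l. sinc_tail l t) \<longlonglongrightarrow> 1"
proof -
  have "filterlim (\<lambda>l. (real l + 1)\<^sup>2 / 2) at_top sequentially" by real_asymp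
  then have "\<forall>\<^sub>F l in sequentially. t\<^sup>2 < (real l + 1)\<^sup>2 / 2" by (simp add: filterlim_at_top_dense)
  then have "\<forall>\<^sub>F l in sequentially. exp (- 2 * t\<^sup>2 / real l) \<le> sinc_tail l t \<and> sinc_tail l t \<le> 1"
    using eventually_ge_at_top[of 1]
  proof eventually_elim
    case (elim l)
    show ?case using sinc_tail_bounds[OF elim(2,1)] by blast
  qed
  then have ev: "\<forall>\<^sub>F l in sequentially. exp (- 2 * t\<^sup>2 / real l) \<le> sinc_tail l t" "\<forall>\<^sub>F l in sequentially. sinc_tail l t \<le> 1"
    unfolding eventually_conj_iff by blast+
  have "(\<lambda>l. exp (- 2 * t\<^sup>2 / real l)) \<longlonglongrightarrow> 1" by real_asymp
  then show ?thesis by (rule tendsto_sandwich[OF ev _ tendsto_const])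
qed

lemma tail_prod_tendsto_1: "(\<lambda>l. tail_prod l x) \<longlonglongrightarrow> 1" for x :: "real^'d::finite"
  using tendsto_prod[of "UNIV :: 'd set" "\<lambda>i l. sinc_tail l (x $ i)" "\<lambda>_. 1"] sinc_tail_tendsto_1
  by (simp add: tail_prod_def)

lemma abs_tail_prod_le_1: "l \<ge> 1 \<Longrightarrow> \<bar>tail_prod l x\<bar> \<le> 1" for x :: "real^'d::finite"
  unfolding tail_prod_def abs_prod by (intro prod_le_1) (simp add: abs_sinc_tail_le_1)

lemma continuous_tail_prod: "continuous_on UNIV (tail_prod l :: real^'d::finite \<Rightarrow> real)"
  unfolding tail_prod_def[abs_def]
  by (intro continuous_intros continuous_on_compose2[OF continuous_on_sinc_tail]) auto

lemma tail_prod_lower: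
  fixes x :: "real^'d::finite"
  assumes l: "l \<ge> 1" and x: "x \<in> cube r" and r: "r\<^sup>2 < (real l + 1)\<^sup>2 / 2"
  shows "exp (- 2 * r\<^sup>2 / real l) ^ CARD('d) \<le> tail_prod l x" "tail_prod l x \<le> 1"
proof -
  have sq: "(x $ i)\<^sup>2 \<le> r\<^sup>2" for i
  proof -
    have "- r \<le> x $ i" "x $ i \<le> r" using x by (auto simp: mem_cube)
    then have "\<bar>x $ i\<bar> \<le> \<bar>r\<bar>" by linarith
    then show ?thesis by (simp only: abs_le_square_iff)
  qed
  have b: "exp (- 2 * (x $ i)\<^sup>2 / real l) \<le> sinc_tail l (x $ i)" "sinc_tail l (x $ i) \<le> 1" for i
    using sinc_tail_bounds[OF l, of "x $ i"] sq[of i] r by linarith+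
  have lo: "exp (- 2 * r\<^sup>2 / real l) \<le> sinc_tail l (x $ i)" for i
  proof -
    have "exp (- 2 * r\<^sup>2 / real l) \<le> exp (- 2 * (x $ i)\<^sup>2 / real l)"
      using sq[of i] l by (simp add: divide_right_mono)
    then show ?thesis using b(1)[of i] by linarith
  qed
  have "(\<Prod>i\<in>(UNIV :: 'd set). exp (- 2 * r\<^sup>2 / real l)) \<le> tail_prod l x"
    unfolding tail_prod_def using lo by (intro prod_mono) (auto simp del: minus_divide_left)
  then show "exp (- 2 * r\<^sup>2 / real l) ^ CARD('d) \<le> tail_prod l x" by simp
  show "tail_prod l x \<le> 1" unfolding tail_prod_def
  proof (intro prod_le_1 conjI b)
    fix i show "0 \<le> sinc_tail l (x $ i)" using lo[of i] exp_ge_zero order_trans by blast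
  qed
qed

lemma continuous_coord_polys: "p \<in> coord_polys m \<Longrightarrow> continuous_on UNIV p" for p :: "real^'d::finite \<Rightarrow> complex"
  unfolding coord_polys_def by (elim CollectE exE) (simp, intro continuous_intros)

lemma L2_cube_continuous:
  fixes f :: "real^'d::finite \<Rightarrow> complex"
  assumes "continuous_on UNIV f" shows "f \<in> L2 (cube r)"
proof -
  have c: "continuous_on (cube r) f" using assms continuous_on_subset by blast
  have "compact (cube r :: (real^'d) set)" by (simp add: cube_def)
  then have "bounded (f ` cube r)" using compact_continuous_image[OF c] compact_imp_bounded by blast
  then obtain B where "\<And>x. x \<in> cube r \<Longrightarrow> cmod (f x) \<le> B" by (auto simp: bounded_iff)
  then show ?thesis using assms
    by (intro L2_cube_bounded borel_measurable_lebesgue_on borel_measurable_continuous_onI)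
qed

lemma Linf_norm_nonneg:
  fixes f :: "real^'d::finite \<Rightarrow> complex"
  assumes "r > 0" "f \<in> borel_measurable (lebesgue_on (cube r))"
  shows "0 \<le> Linf_norm_on (cube r) f"
proof -
  have b: "(\<chi> i. - r) \<bullet> b = - r \<and> (\<chi> i. r) \<bullet> b = r" if "b \<in> Basis" for b :: "real^'d"
    using that by (auto simp: Basis_vec_def inner_axis)
  have "emeasure lborel (cbox (\<chi> i. - r) (\<chi> i. r) :: (real^'d) set) = ennreal (\<Prod>b\<in>Basis. ((\<chi> i. r) - (\<chi> i. - r)) \<bullet> (b :: real^'d))"
    using assms(1) by (intro emeasure_lborel_cbox) (simp add: b)
  moreover have "(\<Prod>b\<in>Basis. ((\<chi> i. r) - (\<chi> i. - r)) \<bullet> (b :: real^'d)) > 0"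
    using assms(1) by (intro prod_pos) (simp add: inner_diff_left b)
  ultimately have "emeasure lborel (cbox (\<chi> i. - r) (\<chi> i. r) :: (real^'d) set) > 0"
    by (simp only: ennreal_less_zero_iff)
  then have "emeasure lebesgue (cube r :: (real^'d) set) \<noteq> 0"
    unfolding cube_def by (subst emeasure_completion) (auto simp del: emeasure_lborel_cbox)
  then have "emeasure (lebesgue_on (cube r :: (real^'d) set)) (space (lebesgue_on (cube r))) \<noteq> 0"
    by (simp add: emeasure_restrict_space)
  then have "esssup (lebesgue_on (cube r :: (real^'d) set)) (\<lambda>x. 0 :: ereal) = 0"
    by (rule esssup_const)
  moreover have "esssup (lebesgue_on (cube r :: (real^'d) set)) (\<lambda>x. 0 :: ereal) \<le> Linf_norm_on (cube r) f"
    unfolding Linf_norm_on_def by (rule esssup_mono) (auto simp: zero_ereal_def)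
  ultimately show ?thesis by simp
qed

lemma Linf_norm_le:
  fixes f :: "real^'d::finite \<Rightarrow> complex"
  assumes "f \<in> borel_measurable (lebesgue_on (cube r))" "\<And>x. x \<in> cube r \<Longrightarrow> cmod (f x) \<le> B"
  shows "Linf_norm_on (cube r) f \<le> ereal B"
  unfolding Linf_norm_on_def using assms by (intro esssup_I AE_I2) auto

lemma L2_norm_dominated:
  assumes g: "g \<in> borel_measurable (lebesgue_on S)" and f: "f \<in> L2 S"
    and le: "\<And>x. x \<in> S \<Longrightarrow> norm (g x) \<le> C * norm (f x)" and C: "C \<ge> 0"
  shows "L2_norm_on S g \<le> C * L2_norm_on S f"
proof (rule power2_le_imp_le)
  have "(\<integral>x. (norm (g x))\<^sup>2 \<partial>lebesgue_on S) \<le> (\<integral>x. C\<^sup>2 * (norm (f x))\<^sup>2 \<partial>lebesgue_on S)"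
  proof (rule integral_mono)
    show "integrable (lebesgue_on S) (\<lambda>x. (norm (g x))\<^sup>2)" by (rule L2_integrable[OF L2_dominated[OF g f le]])
    show "integrable (lebesgue_on S) (\<lambda>x. C\<^sup>2 * (norm (f x))\<^sup>2)" using L2_integrable[OF f] by simp
    fix x assume "x \<in> space (lebesgue_on S)"
    then have "(norm (g x))\<^sup>2 \<le> (C * norm (f x))\<^sup>2" using le by (intro power_mono) auto
    then show "(norm (g x))\<^sup>2 \<le> C\<^sup>2 * (norm (f x))\<^sup>2" by (simp add: power_mult_distrib)
  qed
  then show "(L2_norm_on S g)\<^sup>2 \<le> (C * L2_norm_on S f)\<^sup>2" by (simp add: L2_norm_square power_mult_distrib)
qed (use C in simp)

definition radius :: "real \<Rightarrow> nat \<Rightarrow> real" where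
  "radius A l = A * (real l + 1/2) powr (1/2)"

text \<open>
On these cubes \<open>x\<^sub>i\<^sup>2\<close> is at most a multiple of \<open>l\<close>, so the lower bound \<open>exp (- 2 x\<^sub>i\<^sup>2 / l)\<close> for each factor
does not degenerate as \<open>l\<close> grows. This is where the exponent \<open>1/2\<close> of the half-width enters.
\<close>

lemma tail_prod_on_growing_cubes:
  fixes A :: real
  obtains c where "c > 0"
    "\<forall>\<^sub>F l in sequentially. l \<ge> 1 \<and> (\<forall>x\<in>cube (radius A l) :: (real^'d::finite) set. c \<le> tail_prod l x \<and> tail_prod l x \<le> 1)"
proof
  define c where "c = exp (- (3 * A\<^sup>2)) ^ CARD('d)"
  show "c > 0" by (simp add: c_def)
  have rad2: "(radius A l)\<^sup>2 = A\<^sup>2 * (real l + 1/2)" for l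
    by (simp add: radius_def power_mult_distrib powr_half_sqrt)
  have "\<forall>\<^sub>F l in sequentially. A\<^sup>2 * (real l + 1/2) < (real l + 1)\<^sup>2 / 2" by real_asymp
  then show "\<forall>\<^sub>F l in sequentially. l \<ge> 1 \<and> (\<forall>x\<in>cube (radius A l) :: (real^'d) set. c \<le> tail_prod l x \<and> tail_prod l x \<le> 1)"
    using eventually_ge_at_top[of 1]
  proof eventually_elim
    case (elim l)
    then have sq: "(radius A l)\<^sup>2 < (real l + 1)\<^sup>2 / 2" by (simp add: rad2)
    \<comment> \<open>\<open>2 A\<^sup>2 (l + 1/2) / l \<le> 3 A\<^sup>2\<close> for \<open>l \<ge> 1\<close>\<close>
    have "A\<^sup>2 * 1 \<le> A\<^sup>2 * real l" using elim(2) by (intro mult_left_mono) auto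
    then have "2 * (radius A l)\<^sup>2 / real l \<le> 3 * A\<^sup>2" unfolding rad2 using elim(2) by (simp add: divide_le_eq algebra_simps)
    then have "exp (- (3 * A\<^sup>2)) \<le> exp (- 2 * (radius A l)\<^sup>2 / real l)" by simp
    then have "c \<le> exp (- 2 * (radius A l)\<^sup>2 / real l) ^ CARD('d)" unfolding c_def by (intro power_mono) auto
    then show ?case using tail_prod_lower[OF elim(2) _ sq, where 'd = 'd] elim(2) by (blast intro: order_trans)
  qed
qed

text \<open>
From \<open>z - w = z (1 - 1/R) + (z - R w) / R\<close>.
\<close>

lemma error_le_divided_error:
  fixes z w :: complex
  assumes "0 < c" "c \<le> R" "R \<le> 1"
  shows "cmod (z - w) \<le> cmod z * (1 / R - 1) + 1 / c * cmod (z - of_real R * w)" "0 \<le> 1 / R - 1" "1 / R - 1 \<le> 1 / c"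
proof -
  have R: "R > 0" using assms by linarith
  show nonneg: "0 \<le> 1 / R - 1" using R assms(3) by (simp add: le_divide_eq)
  have inv: "1 / R \<le> 1 / c" using assms R by (intro divide_left_mono) auto
  then show "1 / R - 1 \<le> 1 / c" by linarith
  have "of_real R \<noteq> (0 :: complex)" using R by simp
  then have "z - w = z * of_real (1 - 1 / R) + of_real (1 / R) * (z - of_real R * w)"
    unfolding of_real_diff of_real_divide of_real_1 by (simp add: divide_simps) (simp add: algebra_simps)
  then have "cmod (z - w) \<le> cmod (z * of_real (1 - 1 / R)) + cmod (of_real (1 / R) * (z - of_real R * w))"
    using norm_triangle_ineq by metis
  also have "cmod (z * of_real (1 - 1 / R)) = cmod z * (1 / R - 1)"
    using nonneg by (simp only: norm_mult norm_of_real) simp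
  also have "cmod (of_real (1 / R) * (z - of_real R * w)) \<le> 1 / c * cmod (z - of_real R * w)"
    unfolding norm_mult norm_of_real using inv R by (intro mult_right_mono) auto
  finally show "cmod (z - w) \<le> cmod z * (1 / R - 1) + 1 / c * cmod (z - of_real R * w)" by simp
qed

text \<open>
By \<open>error_le_divided_error\<close> it remains to treat \<open>f (1/R\<^sub>l - 1)\<close> on the cube. It tends to \<open>0\<close> pointwise and is
dominated by a multiple of \<open>f\<close>.
\<close>

lemma remove_tail_L2:
  fixes f :: "real^'d::finite \<Rightarrow> complex"
  assumes fL: "f \<in> L2 UNIV" and fc: "continuous_on UNIV f"
    and pc: "\<And>l. l \<ge> 1 \<Longrightarrow> continuous_on UNIV (p l)"
    and err: "(\<lambda>l. L2_norm_on (cube (radius A l)) (\<lambda>x. f x - of_real (tail_prod l x) * p l x)) \<longlonglongrightarrow> 0"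
  shows "(\<lambda>l. L2_norm_on (cube (radius A l)) (\<lambda>x. f x - p l x)) \<longlonglongrightarrow> 0"
proof -
  obtain c where c0: "c > 0" and ev: "\<forall>\<^sub>F l in sequentially. l \<ge> 1 \<and> (\<forall>x\<in>cube (radius A l) :: (real^'d) set. c \<le> tail_prod l x \<and> tail_prod l x \<le> 1)"
    by (rule tail_prod_on_growing_cubes[of A])
  define good where "good l \<longleftrightarrow> l \<ge> 1 \<and> (\<forall>x\<in>cube (radius A l) :: (real^'d) set. c \<le> tail_prod l x \<and> tail_prod l x \<le> 1)" for l
  note Rc [continuous_intros] = continuous_tail_prod[where 'd = 'd]
  have [measurable]: "tail_prod l \<in> borel_measurable (borel :: (real^'d) measure)" for l by (intro borel_measurable_continuous_onI Rc)
  have [measurable]: "f \<in> borel_measurable borel" by (intro borel_measurable_continuous_onI fc)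
  define W where "W l x = f x * of_real (1 / tail_prod l x - 1)" for l x
  define E where "E l x = of_real (1 / c) * (f x - of_real (tail_prod l x) * p l x)" for l x
  have [measurable]: "W l \<in> borel_measurable borel" for l unfolding W_def[abs_def] by measurable
  have W_norm: "cmod (W l x) = cmod (f x) * (1 / tail_prod l x - 1)" and W_le: "cmod (W l x) \<le> 1 / c * cmod (f x)"
    and le: "cmod (f x - p l x) \<le> cmod (W l x) + cmod (E l x)" if "good l" "x \<in> cube (radius A l)" for l x
  proof -
    have R: "c \<le> tail_prod l x" "tail_prod l x \<le> 1" using that by (auto simp: good_def)
    note e = error_le_divided_error[OF c0 R]
    show W: "cmod (W l x) = cmod (f x) * (1 / tail_prod l x - 1)"
      unfolding W_def norm_mult norm_of_real using e(2) by simp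
    show "cmod (W l x) \<le> 1 / c * cmod (f x)"
      unfolding W using mult_left_mono[OF e(3), of "cmod (f x)"] by simp
    have "cmod (E l x) = 1 / c * cmod (f x - of_real (tail_prod l x) * p l x)"
      unfolding E_def norm_mult norm_of_real using c0 by simp
    then show "cmod (f x - p l x) \<le> cmod (W l x) + cmod (E l x)" unfolding W using e(1)[of "f x" "p l x"] by simp
  qed
  \<comment> \<open>the domain of integration varies with \<open>l\<close>, so dominated convergence is applied on the whole space\<close>
  define F where "F l x = (if good l then indicator (cube (radius A l)) x * (cmod (W l x))\<^sup>2 else 0)" for l x
  have Fm: "F l \<in> borel_measurable lebesgue" for l
    unfolding F_def[abs_def] by (rule measurable_completion) measurable
  have "(\<lambda>l. \<integral>x. F l x \<partial>lebesgue) \<longlonglongrightarrow> (\<integral>x. 0 \<partial>(lebesgue :: (real^'d) measure))"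
  proof (rule integral_dominated_convergence)
    show "integrable lebesgue (\<lambda>x. (1 / c)\<^sup>2 * (cmod (f x))\<^sup>2)"
      using fL by (simp add: L2_UNIV)
    show "AE x in lebesgue. (\<lambda>l. F l x) \<longlonglongrightarrow> 0"
    proof (rule AE_I2)
      fix x :: "real^'d"
      have "(\<lambda>l. cmod (f x * of_real (1 / tail_prod l x - 1))) \<longlonglongrightarrow> cmod (f x * of_real (1 / 1 - 1))"
        by (intro tendsto_intros tail_prod_tendsto_1) simp
      then have "(\<lambda>l. (cmod (W l x))\<^sup>2) \<longlonglongrightarrow> 0"
        unfolding W_def[symmetric] using tendsto_power[of _ 0 sequentially 2] by fastforce
      then show "(\<lambda>l. F l x) \<longlonglongrightarrow> 0"
        by (rule Lim_null_comparison[rotated]) (auto simp: F_def indicator_def)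
    qed
    show "AE x in lebesgue. norm (F l x) \<le> (1 / c)\<^sup>2 * (cmod (f x))\<^sup>2" for l
    proof (rule AE_I2)
      fix x :: "real^'d"
      show "norm (F l x) \<le> (1 / c)\<^sup>2 * (cmod (f x))\<^sup>2"
      proof (cases "good l \<and> x \<in> cube (radius A l)")
        case True
        then have "(cmod (W l x))\<^sup>2 \<le> (1 / c * cmod (f x))\<^sup>2" using W_le by (intro power_mono) auto
        then show ?thesis using True unfolding power_mult_distrib by (simp add: F_def)
      qed (auto simp: F_def)
    qed
  qed (use Fm in auto)
  from tendsto_real_sqrt[OF this] have "(\<lambda>l. sqrt (\<integral>x. F l x \<partial>lebesgue)) \<longlonglongrightarrow> sqrt 0"
    by (simp only: Bochner_Integration.integral_zero)
  from tendsto_add[OF this tendsto_mult_left[OF err, of "1 / c"]]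
  have "(\<lambda>l. sqrt (\<integral>x. F l x \<partial>lebesgue) + 1 / c * L2_norm_on (cube (radius A l)) (\<lambda>x. f x - of_real (tail_prod l x) * p l x)) \<longlonglongrightarrow> 0"
    by simp
  then show ?thesis
  proof (rule Lim_null_comparison[rotated])
    have "\<forall>\<^sub>F l in sequentially. good l" using ev by (simp add: good_def)
    then show "\<forall>\<^sub>F l in sequentially. norm (L2_norm_on (cube (radius A l)) (\<lambda>x. f x - p l x))
       \<le> sqrt (\<integral>x. F l x \<partial>lebesgue) + 1 / c * L2_norm_on (cube (radius A l)) (\<lambda>x. f x - of_real (tail_prod l x) * p l x)"
    proof eventually_elim
      case (elim l)
      let ?Q = "cube (radius A l)"
      have l1: "l \<ge> 1" using elim by (simp add: good_def)
      have WL: "W l \<in> L2 ?Q"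
        by (rule L2_dominated[OF borel_measurable_lebesgue_on L2_cube_continuous[OF fc] W_le[OF elim]]) measurable
      have EL: "E l \<in> L2 ?Q" unfolding E_def[abs_def]
        by (intro L2_cube_continuous continuous_intros fc pc[OF l1])
      \<comment> \<open>the pointwise bound involves moduli, so the triangle inequality is applied to them\<close>
      have aL: "(\<lambda>x. complex_of_real (cmod (h x))) \<in> L2 ?Q \<and> L2_norm_on ?Q (\<lambda>x. complex_of_real (cmod (h x))) = L2_norm_on ?Q h"
        if "h \<in> L2 ?Q" for h using that by (auto simp: L2_def L2_norm_on_def)
      have "L2_norm_on ?Q (\<lambda>x. f x - p l x) \<le> 1 * L2_norm_on ?Q (\<lambda>x. complex_of_real (cmod (W l x)) + complex_of_real (cmod (E l x)))"
      proof (rule L2_norm_dominated)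
        show "(\<lambda>x. f x - p l x) \<in> borel_measurable (lebesgue_on ?Q)"
          by (intro borel_measurable_lebesgue_on borel_measurable_continuous_onI continuous_intros fc pc[OF l1])
        show "(\<lambda>x. complex_of_real (cmod (W l x)) + complex_of_real (cmod (E l x))) \<in> L2 ?Q"
          using aL WL EL by (intro L2_add) auto
        show "cmod (f x - p l x) \<le> 1 * cmod (complex_of_real (cmod (W l x)) + complex_of_real (cmod (E l x)))" if "x \<in> ?Q" for x
          using le[OF elim that] unfolding of_real_add[symmetric] norm_of_real by simp
      qed simp
      also have "\<dots> \<le> L2_norm_on ?Q (W l) + L2_norm_on ?Q (E l)"
        using L2_norm_triangle[of "\<lambda>x. complex_of_real (cmod (W l x))" ?Q "\<lambda>x. complex_of_real (cmod (E l x))"] aL[OF WL] aL[OF EL] by simp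
      also have "L2_norm_on ?Q (W l) = sqrt (\<integral>x. F l x \<partial>lebesgue)"
        using elim by (simp add: L2_norm_on_def F_def integral_restrict_space)
      also have "L2_norm_on ?Q (E l) = 1 / c * L2_norm_on ?Q (\<lambda>x. f x - of_real (tail_prod l x) * p l x)"
        unfolding E_def[abs_def] L2_norm_scale using c0 by (simp add: norm_divide)
      finally show ?case by simp
    qed
  qed
qed

text \<open>
By \<open>error_le_divided_error\<close> it remains to bound \<open>|f| (1/R\<^sub>l - 1)\<close> on the cube. Outside a fixed cube \<open>f\<close> is
small and \<open>1/R\<^sub>l\<close> bounded, and on the fixed cube \<open>R\<^sub>l \<rightarrow> 1\<close> uniformly.
\<close>

lemma remove_tail_Linf:
  fixes f :: "real^'d::finite \<Rightarrow> complex"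
  assumes A: "A > 0" and fc: "continuous_on UNIV f" and bdd: "\<And>x. cmod (f x) \<le> G"
    and vanish: "\<And>e. e > 0 \<Longrightarrow> \<exists>r. \<forall>x. x \<notin> cube r \<longrightarrow> cmod (f x) < e"
    and pc: "\<And>l. l \<ge> 1 \<Longrightarrow> continuous_on UNIV (p l)"
    and err: "\<And>l x. l \<ge> 1 \<Longrightarrow> cmod (f x - of_real (tail_prod l x) * p l x) \<le> U l" "U \<longlonglongrightarrow> 0"
  shows "(\<lambda>l. Linf_norm_on (cube (radius A l)) (\<lambda>x. f x - p l x)) \<longlonglongrightarrow> 0"
proof -
  obtain c where c0: "c > 0" and ev: "\<forall>\<^sub>F l in sequentially. l \<ge> 1 \<and> (\<forall>x\<in>cube (radius A l) :: (real^'d) set. c \<le> tail_prod l x \<and> tail_prod l x \<le> 1)"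
    by (rule tail_prod_on_growing_cubes[of A])
  have m: "(\<lambda>x. f x - p l x) \<in> borel_measurable (lebesgue_on (cube r))" if "l \<ge> 1" for l r
    by (intro borel_measurable_lebesgue_on borel_measurable_continuous_onI continuous_intros fc pc[OF that])
  have small: "\<forall>\<^sub>F l in sequentially. Linf_norm_on (cube (radius A l)) (\<lambda>x. f x - p l x) \<le> ereal e" if e: "e > 0" for e
  proof -
    \<comment> \<open>outside this cube \<open>f\<close> itself is small; inside it the tail is close to \<open>1\<close>\<close>
    obtain r where r: "\<And>x. x \<notin> cube r \<Longrightarrow> cmod (f x) < e * c / 2"
      using vanish[of "e * c / 2"] e c0 by auto
    define m where "m l = exp (- 2 * r\<^sup>2 / real l) ^ CARD('d)" for l :: nat
    have "(\<lambda>l. exp (- 2 * r\<^sup>2 / real l)) \<longlonglongrightarrow> 1" by real_asymp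
    from tendsto_power[OF this] have "m \<longlonglongrightarrow> 1" unfolding m_def by simp
    then have "(\<lambda>l. G * (1 / m l - 1)) \<longlonglongrightarrow> G * (1 / 1 - 1)" by (intro tendsto_intros) auto
    then have ev1: "\<forall>\<^sub>F l in sequentially. G * (1 / m l - 1) < e / 2"
      using e by (intro order_tendstoD) auto
    have "(\<lambda>l. 1 / c * U l) \<longlonglongrightarrow> 1 / c * 0" by (intro tendsto_intros err)
    then have ev2: "\<forall>\<^sub>F l in sequentially. 1 / c * U l < e / 2" using e by (intro order_tendstoD) auto
    have ev3: "\<forall>\<^sub>F l in sequentially. r\<^sup>2 < (real l + 1)\<^sup>2 / 2" by real_asymp
    show ?thesis using ev ev1 ev2 ev3
    proof eventually_elim
      case (elim l)
      have l1: "l \<ge> 1" using elim(1) by blast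
      show ?case
      proof (rule Linf_norm_le[OF m[OF l1]])
        fix x :: "real^'d" assume x: "x \<in> cube (radius A l)"
        have R: "c \<le> tail_prod l x" "tail_prod l x \<le> 1" using elim(1) x by auto
        note e = error_le_divided_error[OF c0 R]
        have "1 / c * cmod (f x - of_real (tail_prod l x) * p l x) \<le> 1 / c * U l"
          using err(1)[OF l1] c0 by (intro mult_left_mono) auto
        then have 1: "1 / c * cmod (f x - of_real (tail_prod l x) * p l x) < e / 2" using elim(3) by linarith
        have 2: "cmod (f x) * (1 / tail_prod l x - 1) < e / 2"
        proof (cases "x \<in> cube r")
          case True
          have "m l > 0" by (simp add: m_def)
          moreover have "m l \<le> tail_prod l x" unfolding m_def by (rule tail_prod_lower(1)[OF l1 True elim(4)])
          ultimately have "1 / tail_prod l x \<le> 1 / m l" by (intro divide_left_mono) auto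
          moreover have "0 \<le> G" using bdd[of x] norm_ge_zero order_trans by blast
          ultimately have "cmod (f x) * (1 / tail_prod l x - 1) \<le> G * (1 / m l - 1)"
            using e(2) bdd by (intro mult_mono) auto
          then show ?thesis using elim(2) by linarith
        next
          case False
          have "cmod (f x) * (1 / tail_prod l x - 1) \<le> cmod (f x) * (1 / c)" using e(3) by (intro mult_left_mono) auto
          also have "\<dots> < e * c / 2 * (1 / c)" using r[OF False] c0 by (intro mult_strict_right_mono) auto
          finally show ?thesis using c0 by simp
        qed
        show "cmod (f x - p l x) \<le> e" using e(1)[of "f x" "p l x"] 1 2 by linarith
      qed
    qed
  qed
  show ?thesis
  proof (rule order_tendstoI)
    fix a :: ereal assume a: "a < 0"
    show "\<forall>\<^sub>F l in sequentially. a < Linf_norm_on (cube (radius A l)) (\<lambda>x. f x - p l x)"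
      using eventually_ge_at_top[of 1]
    proof eventually_elim
      case (elim l)
      have "radius A l > 0" using A by (simp add: radius_def)
      from Linf_norm_nonneg[OF this m[OF elim]] show ?case by (rule less_le_trans[OF a])
    qed
  next
    fix a :: ereal assume "0 < a"
    then obtain e where e: "0 < ereal e" "ereal e < a" using ereal_dense2 by blast
    then have "e > 0" by simp
    from small[OF this] show "\<forall>\<^sub>F l in sequentially. Linf_norm_on (cube (radius A l)) (\<lambda>x. f x - p l x) < a"
      by eventually_elim (rule le_less_trans[OF _ e(2)])
  qed
qed

theorem corollary5p2:
  fixes t :: "int^'d::finite \<Rightarrow> real^'d" and A :: real
  assumes "uniformly_invertible_Riesz_basis (\<lambda>n. exponential (t n))"
    and "A > 0"
  shows "\<forall>f\<in>Paley_Wiener (cube pi).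
    (\<forall>l\<ge>1. \<exists>!p. interpolates t f l p) \<and>
    (\<lambda>l. L2_norm_on (cube (A * (real l + 1/2) powr (1/2))) (\<lambda>x. f x - interp_poly t f l x)) \<longlonglongrightarrow> 0 \<and>
    (\<lambda>l. Linf_norm_on (cube (A * (real l + 1/2) powr (1/2))) (\<lambda>x. f x - interp_poly t f l x)) \<longlonglongrightarrow> 0"
proof
  fix f :: "real^'d \<Rightarrow> complex" assume "f \<in> Paley_Wiener (cube pi)"
  then obtain g where g: "g \<in> L2 (cube pi)" and fL: "f \<in> L2 UNIV" and fg: "f = hat g"
    by (rule Paley_Wiener_hat)
  obtain L where L: "L2_bounded_bijection (cube pi) L" "\<And>n. ae_eq_on (cube pi) (L (lattice_exp n)) (exponential (t n))"
    "\<And>l. l \<ge> 1 \<Longrightarrow> bij_betw (compression l L) (trig_polys l) (trig_polys l)"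
    "(SUP l\<in>{1..}. trig_op_norm l (inv_into (trig_polys l) (compression l L))) < \<infinity>"
    using assms(1) unfolding uniformly_invertible_Riesz_basis_def by blast
  interpret riesz_invertible L t
    by unfold_locales (use L in \<open>auto simp: L2_bounded_bijection_def\<close>)
  have uniq: "\<exists>!p. interpolates t f l p" if "l \<ge> 1" for l
    by (rule interpolation_unique_existence[OF that])
  define p where "p l = interp_poly t f l" for l
  have "interpolates t f l (p l)" if "l \<ge> 1" for l
    unfolding p_def interp_poly_def by (rule theI'[OF uniq[OF that]])
  then have pc: "p l \<in> coord_polys (2 * l)" and pt: "\<And>n. n \<in> index_cube l \<Longrightarrow> p l (t n) = f (t n)" if "l \<ge> 1" for l
    using that by (auto simp: interpolates_def)
  \<comment> \<open>the trigonometric polynomials that belong to the interpolating polynomials\<close>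
  define h where "h l = trig_sum l (\<lambda>n. of_real (tail_prod l (ivec n)) * p l (ivec n))" for l
  have hT: "h l \<in> trig_polys l" for l by (simp add: h_def trig_polys_eq)
  have hat_h: "of_real (tail_prod l x) * p l x = hat (h l) x" if "l \<ge> 1" for l x
    unfolding h_def by (rule tail_prod_coord_poly[OF pc[OF that]])
  define u where "u l x = g x - h l x" for l x
  have uL: "u l \<in> L2 (cube pi)" for l
    unfolding u_def[abs_def] by (intro L2_diff g L2_trig_polys[OF hT])
  define U where "U l = L2_norm_on (cube pi) (u l)" for l
  have U0: "U \<longlonglongrightarrow> 0" unfolding U_def[abs_def] u_def
  proof (rule perturbed_projection_converges[where r = "\<lambda>l n. tail_prod l (t n)", OF g hT])
    show "hat (h l) (t n) = of_real (tail_prod l (t n)) * hat g (t n)" if "l \<ge> 1" "n \<in> index_cube l" for l n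
      using hat_h[OF that(1), of "t n"] pt[OF that] by (simp add: fg)
  qed (auto simp: abs_tail_prod_le_1 tail_prod_tendsto_1)
  have hat_u: "f x - of_real (tail_prod l x) * p l x = hat (u l) x" if "l \<ge> 1" for l x
    unfolding hat_h[OF that] u_def[abs_def] using g L2_trig_polys[OF hT] by (simp add: hat_diff fg)
  have fc: "continuous_on UNIV f" unfolding fg by (rule continuous_hat[OF g])
  have cp: "continuous_on UNIV (p l)" if "l \<ge> 1" for l by (rule continuous_coord_polys[OF pc[OF that]])
  have "(\<lambda>l. L2_norm_on (cube (radius A l)) (\<lambda>x. f x - p l x)) \<longlonglongrightarrow> 0"
  proof (rule remove_tail_L2[OF fL fc cp Lim_null_comparison[OF _ U0]])
    show "\<forall>\<^sub>F l in sequentially. norm (L2_norm_on (cube (radius A l)) (\<lambda>x. f x - of_real (tail_prod l x) * p l x)) \<le> U l"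
      using eventually_ge_at_top[of 1]
    proof eventually_elim
      case (elim l)
      show ?case unfolding hat_u[OF elim] U_def using norm_hat_cube_le[OF uL] by simp
    qed
  qed
  moreover have "(\<lambda>l. Linf_norm_on (cube (radius A l)) (\<lambda>x. f x - p l x)) \<longlonglongrightarrow> 0"
  proof (rule remove_tail_Linf[OF assms(2) fc _ _ cp _ U0])
    show "cmod (f x) \<le> L2_norm_on (cube pi) g" for x unfolding fg by (rule norm_hat_le[OF g])
    show "\<exists>r. \<forall>x. x \<notin> cube r \<longrightarrow> cmod (f x) < e" if "e > 0" for e unfolding fg by (rule hat_vanishes[OF g that])
    show "cmod (f x - of_real (tail_prod l x) * p l x) \<le> U l" if "l \<ge> 1" for l x
      unfolding hat_u[OF that] U_def by (rule norm_hat_le[OF uL])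
  qed
  ultimately show "(\<forall>l\<ge>1. \<exists>!p. interpolates t f l p) \<and>
    (\<lambda>l. L2_norm_on (cube (A * (real l + 1/2) powr (1/2))) (\<lambda>x. f x - interp_poly t f l x)) \<longlonglongrightarrow> 0 \<and>
    (\<lambda>l. Linf_norm_on (cube (A * (real l + 1/2) powr (1/2))) (\<lambda>x. f x - interp_poly t f l x)) \<longlonglongrightarrow> 0"
    using uniq unfolding p_def radius_def by blast
qed

end
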